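(* For every integer $k \ge 2$ there exist a group $G$ and finitely generated projective $\mathbb{Z}G$-modules $P$ and $Q$ such that $P \oplus \mathbb{Z}G \cong Q \oplus \mathbb{Z}G$ and $Q \cong Q_0 \oplus \mathbb{Z}G^k$ for some $\mathbb{Z}G$-module $Q_0$, but $P \not\cong Q$ (all isomorphisms being of $\mathbb{Z}G$-modules).
   Context: $\mathbb{Z}G$ denotes the integral group ring of $G$; modules are left modules. *)

theory Defs
  imports "HOL-Algebra.Module" "HOL-Library.Poly_Mapping"
begin

section \<open>Integral group rings\<close>

text \<open>
  Elements of the group ring are finitely supported functions into the integers whose support
  lies in \<^term>\<open>carrier G\<close>.  The ring structure is given by an explicit record; the
  multiplication that the type class \<^class>\<open>times\<close> puts on finitely supported functions is not used.
\<close>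

definition group_ring_mult ::
    "('g, 'x) monoid_scheme \<Rightarrow> ('g \<Rightarrow>\<^sub>0 int) \<Rightarrow> ('g \<Rightarrow>\<^sub>0 int) \<Rightarrow> ('g \<Rightarrow>\<^sub>0 int)" where
  "group_ring_mult G f h =
     (\<Sum>a\<in>Poly_Mapping.keys f. \<Sum>b\<in>Poly_Mapping.keys h.
        Poly_Mapping.single (a \<otimes>\<^bsub>G\<^esub> b) (Poly_Mapping.lookup f a * Poly_Mapping.lookup h b))"

definition integral_group_ring :: "('g, 'x) monoid_scheme \<Rightarrow> ('g \<Rightarrow>\<^sub>0 int) ring" where
  "integral_group_ring G =
     \<lparr>carrier = {f. Poly_Mapping.keys f \<subseteq> carrier G},
      monoid.mult = group_ring_mult G,
      one = Poly_Mapping.single \<one>\<^bsub>G\<^esub> 1,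
      zero = 0,
      add = (+)\<rparr>"

lemma group_ring_mult_superset:
  assumes "finite A" "finite B" "Poly_Mapping.keys f \<subseteq> A" "Poly_Mapping.keys h \<subseteq> B"
  shows "group_ring_mult G f h =
     (\<Sum>a\<in>A. \<Sum>b\<in>B. Poly_Mapping.single (a \<otimes>\<^bsub>G\<^esub> b) (Poly_Mapping.lookup f a * Poly_Mapping.lookup h b))"
proof -
  have "(\<Sum>b\<in>B. Poly_Mapping.single (a \<otimes>\<^bsub>G\<^esub> b) (Poly_Mapping.lookup f a * Poly_Mapping.lookup h b)) =
        (\<Sum>b\<in>Poly_Mapping.keys h. Poly_Mapping.single (a \<otimes>\<^bsub>G\<^esub> b) (Poly_Mapping.lookup f a * Poly_Mapping.lookup h b))" for a
    by (rule sum.mono_neutral_right) (use assms in \<open>auto simp: in_keys_iff\<close>)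
  moreover have
    "(\<Sum>a\<in>A. \<Sum>b\<in>Poly_Mapping.keys h. Poly_Mapping.single (a \<otimes>\<^bsub>G\<^esub> b) (Poly_Mapping.lookup f a * Poly_Mapping.lookup h b)) =
     (\<Sum>a\<in>Poly_Mapping.keys f. \<Sum>b\<in>Poly_Mapping.keys h. Poly_Mapping.single (a \<otimes>\<^bsub>G\<^esub> b) (Poly_Mapping.lookup f a * Poly_Mapping.lookup h b))"
    by (rule sum.mono_neutral_right) (use assms in \<open>auto simp: in_keys_iff\<close>)
  ultimately show ?thesis
    by (simp add: group_ring_mult_def)
qed

lemma group_ring_mult_add_left:
  "group_ring_mult G (f + g) h = group_ring_mult G f h + group_ring_mult G g h"
proof -
  let ?A = "Poly_Mapping.keys f \<union> Poly_Mapping.keys g \<union> Poly_Mapping.keys (f + g)"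
  have "group_ring_mult G x h =
      (\<Sum>a\<in>?A. \<Sum>b\<in>Poly_Mapping.keys h. Poly_Mapping.single (a \<otimes>\<^bsub>G\<^esub> b) (Poly_Mapping.lookup x a * Poly_Mapping.lookup h b))"
    if "x \<in> {f, g, f + g}" for x
    by (rule group_ring_mult_superset) (use that in auto)
  then show ?thesis
    by (simp add: lookup_add distrib_right single_add sum.distrib)
qed

lemma group_ring_mult_add_right:
  "group_ring_mult G h (f + g) = group_ring_mult G h f + group_ring_mult G h g"
proof -
  let ?A = "Poly_Mapping.keys f \<union> Poly_Mapping.keys g \<union> Poly_Mapping.keys (f + g)"
  have "group_ring_mult G h x =
      (\<Sum>a\<in>Poly_Mapping.keys h. \<Sum>b\<in>?A. Poly_Mapping.single (a \<otimes>\<^bsub>G\<^esub> b) (Poly_Mapping.lookup h a * Poly_Mapping.lookup x b))"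
    if "x \<in> {f, g, f + g}" for x
    by (rule group_ring_mult_superset) (use that in auto)
  then show ?thesis
    by (simp add: lookup_add distrib_left single_add sum.distrib)
qed

lemma group_ring_mult_zero [simp]:
  "group_ring_mult G 0 h = 0" "group_ring_mult G h 0 = 0"
  by (simp_all add: group_ring_mult_def)

lemma group_ring_mult_sum_left:
  "group_ring_mult G (\<Sum>i\<in>I. f i) h = (\<Sum>i\<in>I. group_ring_mult G (f i) h)"
  by (induction I rule: infinite_finite_induct) (simp_all add: group_ring_mult_add_left)

lemma group_ring_mult_sum_right:
  "group_ring_mult G h (\<Sum>i\<in>I. f i) = (\<Sum>i\<in>I. group_ring_mult G h (f i))"
  by (induction I rule: infinite_finite_induct) (simp_all add: group_ring_mult_add_right)

lemma group_ring_mult_single: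
  "group_ring_mult G (Poly_Mapping.single a x) (Poly_Mapping.single b y) =
     Poly_Mapping.single (a \<otimes>\<^bsub>G\<^esub> b) (x * y)"
  by (subst group_ring_mult_superset[of "{a}" "{b}"]) auto

lemma poly_mapping_sum_single:
  "f = (\<Sum>a\<in>Poly_Mapping.keys f. Poly_Mapping.single a (Poly_Mapping.lookup f a))"
  by (rule poly_mapping_eqI)
    (auto simp: lookup_sum lookup_single when_def in_keys_iff)

lemma keys_group_ring_mult:
  assumes "group G" "Poly_Mapping.keys f \<subseteq> carrier G" "Poly_Mapping.keys h \<subseteq> carrier G"
  shows "Poly_Mapping.keys (group_ring_mult G f h) \<subseteq> carrier G"
proof -
  interpret group G by fact
  have "Poly_Mapping.lookup (group_ring_mult G f h) c = 0" if "c \<notin> carrier G" for c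
  proof -
    have "a \<otimes>\<^bsub>G\<^esub> b \<noteq> c" if "a \<in> Poly_Mapping.keys f" "b \<in> Poly_Mapping.keys h" for a b
      using that assms \<open>c \<notin> carrier G\<close> by blast
    then show ?thesis
      by (auto simp: group_ring_mult_def lookup_sum lookup_single when_def intro!: sum.neutral)
  qed
  then show ?thesis
    by (auto simp: in_keys_iff)
qed

lemma group_ring_mult_assoc:
  assumes "group G" "Poly_Mapping.keys f \<subseteq> carrier G" "Poly_Mapping.keys g \<subseteq> carrier G" "Poly_Mapping.keys h \<subseteq> carrier G"
  shows "group_ring_mult G (group_ring_mult G f g) h = group_ring_mult G f (group_ring_mult G g h)"
proof -
  interpret group G by fact
  let ?s = Poly_Mapping.single
  have right: "group_ring_mult G x h =
      (\<Sum>c\<in>Poly_Mapping.keys h. group_ring_mult G x (?s c (Poly_Mapping.lookup h c)))" for x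
    by (metis group_ring_mult_sum_right poly_mapping_sum_single)
  have left: "group_ring_mult G f x =
      (\<Sum>a\<in>Poly_Mapping.keys f. group_ring_mult G (?s a (Poly_Mapping.lookup f a)) x)" for x
    by (metis group_ring_mult_sum_left poly_mapping_sum_single)
  have "group_ring_mult G (group_ring_mult G f g) h =
    (\<Sum>a\<in>Poly_Mapping.keys f. \<Sum>b\<in>Poly_Mapping.keys g. \<Sum>c\<in>Poly_Mapping.keys h.
       ?s (a \<otimes>\<^bsub>G\<^esub> b \<otimes>\<^bsub>G\<^esub> c) (Poly_Mapping.lookup f a * Poly_Mapping.lookup g b * Poly_Mapping.lookup h c))"
    by (simp add: right sum.swap[of _ _ "Poly_Mapping.keys h"] group_ring_mult_def[of G f g]
        group_ring_mult_sum_left group_ring_mult_single)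
  also have "\<dots> = (\<Sum>a\<in>Poly_Mapping.keys f. \<Sum>b\<in>Poly_Mapping.keys g. \<Sum>c\<in>Poly_Mapping.keys h.
       ?s (a \<otimes>\<^bsub>G\<^esub> (b \<otimes>\<^bsub>G\<^esub> c)) (Poly_Mapping.lookup f a * (Poly_Mapping.lookup g b * Poly_Mapping.lookup h c)))"
    using assms by (intro sum.cong refl) (auto simp: m_assoc mult.assoc subset_iff)
  also have "\<dots> = group_ring_mult G f (group_ring_mult G g h)"
    by (subst left) (simp add: group_ring_mult_def[of G g h] group_ring_mult_sum_right
        group_ring_mult_single)
  finally show ?thesis .
qed

lemma group_ring_mult_one:
  assumes "group G" "Poly_Mapping.keys f \<subseteq> carrier G"
  shows "group_ring_mult G (Poly_Mapping.single \<one>\<^bsub>G\<^esub> 1) f = f"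
    and "group_ring_mult G f (Poly_Mapping.single \<one>\<^bsub>G\<^esub> 1) = f"
proof -
  interpret group G by fact
  have "group_ring_mult G (Poly_Mapping.single \<one>\<^bsub>G\<^esub> 1) f =
      (\<Sum>a\<in>Poly_Mapping.keys f. Poly_Mapping.single a (Poly_Mapping.lookup f a))"
    using assms by (auto simp: group_ring_mult_def intro!: sum.cong)
  then show "group_ring_mult G (Poly_Mapping.single \<one>\<^bsub>G\<^esub> 1) f = f"
    by (simp flip: poly_mapping_sum_single)
  have "group_ring_mult G f (Poly_Mapping.single \<one>\<^bsub>G\<^esub> 1) =
      (\<Sum>a\<in>Poly_Mapping.keys f. Poly_Mapping.single a (Poly_Mapping.lookup f a))"
    using assms by (auto simp: group_ring_mult_def intro!: sum.cong)
  then show "group_ring_mult G f (Poly_Mapping.single \<one>\<^bsub>G\<^esub> 1) = f"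
    by (simp flip: poly_mapping_sum_single)
qed

lemma ring_integral_group_ring:
  assumes "group G"
  shows "ring (integral_group_ring G)"
proof -
  interpret group G by fact
  have keys_add: "Poly_Mapping.keys (x + y) \<subseteq> carrier G"
    if "Poly_Mapping.keys x \<subseteq> carrier G" "Poly_Mapping.keys y \<subseteq> carrier G" for x y :: "'a \<Rightarrow>\<^sub>0 int"
    using that keys_add[of x y] by blast
  show ?thesis
  proof (rule ringI)
    show "abelian_group (integral_group_ring G)"
    proof (rule abelian_groupI)
      fix x assume "x \<in> carrier (integral_group_ring G)"
      then show "\<exists>y\<in>carrier (integral_group_ring G).
          y \<oplus>\<^bsub>integral_group_ring G\<^esub> x = \<zero>\<^bsub>integral_group_ring G\<^esub>"
        by (intro bexI[of _ "- x"]) (auto simp: integral_group_ring_def)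
    qed (auto simp: integral_group_ring_def add.assoc add.commute keys_add[THEN subsetD])
    show "monoid (integral_group_ring G)"
      by (rule monoidI)
        (use assms in \<open>simp_all add: integral_group_ring_def keys_group_ring_mult
          group_ring_mult_assoc group_ring_mult_one\<close>)
  qed (simp_all add: integral_group_ring_def group_ring_mult_add_left group_ring_mult_add_right)
qed


section \<open>Left modules over a not necessarily commutative ring\<close>

text \<open>
  The locale \<^locale>\<open>module\<close> requires a commutative base ring.  We keep its record type, whose
  fields \<^const>\<open>monoid.mult\<close> and \<^const>\<open>monoid.one\<close> are irrelevant for modules, and its axioms.
\<close>

locale left_module = R?: ring R + M?: abelian_group M
    for R :: "('r, 'x) ring_scheme" (structure) and M :: "('r, 'm, 'y) module_scheme" (structure) +
  assumes smult_closed [simp, intro]: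
      "\<lbrakk>a \<in> carrier R; x \<in> carrier M\<rbrakk> \<Longrightarrow> a \<odot>\<^bsub>M\<^esub> x \<in> carrier M"
    and smult_l_distr:
      "\<lbrakk>a \<in> carrier R; b \<in> carrier R; x \<in> carrier M\<rbrakk> \<Longrightarrow>
        (a \<oplus> b) \<odot>\<^bsub>M\<^esub> x = a \<odot>\<^bsub>M\<^esub> x \<oplus>\<^bsub>M\<^esub> b \<odot>\<^bsub>M\<^esub> x"
    and smult_r_distr:
      "\<lbrakk>a \<in> carrier R; x \<in> carrier M; y \<in> carrier M\<rbrakk> \<Longrightarrow>
        a \<odot>\<^bsub>M\<^esub> (x \<oplus>\<^bsub>M\<^esub> y) = a \<odot>\<^bsub>M\<^esub> x \<oplus>\<^bsub>M\<^esub> a \<odot>\<^bsub>M\<^esub> y"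
    and smult_assoc1:
      "\<lbrakk>a \<in> carrier R; b \<in> carrier R; x \<in> carrier M\<rbrakk> \<Longrightarrow>
        (a \<otimes> b) \<odot>\<^bsub>M\<^esub> x = a \<odot>\<^bsub>M\<^esub> (b \<odot>\<^bsub>M\<^esub> x)"
    and smult_one [simp]: "x \<in> carrier M \<Longrightarrow> \<one> \<odot>\<^bsub>M\<^esub> x = x"

definition left_module_hom ::
    "('r, 'x) ring_scheme \<Rightarrow> ('r, 'm, 'y) module_scheme \<Rightarrow> ('r, 'n, 'z) module_scheme \<Rightarrow> ('m \<Rightarrow> 'n) set"
  where
  "left_module_hom R M N =
     {f \<in> carrier M \<rightarrow> carrier N.
        (\<forall>x\<in>carrier M. \<forall>y\<in>carrier M. f (x \<oplus>\<^bsub>M\<^esub> y) = f x \<oplus>\<^bsub>N\<^esub> f y) \<and>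
        (\<forall>r\<in>carrier R. \<forall>x\<in>carrier M. f (r \<odot>\<^bsub>M\<^esub> x) = r \<odot>\<^bsub>N\<^esub> f x)}"

definition left_module_isomorphic ::
    "('r, 'x) ring_scheme \<Rightarrow> ('r, 'm, 'y) module_scheme \<Rightarrow> ('r, 'n, 'z) module_scheme \<Rightarrow> bool" where
  "left_module_isomorphic R M N \<longleftrightarrow>
     (\<exists>f\<in>left_module_hom R M N. bij_betw f (carrier M) (carrier N))"

definition direct_sum ::
    "('r, 'm, 'y) module_scheme \<Rightarrow> ('r, 'n, 'z) module_scheme \<Rightarrow> ('r, 'm \<times> 'n) module" where
  "direct_sum M N =
     \<lparr>carrier = carrier M \<times> carrier N,
      monoid.mult = undefined,
      one = undefined,
      zero = (\<zero>\<^bsub>M\<^esub>, \<zero>\<^bsub>N\<^esub>),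
      add = (\<lambda>(x, y) (x', y'). (x \<oplus>\<^bsub>M\<^esub> x', y \<oplus>\<^bsub>N\<^esub> y')),
      smult = (\<lambda>r (x, y). (r \<odot>\<^bsub>M\<^esub> x, r \<odot>\<^bsub>N\<^esub> y))\<rparr>"

definition regular_module :: "('r, 'x) ring_scheme \<Rightarrow> ('r, 'r) module" where
  "regular_module R =
     \<lparr>carrier = carrier R, monoid.mult = (\<otimes>\<^bsub>R\<^esub>), one = \<one>\<^bsub>R\<^esub>,
      zero = \<zero>\<^bsub>R\<^esub>, add = (\<oplus>\<^bsub>R\<^esub>), smult = (\<otimes>\<^bsub>R\<^esub>)\<rparr>"

definition free_module_of_rank :: "('r, 'x) ring_scheme \<Rightarrow> nat \<Rightarrow> ('r, nat \<Rightarrow> 'r) module" where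
  "free_module_of_rank R n =
     \<lparr>carrier = (\<Pi>\<^sub>E i\<in>{..<n}. carrier R),
      monoid.mult = undefined,
      one = undefined,
      zero = (\<lambda>i\<in>{..<n}. \<zero>\<^bsub>R\<^esub>),
      add = (\<lambda>x y. \<lambda>i\<in>{..<n}. x i \<oplus>\<^bsub>R\<^esub> y i),
      smult = (\<lambda>r x. \<lambda>i\<in>{..<n}. r \<otimes>\<^bsub>R\<^esub> x i)\<rparr>"

definition finitely_generated_module ::
    "('r, 'x) ring_scheme \<Rightarrow> ('r, 'm, 'y) module_scheme \<Rightarrow> bool" where
  "finitely_generated_module R M \<longleftrightarrow>
     (\<exists>S. finite S \<and> S \<subseteq> carrier M \<and>
        (\<forall>x\<in>carrier M. \<exists>c\<in>S \<rightarrow> carrier R. x = (\<Oplus>\<^bsub>M\<^esub>s\<in>S. c s \<odot>\<^bsub>M\<^esub> s)))"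

text \<open>
  Projectivity is the lifting property.  A definition cannot quantify over types, so the test
  modules \<open>A\<close> and \<open>B\<close> have to live on fixed types.  The types chosen are large enough to test
  against the canonical surjection from the free module on \<^term>\<open>carrier P\<close> onto \<open>P\<close>; lemma
  \<open>projective_module_lift\<close> below shows that the lifting property then holds for test modules on
  arbitrary types.
\<close>

definition projective_module ::
    "('r, 'x) ring_scheme \<Rightarrow> ('r, 'm) module \<Rightarrow> bool" where
  "projective_module R P \<longleftrightarrow>
     (\<forall>(A :: ('r, 'm \<Rightarrow> 'r) module) (B :: ('r, 'm) module).
        left_module R A \<longrightarrow> left_module R B \<longrightarrow>
        (\<forall>f\<in>left_module_hom R A B. \<forall>g\<in>left_module_hom R P B.
           f ` carrier A = carrier B \<longrightarrow>
           (\<exists>h\<in>left_module_hom R P A. \<forall>x\<in>carrier P. f (h x) = g x)))"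


subsection \<open>Basic facts\<close>

lemma left_module_direct_sum:
  assumes "left_module R M" "left_module R N"
  shows "left_module R (direct_sum M N)"
proof -
  interpret M: left_module R M by fact
  interpret N: left_module R N by fact
  show ?thesis
  proof (intro left_module.intro left_module_axioms.intro)
    show "abelian_group (direct_sum M N)"
    proof (rule abelian_groupI)
      fix z assume "z \<in> carrier (direct_sum M N)"
      then show "\<exists>w\<in>carrier (direct_sum M N).
          w \<oplus>\<^bsub>direct_sum M N\<^esub> z = \<zero>\<^bsub>direct_sum M N\<^esub>"
        by (intro bexI[of _ "(\<ominus>\<^bsub>M\<^esub> fst z, \<ominus>\<^bsub>N\<^esub> snd z)"])
          (auto simp: direct_sum_def M.M.l_neg N.M.l_neg)
    qed (auto simp: direct_sum_def M.M.a_ac N.M.a_ac)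
  qed (auto simp: direct_sum_def M.smult_l_distr N.smult_l_distr M.smult_r_distr N.smult_r_distr
      M.smult_assoc1 N.smult_assoc1 intro: M.R.ring_axioms)
qed

lemma left_module_regular_module:
  assumes "ring R"
  shows "left_module R (regular_module R)"
proof -
  interpret ring R by fact
  show ?thesis
  proof (intro left_module.intro left_module_axioms.intro)
    show "abelian_group (regular_module R)"
      by (rule abelian_groupI)
        (auto simp: regular_module_def a_ac intro!: bexI[of _ "\<ominus>\<^bsub>R\<^esub> _"] l_neg)
  qed (auto simp: regular_module_def l_distr r_distr m_assoc intro: assms)
qed

lemma left_module_free_module_of_rank:
  assumes "ring R"
  shows "left_module R (free_module_of_rank R n)"
proof -
  interpret ring R by fact
  show ?thesis
  proof (intro left_module.intro left_module_axioms.intro)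
    show "abelian_group (free_module_of_rank R n)"
    proof (rule abelian_groupI)
      fix x assume "x \<in> carrier (free_module_of_rank R n)"
      then show "\<exists>y\<in>carrier (free_module_of_rank R n).
          y \<oplus>\<^bsub>free_module_of_rank R n\<^esub> x = \<zero>\<^bsub>free_module_of_rank R n\<^esub>"
        by (intro bexI[of _ "\<lambda>i\<in>{..<n}. \<ominus>\<^bsub>R\<^esub> x i"])
          (auto simp: free_module_of_rank_def PiE_iff l_neg intro!: restrict_ext)
    qed (auto simp: free_module_of_rank_def PiE_iff a_ac extensional_def fun_eq_iff)
  qed (auto simp: free_module_of_rank_def PiE_iff l_distr r_distr m_assoc extensional_def fun_eq_iff
      intro: assms)
qed

text \<open>The free module on an arbitrary set, used only for the universality lemma.\<close>

definition free_module_on :: "('r, 'x) ring_scheme \<Rightarrow> 'i set \<Rightarrow> ('r, 'i \<Rightarrow> 'r) module" where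
  "free_module_on R I =
     \<lparr>carrier = {c. (\<forall>i. c i \<in> carrier R) \<and> finite {i. c i \<noteq> \<zero>\<^bsub>R\<^esub>} \<and> {i. c i \<noteq> \<zero>\<^bsub>R\<^esub>} \<subseteq> I},
      monoid.mult = undefined,
      one = undefined,
      zero = (\<lambda>i. \<zero>\<^bsub>R\<^esub>),
      add = (\<lambda>x y i. x i \<oplus>\<^bsub>R\<^esub> y i),
      smult = (\<lambda>r x i. r \<otimes>\<^bsub>R\<^esub> x i)\<rparr>"

lemma left_module_free_module_on:
  assumes "ring R"
  shows "left_module R (free_module_on R I)"
proof -
  interpret ring R by fact
  let ?supp = "\<lambda>c. {i. c i \<noteq> \<zero>\<^bsub>R\<^esub>}"
  have add: "?supp (\<lambda>i. x i \<oplus>\<^bsub>R\<^esub> y i) \<subseteq> ?supp x \<union> ?supp y" for x y :: "'c \<Rightarrow> 'a"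
    by auto
  have smult: "?supp (\<lambda>i. r \<otimes>\<^bsub>R\<^esub> x i) \<subseteq> ?supp x" if "r \<in> carrier R" for r and x :: "'c \<Rightarrow> 'a"
    using that by auto
  have neg: "?supp (\<lambda>i. \<ominus>\<^bsub>R\<^esub> x i) \<subseteq> ?supp x" for x :: "'c \<Rightarrow> 'a"
    by auto
  have add_closed: "x \<oplus>\<^bsub>free_module_on R I\<^esub> y \<in> carrier (free_module_on R I)"
    if "x \<in> carrier (free_module_on R I)" "y \<in> carrier (free_module_on R I)" for x y
    using that finite_subset[OF add[of x y]] add[of x y] by (auto simp: free_module_on_def)
  have smult_closed: "r \<odot>\<^bsub>free_module_on R I\<^esub> x \<in> carrier (free_module_on R I)"
    if "r \<in> carrier R" "x \<in> carrier (free_module_on R I)" for r x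
    using that finite_subset[OF smult[of r x]] smult[of r x] by (auto simp: free_module_on_def)
  show ?thesis
  proof (intro left_module.intro left_module_axioms.intro)
    show "abelian_group (free_module_on R I)"
    proof (rule abelian_groupI)
      fix x assume x: "x \<in> carrier (free_module_on R I)"
      have "(\<lambda>i. \<ominus>\<^bsub>R\<^esub> x i) \<in> carrier (free_module_on R I)"
        using x finite_subset[OF neg[of x]] neg[of x] by (auto simp: free_module_on_def)
      then show "\<exists>y\<in>carrier (free_module_on R I).
          y \<oplus>\<^bsub>free_module_on R I\<^esub> x = \<zero>\<^bsub>free_module_on R I\<^esub>"
        using x by (intro bexI[of _ "\<lambda>i. \<ominus>\<^bsub>R\<^esub> x i"]) (auto simp: free_module_on_def l_neg)
    qed (auto simp: add_closed, auto simp: free_module_on_def a_ac)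
  qed (auto simp: smult_closed assms, auto simp: free_module_on_def l_distr r_distr m_assoc)
qed

lemma (in left_module) smult_l_null [simp]: "x \<in> carrier M \<Longrightarrow> \<zero> \<odot>\<^bsub>M\<^esub> x = \<zero>\<^bsub>M\<^esub>"
  by (metis M.add.l_cancel_one' R.add.one_closed R.l_zero smult_closed smult_l_distr)

lemma (in left_module) smult_r_null [simp]: "a \<in> carrier R \<Longrightarrow> a \<odot>\<^bsub>M\<^esub> \<zero>\<^bsub>M\<^esub> = \<zero>\<^bsub>M\<^esub>"
  by (metis M.add.l_cancel_one' M.add.one_closed M.l_zero smult_closed smult_r_distr)

lemma (in left_module) finsum_smult_ldistr:
  "\<lbrakk>finite A; a \<in> carrier R; f \<in> A \<rightarrow> carrier M\<rbrakk> \<Longrightarrow>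
     a \<odot>\<^bsub>M\<^esub> (\<Oplus>\<^bsub>M\<^esub>i\<in>A. f i) = (\<Oplus>\<^bsub>M\<^esub>i\<in>A. a \<odot>\<^bsub>M\<^esub> f i)"
  by (induction A rule: finite_induct) (auto simp: Pi_def smult_r_distr)

lemma left_module_hom_comp:
  assumes "f \<in> left_module_hom R L M" "g \<in> left_module_hom R M N"
  shows "(\<lambda>x. g (f x)) \<in> left_module_hom R L N"
  using assms by (auto simp: left_module_hom_def Pi_iff)

lemma (in left_module) hom_finsum:
  assumes "left_module R N" "f \<in> left_module_hom R M N" "finite A" "u \<in> A \<rightarrow> carrier M"
  shows "f (\<Oplus>\<^bsub>M\<^esub>i\<in>A. u i) = (\<Oplus>\<^bsub>N\<^esub>i\<in>A. f (u i))"
proof -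
  interpret N: left_module R N by fact
  have f: "f x \<in> carrier N" if "x \<in> carrier M" for x
    using assms(2) that by (auto simp: left_module_hom_def)
  have "f \<zero>\<^bsub>M\<^esub> = f (\<zero> \<odot>\<^bsub>M\<^esub> \<zero>\<^bsub>M\<^esub>)"
    by simp
  also have "\<dots> = \<zero> \<odot>\<^bsub>N\<^esub> f \<zero>\<^bsub>M\<^esub>"
    using assms(2) R.zero_closed M.zero_closed unfolding left_module_hom_def by blast
  finally have "f \<zero>\<^bsub>M\<^esub> = \<zero>\<^bsub>N\<^esub>"
    by (simp add: f)
  with assms(3,4) show ?thesis
  proof (induction A rule: finite_induct)
    case (insert i A)
    then have "u i \<in> carrier M" "(\<Oplus>\<^bsub>M\<^esub>i\<in>A. u i) \<in> carrier M"
      by auto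
    then have "f (u i \<oplus>\<^bsub>M\<^esub> (\<Oplus>\<^bsub>M\<^esub>i\<in>A. u i)) = f (u i) \<oplus>\<^bsub>N\<^esub> f (\<Oplus>\<^bsub>M\<^esub>i\<in>A. u i)"
      using assms(2) unfolding left_module_hom_def by blast
    with insert show ?case
      by (auto simp: f Pi_iff)
  qed simp
qed

lemma (in left_module) linear_extension:
  assumes v: "v \<in> I \<rightarrow> carrier M"
  defines "L \<equiv> \<lambda>c. \<Oplus>\<^bsub>M\<^esub>i\<in>{i. c i \<noteq> \<zero>}. c i \<odot>\<^bsub>M\<^esub> v i"
  shows "L \<in> left_module_hom R (free_module_on R I) M"
proof -
  let ?F = "free_module_on R I"
  interpret F: left_module R ?F
    by (rule left_module_free_module_on) (rule R.ring_axioms)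
  have carr: "c i \<in> carrier R" "finite {i. c i \<noteq> \<zero>}" "{i. c i \<noteq> \<zero>} \<subseteq> I"
    if "c \<in> carrier ?F" for c i
    using that by (auto simp: free_module_on_def)
  have v': "v i \<in> carrier M" if "i \<in> I" for i
    using v that by blast
  have coeff: "c i \<in> carrier R" if "c \<in> carrier ?F" for c i
    using that by (rule carr)
  have F_add: "(c \<oplus>\<^bsub>?F\<^esub> d) i = c i \<oplus> d i" and F_smult: "(r \<odot>\<^bsub>?F\<^esub> c) i = r \<otimes> c i" for c d r i
    by (simp_all add: free_module_on_def)
  have L: "L c = (\<Oplus>\<^bsub>M\<^esub>i\<in>A. c i \<odot>\<^bsub>M\<^esub> v i)"
    if "c \<in> carrier ?F" "finite A" "{i. c i \<noteq> \<zero>} \<subseteq> A" "A \<subseteq> I" for c A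
    unfolding L_def using that v' coeff[OF that(1)]
    by (intro M.add.finprod_mono_neutral_cong_left) (auto simp: subset_iff)
  show ?thesis
    unfolding left_module_hom_def
  proof (intro CollectI conjI ballI)
    show "L \<in> carrier ?F \<rightarrow> carrier M"
    proof
      fix c assume c: "c \<in> carrier ?F"
      show "L c \<in> carrier M"
        unfolding L_def using v' coeff[OF c] carr(3)[OF c] by (intro M.finsum_closed) auto
    qed
  next
    fix c d assume cd: "c \<in> carrier ?F" "d \<in> carrier ?F"
    define A where "A = {i. c i \<noteq> \<zero>} \<union> {i. d i \<noteq> \<zero>}"
    have A: "finite A" "A \<subseteq> I" "{i. c i \<noteq> \<zero>} \<subseteq> A" "{i. d i \<noteq> \<zero>} \<subseteq> A"
      using carr[OF cd(1)] carr[OF cd(2)] by (auto simp: A_def)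
    have vA: "v i \<in> carrier M" if "i \<in> A" for i
      using that A(2) v' by blast
    have "{i. (c \<oplus>\<^bsub>?F\<^esub> d) i \<noteq> \<zero>} \<subseteq> A"
      by (auto simp: F_add A_def)
    then have "L (c \<oplus>\<^bsub>?F\<^esub> d) = (\<Oplus>\<^bsub>M\<^esub>i\<in>A. (c \<oplus>\<^bsub>?F\<^esub> d) i \<odot>\<^bsub>M\<^esub> v i)"
      using A cd by (intro L) auto
    also have "\<dots> = (\<Oplus>\<^bsub>M\<^esub>i\<in>A. c i \<odot>\<^bsub>M\<^esub> v i \<oplus>\<^bsub>M\<^esub> d i \<odot>\<^bsub>M\<^esub> v i)"
      using vA coeff[OF cd(1)] coeff[OF cd(2)]
      by (intro M.finsum_cong') (auto simp: F_add smult_l_distr)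
    also have "\<dots> = (\<Oplus>\<^bsub>M\<^esub>i\<in>A. c i \<odot>\<^bsub>M\<^esub> v i) \<oplus>\<^bsub>M\<^esub> (\<Oplus>\<^bsub>M\<^esub>i\<in>A. d i \<odot>\<^bsub>M\<^esub> v i)"
      using vA coeff[OF cd(1)] coeff[OF cd(2)] by (intro M.finsum_addf) auto
    also have "\<dots> = L c \<oplus>\<^bsub>M\<^esub> L d"
      by (simp only: L[OF cd(1) A(1,3,2)] L[OF cd(2) A(1,4,2)])
    finally show "L (c \<oplus>\<^bsub>?F\<^esub> d) = L c \<oplus>\<^bsub>M\<^esub> L d" .
  next
    fix r c assume rc: "r \<in> carrier R" "c \<in> carrier ?F"
    define A where "A = {i. c i \<noteq> \<zero>}"
    have A: "finite A" "A \<subseteq> I" "{i. c i \<noteq> \<zero>} \<subseteq> A"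
      using carr[OF rc(2)] by (auto simp: A_def)
    have vA: "v i \<in> carrier M" if "i \<in> A" for i
      using that A(2) v' by blast
    have "{i. (r \<odot>\<^bsub>?F\<^esub> c) i \<noteq> \<zero>} \<subseteq> A"
      using rc(1) by (auto simp: F_smult A_def)
    then have "L (r \<odot>\<^bsub>?F\<^esub> c) = (\<Oplus>\<^bsub>M\<^esub>i\<in>A. (r \<odot>\<^bsub>?F\<^esub> c) i \<odot>\<^bsub>M\<^esub> v i)"
      using A rc by (intro L) auto
    also have "\<dots> = (\<Oplus>\<^bsub>M\<^esub>i\<in>A. r \<odot>\<^bsub>M\<^esub> (c i \<odot>\<^bsub>M\<^esub> v i))"
      using vA rc(1) coeff[OF rc(2)]
      by (intro M.finsum_cong') (auto simp: F_smult smult_assoc1)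
    also have "\<dots> = r \<odot>\<^bsub>M\<^esub> L c"
      unfolding L[OF rc(2) A(1,3,2)] using A(1) vA rc(1) coeff[OF rc(2)]
      by (intro finsum_smult_ldistr[symmetric]) auto
    finally show "L (r \<odot>\<^bsub>?F\<^esub> c) = r \<odot>\<^bsub>M\<^esub> L c" .
  qed
qed

lemma projective_module_lift:
  assumes P: "left_module R P" "projective_module R P"
    and A: "left_module R A" and B: "left_module R B"
    and f: "f \<in> left_module_hom R A B" "f ` carrier A = carrier B"
    and g: "g \<in> left_module_hom R P B"
  shows "\<exists>h\<in>left_module_hom R P A. \<forall>x\<in>carrier P. f (h x) = g x"
proof -
  interpret P: left_module R P by fact
  interpret A: left_module R A by fact
  interpret B: left_module R B by fact
  let ?F = "free_module_on R (carrier P)"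
  interpret F: left_module R ?F
    by (rule left_module_free_module_on) (rule P.R.ring_axioms)
  define L where "L = (\<lambda>c. \<Oplus>\<^bsub>P\<^esub>i\<in>{i. c i \<noteq> \<zero>\<^bsub>R\<^esub>}. c i \<odot>\<^bsub>P\<^esub> i)"
  have L: "L \<in> left_module_hom R ?F P"
    using P.linear_extension[of "\<lambda>x. x" "carrier P"] by (simp add: L_def)
  have "x \<in> L ` carrier ?F" if x: "x \<in> carrier P" for x
  proof (cases "\<one>\<^bsub>R\<^esub> = \<zero>\<^bsub>R\<^esub>")
    case True
    then have "x = \<zero>\<^bsub>P\<^esub>"
      using x by (metis P.smult_one P.smult_l_null)
    moreover have "L \<zero>\<^bsub>?F\<^esub> = \<zero>\<^bsub>P\<^esub>"
      by (simp add: L_def free_module_on_def)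
    ultimately show ?thesis
      using F.M.zero_closed by (metis imageI)
  next
    case False
    let ?c = "\<lambda>i. if i = x then \<one>\<^bsub>R\<^esub> else \<zero>\<^bsub>R\<^esub>"
    have supp: "{i. ?c i \<noteq> \<zero>\<^bsub>R\<^esub>} = {x}"
      using False by auto
    have "?c \<in> carrier ?F"
      using x by (auto simp: free_module_on_def)
    moreover have "L ?c = x"
      unfolding L_def supp using x by simp
    ultimately show ?thesis
      by (metis imageI)
  qed
  moreover have "L ` carrier ?F \<subseteq> carrier P"
    using L by (auto simp: left_module_hom_def)
  ultimately have "L ` carrier ?F = carrier P"
    by blast
  moreover have "(\<lambda>x. x) \<in> left_module_hom R P P"
    by (simp add: left_module_hom_def)
  ultimately have "\<exists>s\<in>left_module_hom R P ?F. \<forall>x\<in>carrier P. L (s x) = x"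
    using P(2)[unfolded projective_module_def, rule_format,
        OF F.left_module_axioms P.left_module_axioms L] by blast
  then obtain s where s: "s \<in> left_module_hom R P ?F" "\<And>x. x \<in> carrier P \<Longrightarrow> L (s x) = x"
    by blast
  have "\<exists>a\<in>carrier A. f a = g p" if "p \<in> carrier P" for p
  proof -
    have "g p \<in> f ` carrier A"
      using that g unfolding f(2) by (auto simp: left_module_hom_def)
    then show ?thesis
      by auto
  qed
  then obtain v where v: "\<And>p. p \<in> carrier P \<Longrightarrow> v p \<in> carrier A \<and> f (v p) = g p"
    by metis
  define H where "H = (\<lambda>c. \<Oplus>\<^bsub>A\<^esub>i\<in>{i. c i \<noteq> \<zero>\<^bsub>R\<^esub>}. c i \<odot>\<^bsub>A\<^esub> v i)"
  have H: "H \<in> left_module_hom R ?F A"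
    unfolding H_def by (rule A.linear_extension) (use v in auto)
  have fH: "f (H c) = g (L c)" if c: "c \<in> carrier ?F" for c
  proof -
    have c': "c i \<in> carrier R" "finite {i. c i \<noteq> \<zero>\<^bsub>R\<^esub>}" "{i. c i \<noteq> \<zero>\<^bsub>R\<^esub>} \<subseteq> carrier P" for i
      using c by (auto simp: free_module_on_def)
    have "f (H c) = (\<Oplus>\<^bsub>B\<^esub>i\<in>{i. c i \<noteq> \<zero>\<^bsub>R\<^esub>}. f (c i \<odot>\<^bsub>A\<^esub> v i))"
      unfolding H_def using c' v by (intro A.hom_finsum B f(1)) auto
    also have "\<dots> = (\<Oplus>\<^bsub>B\<^esub>i\<in>{i. c i \<noteq> \<zero>\<^bsub>R\<^esub>}. g (c i \<odot>\<^bsub>P\<^esub> i))"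
    proof (rule B.M.finsum_cong')
      show "(\<lambda>i. g (c i \<odot>\<^bsub>P\<^esub> i)) \<in> {i. c i \<noteq> \<zero>\<^bsub>R\<^esub>} \<rightarrow> carrier B"
        using c' g by (auto simp: left_module_hom_def Pi_iff subset_iff)
      fix i assume "i \<in> {i. c i \<noteq> \<zero>\<^bsub>R\<^esub>}"
      then have "i \<in> carrier P"
        using c' by blast
      then show "f (c i \<odot>\<^bsub>A\<^esub> v i) = g (c i \<odot>\<^bsub>P\<^esub> i)"
        using c'(1)[of i] v[of i] f(1) g by (auto simp: left_module_hom_def)
    qed simp
    also have "\<dots> = g (L c)"
      unfolding L_def using c' by (intro P.hom_finsum[symmetric] B g) auto
    finally show ?thesis .
  qed
  have "s x \<in> carrier ?F" if "x \<in> carrier P" for x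
    using s(1) that by (auto simp: left_module_hom_def)
  then have "\<forall>x\<in>carrier P. f (H (s x)) = g x"
    by (simp add: fH s(2))
  then show ?thesis
    by (intro bexI[OF _ left_module_hom_comp[OF s(1) H]])
qed


section \<open>Choice of types\<close>

text \<open>
  An existential statement about groups and modules has to name the types on which they live.
  Group elements are taken from \<^typ>\<open>nat\<close> and module elements from
  \<^typ>\<open>nat \<Rightarrow> nat \<Rightarrow>\<^sub>0 int\<close>.  Nothing is lost.  Finitely generated modules over the group ring of a
  countable group are countable, so up to isomorphism they live on these types.  An example of
  projective modules over an arbitrary group descends to a countable subgroup: choose one that
  contains the supports of all coefficients of the finitely many matrices (idempotents and mutually
  inverse isomorphisms) that describe it.  Non-isomorphism descends as well, because an isomorphism
  over the subgroup would induce one over the whole group.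
\<close>

end

theory Submission
  imports Defs Complex_Main "HOL-Library.Countable" "HOL-Library.Countable_Set"
begin

text \<open>
  Let \<open>K = \<langle>x, y | x y = y\<^sup>-\<^sup>1 x\<rangle>\<close> be the Klein bottle group and \<open>G\<close> a free product of copies of \<open>K\<close>.
  For \<open>r = 1 + y - y\<^sup>3\<close> and its image \<open>r'\<close> under \<open>y \<mapsto> y\<^sup>-\<^sup>1\<close>, the relation \<open>r' (x + 1) = x r + r'\<close> and the
  coprimality of \<open>r\<close> and \<open>r'\<close> show that \<open>(r, x + 1)\<close> is unimodular over \<open>\<int>K\<close>.  Its kernel is stably free
  of rank one.  It is not free, even over a field \<open>F\<close>: it is isomorphic to the left ideal
  \<open>I = {a. a r \<in> FK (x + 1)}\<close>, and comparing degrees in \<open>x\<close> of elements of \<open>FK\<close> shows that \<open>I\<close> is not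
  principal.  In the domain \<open>FK\<close> this means that a nonzero linear form on \<open>I\<close> is injective and never takes
  a nonzero scalar value.

  Inducing these modules from \<open>k\<close> different factors up to \<open>G\<close> and adding them gives \<open>P\<close>, which is the kernel
  of one unimodular column of length \<open>k + 1\<close>, so \<open>P \<oplus> \<int>G \<cong> \<int>G\<^sup>k \<oplus> \<int>G\<close>.  An isomorphism of \<open>P\<close> with \<open>\<int>G\<^sup>k\<close>
  would give linear maps \<open>\<phi>\<^sub>j : I \<rightarrow> FG\<close>, \<open>j < k\<close>, whose images generate the unit left ideal.  As in Bergman's
  work on coproducts of rings, look at the longest words in such a relation: some \<open>\<phi>\<^sub>i\<close> has
  the leading part of one value contained in the leading parts of the left ideal generated by
  the other images.  The rigidity of \<open>I\<close> then forces this for all of \<open>\<phi>\<^sub>i\<close>, so subtracting a suitable map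
  lowers the degree of \<open>\<phi>\<^sub>i\<close> without changing the left ideal.  The descent ends with a contradiction.
\<close>

section \<open>Free powers of a group\<close>

abbreviation reduced :: "(nat \<times> 'h::group_add) list \<Rightarrow> bool" where
  "reduced w \<equiv> successively (\<lambda>p q. fst p \<noteq> fst q) w \<and> (\<forall>p\<in>set w. snd p \<noteq> 0)"

text \<open>Left multiplication of a normal form by one letter. Defining the product through this
  action, as in van der Waerden's argument, avoids choosing an order of reductions in an arbitrary
  word.\<close>

fun lcons :: "nat \<times> 'h \<Rightarrow> (nat \<times> 'h::group_add) list \<Rightarrow> (nat \<times> 'h) list" where
  "lcons (i, a) [] = (if a = 0 then [] else [(i, a)])"
| "lcons (i, a) ((j, b) # w) =
     (if a = 0 then (j, b) # w
      else if i = j then (if a + b = 0 then w else (i, a + b) # w)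
      else (i, a) # (j, b) # w)"

lemma lcons_zero [simp]: "lcons (i, 0) w = w"
  by (cases w) auto

lemma reduced_lcons: "reduced w \<Longrightarrow> reduced (lcons p w)"
  by (induction p w rule: lcons.induct) (auto simp: successively_Cons)

text \<open>The letters of one factor act on reduced words; associativity of the free product rests
  on this. The delicate case is that \<open>b\<close> cancels the first letter: the letter behind it
  belongs to another factor, so \<open>a\<close> can be put in front without a further
  merge.\<close>

lemma lcons_lcons: "reduced w \<Longrightarrow> lcons (i, a) (lcons (i, b) w) = lcons (i, a + b) w"
proof (cases w)
  case (Cons p w')
  assume red: "reduced w"
  obtain j c where p: "p = (j, c)"
    by (cases p)
  show ?thesis
  proof (cases "i = j \<and> b \<noteq> 0 \<and> b + c = 0")
    case True
    then have "a + b = 0 \<longleftrightarrow> a = c" "a + b + c = a"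
      by (metis add.inverse_unique neg_eq_iff_add_eq_0 add.inverse_inverse,
          simp add: add.assoc)
    moreover have "w' = [] \<or> fst (hd w') \<noteq> i"
      using red Cons p True by (cases w') auto
    ultimately show ?thesis
      using True red Cons p by (cases w') (auto simp: add.assoc)
  next
    case False
    have "x + y = x \<longleftrightarrow> y = 0" for x y :: 'a
      by (metis add.right_neutral add_left_cancel)
    with False show ?thesis
      using red Cons p by (auto simp: add.assoc neg_eq_iff_add_eq_0[symmetric])
  qed
qed (auto simp: add.assoc)

lemma reduced_foldr: "reduced v \<Longrightarrow> reduced (foldr lcons u v)"
  by (induction u) (auto simp: reduced_lcons)

lemma foldr_lcons_append: "reduced (u @ v) \<Longrightarrow> foldr lcons u v = u @ v"
proof (induction u)
  case (Cons p u)
  then show ?case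
    by (cases p; cases "u @ v") (auto simp: successively_Cons)
qed simp

text \<open>The acting word may be normalized first or applied letter by letter, with the same
  effect. This is the induction step for associativity.\<close>

lemma foldr_lcons: "reduced u \<Longrightarrow> reduced w \<Longrightarrow> foldr lcons (lcons p u) w = lcons p (foldr lcons u w)"
  by (induction p u rule: lcons.induct) (auto simp: lcons_lcons reduced_foldr)

lemma foldr_foldr_lcons:
  "reduced v \<Longrightarrow> reduced w \<Longrightarrow> foldr lcons (foldr lcons u v) w = foldr lcons u (foldr lcons v w)"
  by (induction u) (auto simp: foldr_lcons reduced_foldr)

lemma foldr_lcons_inverse:
  "reduced w \<Longrightarrow> foldr lcons (rev (map (\<lambda>(i, a). (i, - a)) u)) (foldr lcons u w) = w"
proof (induction u)
  case (Cons p u)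
  then show ?case
    by (cases p) (simp add: lcons_lcons reduced_foldr)
qed simp

text \<open>There is one copy of the group for each natural number, so that the same group serves
  all \<open>k\<close>. Elements are the normal forms themselves, from which lengths and prefixes
  can be read off. The notation is additive, though the group need not be commutative, because the
  product of finitely supported functions adds keys.\<close>

typedef (overloaded) 'h free_power = "{w :: (nat \<times> 'h::group_add) list. reduced w}"
  morphisms word Word
  by (rule exI[of _ "[]"]) simp

setup_lifting type_definition_free_power

lemma reduced_word: "reduced (word g)"
  using word[of g] by simp

instantiation free_power :: (group_add) group_add
begin

lift_definition zero_free_power :: "'a free_power" is "[]"
  by simp

lift_definition plus_free_power :: "'a free_power \<Rightarrow> 'a free_power \<Rightarrow> 'a free_power"
  is "foldr lcons"
  by (rule reduced_foldr)

lift_definition uminus_free_power :: "'a free_power \<Rightarrow> 'a free_power"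
  is "\<lambda>u. foldr lcons (rev (map (\<lambda>(i, a). (i, - a)) u)) []"
  by (rule reduced_foldr) simp

definition minus_free_power :: "'a free_power \<Rightarrow> 'a free_power \<Rightarrow> 'a free_power" where
  "minus_free_power g h = g + - h"

instance
proof
  fix a b c :: "'a free_power"
  show "a + b + c = a + (b + c)"
    by transfer (simp add: foldr_foldr_lcons)
  show "0 + a = a"
    by transfer simp
  show "a + 0 = a"
    by transfer (simp add: foldr_lcons_append)
  show "- a + a = 0"
  proof transfer
    fix u :: "(nat \<times> 'a) list"
    assume "reduced u"
    then show "foldr lcons (foldr lcons (rev (map (\<lambda>(i, a). (i, - a)) u)) []) u = []"
      using foldr_lcons_inverse[of "[]" u] foldr_lcons_append[of u "[]"]
      by (simp add: foldr_foldr_lcons)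
  qed
  show "a + - b = a - b"
    by (simp add: minus_free_power_def)
qed

end

instance free_power :: ("{group_add, countable}") countable
  by (rule countable_classI[of "\<lambda>g. to_nat (word g)"]) (simp add: word_inject)

section \<open>Word length and the embedded factors\<close>

definition fp_length :: "'h::group_add free_power \<Rightarrow> nat" where
  "fp_length g = length (word g)"

definition factor :: "nat \<Rightarrow> 'h::group_add \<Rightarrow> 'h free_power" where
  "factor i a = Word (if a = 0 then [] else [(i, a)])"

lemma word_factor: "word (factor i a) = (if a = 0 then [] else [(i, a)])"
  by (simp add: factor_def Word_inverse)

lemma word_zero [simp]: "word 0 = []"
  by (rule zero_free_power.rep_eq)

lemma word_plus: "word (g + h) = foldr lcons (word g) (word h)"
  by (rule plus_free_power.rep_eq)

lemma word_factor_plus: "word (factor i a + g) = lcons (i, a) (word g)"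
  by (simp add: word_plus word_factor)

lemma factor_zero [simp]: "factor i 0 = 0"
  by (rule word_inject[THEN iffD1]) (simp add: word_factor)

lemma factor_add: "factor i (a + b) = factor i a + factor i b"
  by (rule word_inject[THEN iffD1]) (auto simp: word_factor_plus word_factor)

lemma factor_uminus: "factor i (- a) = - factor i a"
  by (metis add.right_inverse factor_add factor_zero minus_unique)

lemma fp_length_plus_le: "fp_length (g + h) \<le> fp_length g + fp_length h"
proof -
  have lcons: "length (lcons p w) \<le> Suc (length w)" for p and w :: "(nat \<times> 'a) list"
    by (induction p w rule: lcons.induct) auto
  have "length (foldr lcons u w) \<le> length u + length w" for u w :: "(nat \<times> 'a) list"
  proof (induction u)
    case (Cons p u)
    then show ?case
      using lcons[of p "foldr lcons u w"] by simp
  qed simp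
  then show ?thesis
    by (simp add: fp_length_def word_plus)
qed

section \<open>Cosets of a factor\<close>

definition starts_with :: "nat \<Rightarrow> 'h::group_add free_power \<Rightarrow> bool" where
  "starts_with i g \<longleftrightarrow> word g \<noteq> [] \<and> fst (hd (word g)) = i"

definition ends_with :: "nat \<Rightarrow> 'h::group_add free_power \<Rightarrow> bool" where
  "ends_with i g \<longleftrightarrow> word g \<noteq> [] \<and> fst (last (word g)) = i"

text \<open>With \<open>coset_rep\<close> this splits \<open>g\<close> along the cosets of factor
  \<open>i\<close> under left translation. The representative is the shortest element of its coset,
  and the head is \<open>0\<close> exactly when \<open>g\<close> is its own representative.\<close>

definition coset_head :: "nat \<Rightarrow> 'h::group_add free_power \<Rightarrow> 'h" where
  "coset_head i g = (if starts_with i g then snd (hd (word g)) else 0)"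

definition coset_rep :: "nat \<Rightarrow> 'h::group_add free_power \<Rightarrow> 'h free_power" where
  "coset_rep i g = (if starts_with i g then Word (tl (word g)) else g)"

lemma word_coset_rep: "word (coset_rep i g) = (if starts_with i g then tl (word g) else word g)"
proof -
  have "reduced (tl (word g))"
    using reduced_word[of g] by (cases "word g") (auto simp: successively_Cons)
  then show ?thesis
    by (simp add: coset_rep_def Word_inverse)
qed

text \<open>The letters that meet lie in different factors, so nothing merges and lengths
  add.\<close>

lemma word_plus_append:
  assumes "\<not> ends_with i g" "starts_with i h"
  shows "word (g + h) = word g @ word h"
  unfolding word_plus
  using assms reduced_word[of g] reduced_word[of h]
  by (intro foldr_lcons_append) (auto simp: successively_append_iff starts_with_def ends_with_def)

lemma word_factor_plus':
  assumes "\<not> starts_with i g" "a \<noteq> 0"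
  shows "word (factor i a + g) = (i, a) # word g"
  using assms by (cases "word g") (auto simp: word_factor_plus starts_with_def)

lemma not_starts_with_coset_rep: "\<not> starts_with i (coset_rep i g)"
  using reduced_word[of g]
  by (cases "word g"; cases "tl (word g)")
    (auto simp: word_coset_rep starts_with_def)

lemma coset_decomp: "factor i (coset_head i g) + coset_rep i g = g"
proof (cases "starts_with i g")
  case True
  have "coset_head i g \<noteq> 0"
    using True reduced_word[of g] by (auto simp: coset_head_def starts_with_def)
  then have "word (factor i (coset_head i g) + coset_rep i g) = word g"
    using True
    by (subst word_factor_plus') (auto simp: not_starts_with_coset_rep word_coset_rep,
        cases "word g", auto simp: starts_with_def coset_head_def)
  then show ?thesis
    by (simp add: word_inject)
qed (simp add: coset_head_def coset_rep_def)

lemma coset_decomp_unique: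
  assumes "\<not> starts_with i w"
  shows "coset_head i (factor i a + w) = a" "coset_rep i (factor i a + w) = w"
proof -
  have "coset_head i (factor i a + w) = a \<and> coset_rep i (factor i a + w) = w"
  proof (cases "a = 0")
    case False
    then have "word (factor i a + w) = (i, a) # word w"
      using assms by (rule word_factor_plus'[rotated])
    then show ?thesis
      by (simp add: coset_head_def coset_rep_def starts_with_def word_inverse)
  qed (use assms in \<open>simp add: coset_head_def coset_rep_def\<close>)
  then show "coset_head i (factor i a + w) = a" "coset_rep i (factor i a + w) = w"
    by auto
qed

lemma coset_factor_plus:
  "coset_head i (factor i a + g) = a + coset_head i g"
  "coset_rep i (factor i a + g) = coset_rep i g"
proof -
  have "factor i a + g = factor i (a + coset_head i g) + coset_rep i g"
    by (simp add: factor_add add.assoc coset_decomp)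
  then show "coset_head i (factor i a + g) = a + coset_head i g"
    "coset_rep i (factor i a + g) = coset_rep i g"
    using coset_decomp_unique[OF not_starts_with_coset_rep[of i g]] by auto
qed

lemma fp_length_coset_rep:
  "fp_length g = fp_length (coset_rep i g) + (if starts_with i g then 1 else 0)"
  by (auto simp: fp_length_def word_coset_rep starts_with_def)

text \<open>The mirror image for right translation. It serves to push a factor element from a
  coefficient into the argument of a factor linear map.\<close>

lemma right_coset_decomp:
  obtains u a where "g = u + factor i a" "\<not> ends_with i u"
proof (cases "ends_with i g")
  case True
  then obtain w a where w: "word g = w @ [(i, a)]"
    by (cases "word g" rule: rev_cases) (auto simp: ends_with_def)
  have red: "reduced w" and last: "w = [] \<or> fst (last w) \<noteq> i" and a: "a \<noteq> 0"
    using reduced_word[of g] by (auto simp: w successively_append_iff)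
  have u: "\<not> ends_with i (Word w)"
    using red last by (simp add: ends_with_def Word_inverse)
  have "word (Word w + factor i a) = w @ [(i, a)]"
    using red a by (subst word_plus_append[OF u]) (auto simp: starts_with_def word_factor Word_inverse)
  then have "g = Word w + factor i a"
    by (simp add: w flip: word_inject)
  with u show ?thesis
    using that by blast
next
  case False
  then show ?thesis
    using that[of g 0] by simp
qed

section \<open>Group rings\<close>

abbreviation (input) "lookup \<equiv> Poly_Mapping.lookup"
abbreviation (input) "keys \<equiv> Poly_Mapping.keys"
abbreviation (input) "single \<equiv> Poly_Mapping.single"

text \<open>There is no separate case for \<open>0\<close>, which is \<open>single\<close> with
  coefficient \<open>0\<close>.\<close>

lemma poly_mapping_additive_induct [case_names single add]:
  fixes f :: "'g \<Rightarrow>\<^sub>0 'a::comm_monoid_add"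
  assumes "\<And>k c. P (single k c)" "\<And>f g. P f \<Longrightarrow> P g \<Longrightarrow> P (f + g)"
  shows "P f"
proof -
  have P0: "P 0"
    using assms(1)[of undefined 0] by simp
  have "P (\<Sum>k\<in>A. single k (lookup f k))" if "finite A" for A
    using that by (induction A rule: finite_induct) (auto intro: assms P0)
  then show ?thesis
    by (subst poly_mapping_sum_single) simp
qed

lemma lookup_single_mult:
  fixes s :: "'g::group_add \<Rightarrow>\<^sub>0 'a::semiring_0"
  shows "lookup (single u c * s) t = c * lookup s (- u + t)"
proof (induction s rule: poly_mapping_additive_induct)
  case (single k d)
  have "u + k = t \<longleftrightarrow> k = - u + t"
    by (metis add.assoc add_0 left_minus right_minus)
  then show ?case
    by (auto simp: mult_single lookup_single when_def)
qed (simp add: distrib_left lookup_add)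

text \<open>One construction for all changes of group and coefficients: embedding a factor, passing
  from the integers to a field, and renaming group elements by natural numbers.\<close>

definition pm_map :: "('g \<Rightarrow> 'h) \<Rightarrow> ('a \<Rightarrow> 'b) \<Rightarrow> ('g \<Rightarrow>\<^sub>0 'a::zero) \<Rightarrow> 'h \<Rightarrow>\<^sub>0 'b::comm_monoid_add" where
  "pm_map g c f = (\<Sum>k\<in>keys f. single (g k) (c (lookup f k)))"

locale ring_hom_1 =
  fixes c :: "'a::ring_1 \<Rightarrow> 'b::ring_1"
  assumes add: "c (x + y) = c x + c y"
    and mult: "c (x * y) = c x * c y"
    and one: "c 1 = 1"
begin

lemma zero: "c 0 = 0"
  using add[of 0 0] by simp

lemma pm_map_superset:
  assumes "finite A" "keys f \<subseteq> A"
  shows "pm_map g c f = (\<Sum>k\<in>A. single (g k) (c (lookup f k)))"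
  unfolding pm_map_def by (rule sum.mono_neutral_left) (use assms in \<open>auto simp: in_keys_iff zero\<close>)

lemma pm_map_single: "pm_map g c (single k x) = single (g k) (c x)"
  by (subst pm_map_superset[of "{k}"]) auto

lemma pm_map_add: "pm_map g c (f + f') = pm_map g c f + pm_map g c f'"
  by (subst (1 2 3) pm_map_superset[of "keys f \<union> keys f' \<union> keys (f + f')"])
    (auto simp: lookup_add add single_add sum.distrib)

lemma pm_map_mult:
  fixes g :: "'g::monoid_add \<Rightarrow> 'h::monoid_add"
  assumes "\<And>a b. g (a + b) = g a + g b"
  shows "pm_map g c (f * f') = pm_map g c f * pm_map g c f'"
proof (induction f rule: poly_mapping_additive_induct)
  case (single k x)
  show ?case
    by (induction f' rule: poly_mapping_additive_induct)
      (simp_all add: mult_single pm_map_single assms mult distrib_left pm_map_add)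
qed (simp add: distrib_right pm_map_add)

lemma pm_map_hom:
  fixes g :: "'g::group_add \<Rightarrow> 'h::group_add"
  assumes "\<And>a b. g (a + b) = g a + g b"
  shows "ring_hom_1 (pm_map g c)"
proof
  have "g 0 + g 0 = g 0 + 0"
    using assms[of 0 0] by simp
  then have "g 0 = 0"
    by (rule add_left_imp_eq)
  then show "pm_map g c 1 = 1"
    using pm_map_single[of g 0 1] by (simp add: one)
qed (simp_all add: pm_map_add pm_map_mult assms)

end

section \<open>Left ideals generated by a set\<close>

inductive_set left_ideal :: "'r::ring_1 set \<Rightarrow> 'r set" for X where
  zero: "0 \<in> left_ideal X"
| add_mult: "x \<in> left_ideal X \<Longrightarrow> y \<in> X \<Longrightarrow> x + s * y \<in> left_ideal X"

lemma left_ideal_gen: "y \<in> X \<Longrightarrow> s * y \<in> left_ideal X"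
  using left_ideal.add_mult[OF left_ideal.zero, of y X s] by simp

lemma left_ideal_incl: "y \<in> X \<Longrightarrow> y \<in> left_ideal X"
  using left_ideal_gen[of y X 1] by simp

lemma left_ideal_add: "y \<in> left_ideal X \<Longrightarrow> x \<in> left_ideal X \<Longrightarrow> x + y \<in> left_ideal X"
  by (induction rule: left_ideal.induct) (auto simp: add.assoc[symmetric] intro: left_ideal.intros)

lemma left_ideal_mult: "x \<in> left_ideal X \<Longrightarrow> s * x \<in> left_ideal X"
  by (induction rule: left_ideal.induct)
    (auto simp: distrib_left mult.assoc[symmetric] intro: left_ideal.intros)

lemma left_ideal_sum: "(\<And>i. i \<in> A \<Longrightarrow> f i \<in> left_ideal X) \<Longrightarrow> sum f A \<in> left_ideal X"
  by (induction A rule: infinite_finite_induct) (auto intro: left_ideal.zero left_ideal_add)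

lemma left_ideal_subset: "X \<subseteq> left_ideal Y \<Longrightarrow> left_ideal X \<subseteq> left_ideal Y"
proof
  fix x
  assume sub: "X \<subseteq> left_ideal Y" and "x \<in> left_ideal X"
  from this(2) show "x \<in> left_ideal Y"
    by (induction rule: left_ideal.induct) (use sub in \<open>auto intro: left_ideal.zero left_ideal_add left_ideal_mult\<close>)
qed

lemma left_ideal_mono: "X \<subseteq> Y \<Longrightarrow> left_ideal X \<subseteq> left_ideal Y"
  using left_ideal_incl by (intro left_ideal_subset) blast

section \<open>Unimodular elements over a free power\<close>

text \<open>For a torsion-free module of rank one such as \<open>I\<close>, this says that linear forms on \<open>I\<close> are injective
  and never attain a nonzero scalar, that is, \<open>I\<close> has no free direct summand.\<close>

definition rigid :: "('h::group_add \<Rightarrow>\<^sub>0 'a::field) set \<Rightarrow> bool" where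
  "rigid I \<longleftrightarrow> 0 \<in> I \<and> (\<forall>a\<in>I. \<forall>b\<in>I. a + b \<in> I) \<and> (\<forall>c. \<forall>a\<in>I. c * a \<in> I) \<and>
     (\<forall>\<psi>. (\<forall>a\<in>I. \<forall>b\<in>I. \<psi> (a + b) = \<psi> a + (\<psi> b :: 'h \<Rightarrow>\<^sub>0 'a)) \<longrightarrow> (\<forall>c. \<forall>a\<in>I. \<psi> (c * a) = c * \<psi> a) \<longrightarrow>
        (\<exists>p\<in>I. p \<noteq> 0 \<and> keys (\<psi> p) \<subseteq> {0}) \<longrightarrow> (\<forall>a\<in>I. \<psi> a = 0))"

text \<open>Linearity over the group ring of factor \<open>i\<close>, asked for monomial scalars
  only; on an ideal, additivity extends it to all scalars.\<close>

definition factor_linear ::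
    "nat \<Rightarrow> ('h::group_add \<Rightarrow>\<^sub>0 'a::field) set \<Rightarrow> (('h \<Rightarrow>\<^sub>0 'a) \<Rightarrow> ('h free_power \<Rightarrow>\<^sub>0 'a)) \<Rightarrow> bool" where
  "factor_linear i I \<phi> \<longleftrightarrow> (\<forall>a\<in>I. \<forall>b\<in>I. \<phi> (a + b) = \<phi> a + \<phi> b) \<and>
     (\<forall>h c. \<forall>a\<in>I. \<phi> (single h c * a) = single (factor i h) c * \<phi> a)"

text \<open>The degree measures the coset representative and not the whole word, so left
  multiplication by factor \<open>i\<close> does not change it.\<close>

definition coset_degree_le :: "nat \<Rightarrow> nat \<Rightarrow> ('h::group_add free_power \<Rightarrow>\<^sub>0 'a::zero) \<Rightarrow> bool" where
  "coset_degree_le i d s \<longleftrightarrow> (\<forall>k\<in>keys s. fp_length (coset_rep i k) \<le> d)"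

lemma vector_space_scalars:
  "vector_space (\<lambda>c (s :: 'g::group_add \<Rightarrow>\<^sub>0 'a::field). single 0 c * s)"
  by standard
    (simp_all add: distrib_left distrib_right single_add mult_single mult.assoc[symmetric])

lemma coset_degree_le_diff:
  fixes s t :: "'h::group_add free_power \<Rightarrow>\<^sub>0 'a::ab_group_add"
  shows "coset_degree_le i d s \<Longrightarrow> coset_degree_le i d t \<Longrightarrow> coset_degree_le i d (s - t)"
  by (force simp: coset_degree_le_def in_keys_iff lookup_minus)

text \<open>Words that do not start in factor \<open>i\<close> are the coset representatives. This
  is thus the degree \<open>d\<close> part of the component with coset head \<open>0\<close>; the
  other components are reached by translation.\<close>

definition top_part :: "nat \<Rightarrow> nat \<Rightarrow> ('h::group_add free_power \<Rightarrow>\<^sub>0 'a::comm_monoid_add) \<Rightarrow> ('h free_power \<Rightarrow>\<^sub>0 'a)" where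
  "top_part i d s = (\<Sum>k\<in>{k\<in>keys s. fp_length k = d \<and> \<not> starts_with i k}. single k (lookup s k))"

lemma lookup_top_part:
  "lookup (top_part i d s) w = (if fp_length w = d \<and> \<not> starts_with i w then lookup s w else 0)"
  by (auto simp: top_part_def lookup_sum lookup_single when_def in_keys_iff)

text \<open>A section of \<open>top_part\<close> on \<open>V\<close>, applied to every coset component, subtracts from the
  component of degree \<open>d\<close> its part in the space of top parts of elements of \<open>V\<close>.\<close>

lemma top_reduction:
  fixes V :: "('h::group_add free_power \<Rightarrow>\<^sub>0 'a::field) set"
  assumes V0: "0 \<in> V" and V_add: "\<And>x y. x \<in> V \<Longrightarrow> y \<in> V \<Longrightarrow> x + y \<in> V"
    and V_scale: "\<And>c x. x \<in> V \<Longrightarrow> single 0 c * x \<in> V"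
    and V_len: "\<And>x k. x \<in> V \<Longrightarrow> k \<in> keys x \<Longrightarrow> fp_length k \<le> d"
  shows "\<exists>T. (\<forall>s s'. T (s + s') = T s + T s') \<and>
    (\<forall>h c s. T (single (factor i h) c * s) = single (factor i h) c * T s) \<and>
    (\<forall>s. T s \<in> left_ideal V) \<and> (\<forall>s. coset_degree_le i d (T s)) \<and>
    (\<forall>s h. (\<exists>y\<in>V. \<forall>w. fp_length w = d \<longrightarrow> \<not> starts_with i w \<longrightarrow> lookup s (factor i h + w) = lookup y w) \<longrightarrow>
       (\<forall>w. fp_length w = d \<longrightarrow> \<not> starts_with i w \<longrightarrow>
          lookup (T s) (factor i h + w) = lookup s (factor i h + w)))"
proof -
  let ?S = "\<lambda>c (s :: 'h free_power \<Rightarrow>\<^sub>0 'a). single 0 c * s"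
  interpret vector_space ?S
    by (rule vector_space_scalars)
  interpret pair: vector_space_pair ?S ?S ..
  have lin: "Vector_Spaces.linear ?S ?S (top_part i d)"
    by (auto simp: Vector_Spaces.linear_iff vector_space_axioms lookup_top_part lookup_add
        lookup_single_mult intro!: poly_mapping_eqI)
  have "subspace V"
    by (auto simp: subspace_def V0 V_add V_scale)
  \<comment> \<open>\<open>g\<close> chooses, linearly over the field, an element of
    \<open>V\<close> with a prescribed top part whenever that part comes from
    \<open>V\<close>.\<close>
  from pair.linear_exists_right_inverse_on[OF lin this]
  obtain g where g: "range g \<subseteq> V" "Vector_Spaces.linear ?S ?S g"
    and g_inv: "\<And>v. v \<in> V \<Longrightarrow> top_part i d (g (top_part i d v)) = top_part i d v"
    by blast
  have g_add: "g (x + y) = g x + g y" and g_scale: "g (?S c x) = ?S c (g x)" for x y c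
    using g(2) by (simp_all add: Vector_Spaces.linear_iff)
  have gV: "g x \<in> V" for x
    using g(1) by blast
  \<comment> \<open>For a representative of length \<open>d\<close> the head is removed,
    \<open>g\<close> is applied, and the head is put back. This makes \<open>T\<close> linear over
    the group ring of factor \<open>i\<close>.\<close>
  define T0 where "T0 k = (if fp_length (coset_rep i k) = d
      then single (factor i (coset_head i k)) 1 * g (single (coset_rep i k) 1) else 0)" for k
  define T where "T s = (\<Sum>k\<in>keys s. ?S (lookup s k) (T0 k))" for s
  have T_superset: "T s = (\<Sum>k\<in>A. ?S (lookup s k) (T0 k))" if "finite A" "keys s \<subseteq> A" for s A
    unfolding T_def by (rule sum.mono_neutral_left) (use that in \<open>auto simp: in_keys_iff\<close>)
  have T_add: "T (s + s') = T s + T s'" for s s'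
    by (subst (1 2 3) T_superset[of "keys s \<union> keys s' \<union> keys (s + s')"])
      (auto simp: lookup_add single_add distrib_right sum.distrib)
  have T_single: "T (single k c) = ?S c (T0 k)" for k c
    by (subst T_superset[of "{k}"]) auto
  have T0_shift: "T0 (factor i h + k) = single (factor i h) 1 * T0 k" for h k
    by (simp add: T0_def coset_factor_plus factor_add mult.assoc[symmetric] mult_single)
  have T_mult: "T (single (factor i h) c * s) = single (factor i h) c * T s" for h c s
  proof (induction s rule: poly_mapping_additive_induct)
    case (single k b)
    show ?case
      by (simp add: mult_single T_single T0_shift mult.assoc[symmetric])
  qed (simp add: distrib_left T_add)
  have T0_ideal: "T0 k \<in> left_ideal V" for k
    by (auto simp: T0_def left_ideal.zero intro: left_ideal_gen gV)
  have "T s \<in> left_ideal V" for s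
    unfolding T_def by (intro left_ideal_sum left_ideal_mult T0_ideal)
  moreover have "coset_degree_le i d (T s)" for s
    unfolding coset_degree_le_def
  proof
    fix k
    assume "k \<in> keys (T s)"
    then have "lookup (T s) k \<noteq> 0"
      by (simp add: in_keys_iff)
    then obtain l where "lookup (T0 l) k \<noteq> 0"
      unfolding T_def lookup_sum by (auto simp: lookup_single_mult elim!: sum.not_neutral_contains_not_neutral)
    then have "lookup (g (single (coset_rep i l) 1)) (factor i (- coset_head i l) + k) \<noteq> 0"
      by (auto simp: T0_def lookup_single_mult factor_uminus split: if_splits)
    then have "fp_length (factor i (- coset_head i l) + k) \<le> d"
      using V_len[OF gV] by (auto simp: in_keys_iff)
    then show "fp_length (coset_rep i k) \<le> d"
      using fp_length_coset_rep[of "factor i (- coset_head i l) + k" i] by (simp add: coset_factor_plus)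
  qed
  moreover have "lookup (T s) (factor i h + w) = lookup s (factor i h + w)"
    if y: "y \<in> V" "\<forall>w. fp_length w = d \<longrightarrow> \<not> starts_with i w \<longrightarrow> lookup s (factor i h + w) = lookup y w"
      and w: "fp_length w = d" "\<not> starts_with i w" for s h y w
  proof -
    define slice :: "('h free_power \<Rightarrow>\<^sub>0 'a) \<Rightarrow> ('h free_power \<Rightarrow>\<^sub>0 'a)" where
      "slice s = top_part i d (single (factor i (- h)) 1 * s)" for s
    have slice_add: "slice (s + s') = slice s + slice s'" for s s'
      by (rule poly_mapping_eqI) (simp add: slice_def distrib_left lookup_top_part lookup_add)
    \<comment> \<open>At such words the coefficients of \<open>T s\<close> depend only on the
      component of \<open>s\<close> with head \<open>h\<close>.\<close>
    have slice: "lookup (T s) (factor i h + w) = lookup (g (slice s)) w" for s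
    proof (induction s rule: poly_mapping_additive_induct)
      case (single k b)
      have shift: "factor i (- coset_head i k) + (factor i h + w) = factor i (- coset_head i k + h) + w"
        by (simp add: factor_add add.assoc)
      show ?case
      proof (cases "coset_head i k = h \<and> fp_length (coset_rep i k) = d")
        case True
        have k: "factor i (- h) + k = coset_rep i k"
          by (metis True add.assoc add_0 coset_decomp factor_uminus left_minus)
        have "slice (single k b) = ?S b (single (coset_rep i k) 1)"
          by (rule poly_mapping_eqI)
            (use True in \<open>auto simp: slice_def mult_single k lookup_top_part lookup_single when_def
               not_starts_with_coset_rep\<close>)
        moreover have "factor i (- h) + (factor i h + w) = w"
          by (simp add: factor_uminus)
        ultimately show ?thesis
          using True by (simp add: T_single lookup_single_mult T0_def g_scale flip: factor_uminus)
      next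
        case False
        have "\<not> (fp_length (factor i (- h) + k) = d \<and> \<not> starts_with i (factor i (- h) + k))"
        proof
          assume *: "fp_length (factor i (- h) + k) = d \<and> \<not> starts_with i (factor i (- h) + k)"
          have "k = factor i h + (factor i (- h) + k)"
            by (simp add: factor_uminus)
          then show False
            using False * coset_decomp_unique[of i "factor i (- h) + k" h] by simp
        qed
        then have "slice (single k b) = 0"
          by (intro poly_mapping_eqI) (auto simp: slice_def mult_single lookup_top_part lookup_single when_def)
        moreover have "lookup (T0 k) (factor i h + w) = 0"
        proof (cases "fp_length (coset_rep i k) = d")
          case True
          \<comment> \<open>A different head leaves a letter in front of \<open>w\<close> and hence
            a word of length \<open>Suc d\<close>, which is too long to occur in an element of
            \<open>V\<close>.\<close>
          then have "- coset_head i k + h \<noteq> 0"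
            using False by (metis add.inverse_inverse minus_unique)
          then have "fp_length (factor i (- coset_head i k + h) + w) = Suc d"
            using w by (simp add: fp_length_def word_factor_plus')
          then have "factor i (- coset_head i k + h) + w \<notin> keys (g (single (coset_rep i k) 1))"
            using V_len[OF gV] by fastforce
          then show ?thesis
            using True by (simp add: T0_def lookup_single_mult in_keys_iff shift flip: factor_uminus)
        qed (simp add: T0_def)
        moreover have "g 0 = 0"
          using g_add[of 0 0] by simp
        ultimately show ?thesis
          by (simp add: T_single lookup_single_mult)
      qed
    qed (simp add: T_add slice_add g_add lookup_add)
    have eq: "slice s = top_part i d y"
      by (rule poly_mapping_eqI)
        (use y(2) in \<open>auto simp: slice_def lookup_top_part lookup_single_mult factor_uminus\<close>)
    have "lookup (g (slice s)) w = lookup (top_part i d (g (top_part i d y))) w"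
      using w by (simp add: eq lookup_top_part)
    also have "\<dots> = lookup y w"
      using w by (simp add: g_inv[OF y(1)] lookup_top_part)
    finally show ?thesis
      using y(2) w by (simp add: slice)
  qed
  ultimately show ?thesis
    using T_add T_mult by (intro exI[of _ T]) auto
qed

lemma ex_maximal:
  fixes f :: "'b \<Rightarrow> nat"
  assumes "finite A" "A \<noteq> {}"
  obtains x where "x \<in> A" "\<And>y. y \<in> A \<Longrightarrow> f y \<le> f x"
  using Max_in[of "f ` A"] Max_ge[of "f ` A"] assms by (metis finite_imageI imageE image_eqI image_is_empty)

text \<open>The group ring is a free left module over that of factor \<open>i\<close>, with the
  coset representatives as basis; this is the coordinate at the representative
  \<open>w\<close>.\<close>

definition coset_component :: "nat \<Rightarrow> 'h::group_add free_power \<Rightarrow> ('h free_power \<Rightarrow>\<^sub>0 'a::comm_monoid_add) \<Rightarrow> 'h \<Rightarrow>\<^sub>0 'a" where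
  "coset_component i w s = (\<Sum>k\<in>{k\<in>keys s. coset_rep i k = w}. single (coset_head i k) (lookup s k))"

lemma lookup_coset_component:
  assumes "\<not> starts_with i w"
  shows "lookup (coset_component i w s) h = lookup s (factor i h + w)"
proof -
  have eq: "coset_rep i k = w \<and> coset_head i k = h \<longleftrightarrow> k = factor i h + w" for k
    using coset_decomp_unique[OF assms] coset_decomp[of i k] by auto
  have "lookup (coset_component i w s) h =
      (\<Sum>k\<in>{k\<in>keys s. coset_rep i k = w}. if k = factor i h + w then lookup s k else 0)"
    unfolding coset_component_def lookup_sum
    by (intro sum.cong) (auto simp: lookup_single when_def eq[symmetric])
  also have "\<dots> = lookup s (factor i h + w)"
    using coset_decomp_unique(2)[OF assms, of h] by (auto simp: in_keys_iff)
  finally show ?thesis .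
qed

section \<open>Rigid ideals and the descent on degrees\<close>

lemma rigid_zero: "rigid I \<Longrightarrow> 0 \<in> I"
  and rigid_add: "rigid I \<Longrightarrow> a \<in> I \<Longrightarrow> b \<in> I \<Longrightarrow> a + b \<in> I"
  and rigid_mult: "rigid I \<Longrightarrow> a \<in> I \<Longrightarrow> c * a \<in> I"
  by (auto simp: rigid_def)

text \<open>\<open>rigid\<close> speaks of forms that are linear for all scalars. Additivity reduces
  this to monomial scalars, which is all that \<open>factor_linear\<close> provides.\<close>

lemma rigid_scalar_value:
  assumes "rigid I" "\<And>a b. a \<in> I \<Longrightarrow> b \<in> I \<Longrightarrow> \<psi> (a + b) = \<psi> a + \<psi> b"
    "\<And>h c a. a \<in> I \<Longrightarrow> \<psi> (single h c * a) = single h c * \<psi> a"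
    "p \<in> I" "p \<noteq> 0" "keys (\<psi> p) \<subseteq> {0}" "a \<in> I"
  shows "\<psi> a = 0"
proof -
  have "\<forall>a\<in>I. \<psi> (c * a) = c * \<psi> a" for c
    by (induction c rule: poly_mapping_additive_induct)
      (simp_all add: assms(2,3) distrib_right rigid_mult[OF assms(1)])
  then show ?thesis
    using assms(1)[unfolded rigid_def] assms(2,4-) by blast
qed

lemma factor_linear_zero:
  assumes "rigid I" "factor_linear i I \<phi>"
  shows "\<phi> 0 = 0"
proof -
  have "\<phi> (0 + 0) = \<phi> 0 + \<phi> 0"
    using assms rigid_zero unfolding factor_linear_def by blast
  then show ?thesis
    by simp
qed

text \<open>For \<open>k = u + factor j a\<close>, the monomial \<open>single k c\<close> acts on
  \<open>\<phi> j b\<close> as \<open>single u 1\<close> acts on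
  \<open>\<phi> j (single a c * b)\<close>. Coefficients can therefore be chosen not to end in
  factor \<open>j\<close>, and then they concatenate without cancellation with words that start in
  it.\<close>

lemma left_ideal_normal_form:
  fixes \<phi> :: "nat \<Rightarrow> ('h::group_add \<Rightarrow>\<^sub>0 'a::field) \<Rightarrow> ('h free_power \<Rightarrow>\<^sub>0 'a)"
  assumes I: "rigid I" and lin: "\<And>j. j < n \<Longrightarrow> factor_linear j I (\<phi> j)"
    and "x \<in> left_ideal (\<Union>j<n. \<phi> j ` I)"
  shows "\<exists>A U. finite U \<and> (\<forall>j u. A j u \<in> I) \<and> (\<forall>j u. A j u \<noteq> 0 \<longrightarrow> u \<in> U \<and> \<not> ends_with j u) \<and>
     x = (\<Sum>j<n. \<Sum>u\<in>U. single u 1 * \<phi> j (A j u))" (is "\<exists>A U. ?nf x A U")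
  using assms(3)
proof (induction rule: left_ideal.induct)
  case zero
  show ?case
    by (rule exI[of _ "\<lambda>_ _. 0"], rule exI[of _ "{}"]) (simp add: rigid_zero[OF I])
next
  case (add_mult x y s)
  have phi0: "\<phi> j 0 = 0" if "j < n" for j
    by (rule factor_linear_zero[OF I lin[OF that]])
  have phi_add: "\<phi> j (a + b) = \<phi> j a + \<phi> j b" if "j < n" "a \<in> I" "b \<in> I" for j a b
    using lin[OF that(1)] that by (auto simp: factor_linear_def)
  have add: "\<exists>A U. ?nf (x + y) A U" if nf: "\<exists>A U. ?nf x A U" "\<exists>A U. ?nf y A U" for x y
  proof -
    obtain A U B W where A: "?nf x A U" and B: "?nf y B W"
      using nf by blast
    have fin: "finite U" "finite W" and A0: "\<And>j u. u \<notin> U \<Longrightarrow> A j u = 0" and B0: "\<And>j u. u \<notin> W \<Longrightarrow> B j u = 0"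
      using A B by blast+
    have "(\<Sum>u\<in>U. single u 1 * \<phi> j (A j u)) = (\<Sum>u\<in>U \<union> W. single u 1 * \<phi> j (A j u))"
      "(\<Sum>u\<in>W. single u 1 * \<phi> j (B j u)) = (\<Sum>u\<in>U \<union> W. single u 1 * \<phi> j (B j u))"
      if "j < n" for j
      by (rule sum.mono_neutral_left; simp add: fin A0 B0 phi0[OF that])+
    then have "x + y = (\<Sum>j<n. \<Sum>u\<in>U \<union> W. single u 1 * \<phi> j (A j u + B j u))"
      using A B by (simp add: phi_add distrib_left sum.distrib)
    moreover have "A j u + B j u \<noteq> 0 \<longrightarrow> u \<in> U \<union> W \<and> \<not> ends_with j u" for j u
      using A B by (cases "A j u = 0") auto
    ultimately show ?thesis
      using A B by (intro exI[of _ "\<lambda>j u. A j u + B j u"] exI[of _ "U \<union> W"])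
        (simp add: rigid_add[OF I])
  qed
  from add_mult.hyps obtain j b where j: "j < n" and b: "b \<in> I" and y: "y = \<phi> j b"
    by blast
  have "\<exists>A U. ?nf (s * y) A U"
  proof (induction s rule: poly_mapping_additive_induct)
    case (single k c)
    obtain u a where u: "k = u + factor j a" "\<not> ends_with j u"
      by (rule right_coset_decomp)
    define A where "A j' u' = (if j' = j \<and> u' = u then single a c * b else 0)" for j' u'
    have "single k c * y = single u 1 * \<phi> j (A j u)"
      using lin[OF j] b by (simp add: u y A_def factor_linear_def mult.assoc[symmetric] mult_single)
    also have "\<dots> = (\<Sum>j'<n. if j' = j then single u 1 * \<phi> j (A j u) else 0)"
      using j by simp
    also have "\<dots> = (\<Sum>j'<n. single u 1 * \<phi> j' (A j' u))"
      by (intro sum.cong) (auto simp: A_def phi0)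
    finally show ?case
      using u b by (intro exI[of _ A] exI[of _ "{u}"])
        (auto simp: A_def rigid_zero[OF I] rigid_mult[OF I])
  qed (auto simp: distrib_right intro!: add)
  with add_mult.IH show ?case
    by (rule add)
qed

text \<open>\<open>D j\<close> is a strict bound for the degrees of all values of
  \<open>\<phi> j\<close>, so \<open>D j = 0\<close> forces \<open>\<phi> j\<close> to vanish on
  \<open>I\<close>. The induction is on the sum of the bounds: a relation for \<open>1\<close>
  allows one bound to be lowered while the left ideal still contains \<open>1\<close>.\<close>

theorem one_notin_left_ideal:
  fixes \<phi> :: "nat \<Rightarrow> ('h::group_add \<Rightarrow>\<^sub>0 'a::field) \<Rightarrow> ('h free_power \<Rightarrow>\<^sub>0 'a)"
  assumes I: "rigid I" and "\<And>j. j < n \<Longrightarrow> factor_linear j I (\<phi> j)"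
    and "\<And>j b k. j < n \<Longrightarrow> b \<in> I \<Longrightarrow> k \<in> keys (\<phi> j b) \<Longrightarrow> fp_length (coset_rep j k) < D j"
  shows "1 \<notin> left_ideal (\<Union>j<n. \<phi> j ` I)"
  using assms(2,3)
proof (induction "\<Sum>j<n. D j" arbitrary: D \<phi> rule: less_induct)
  case less
  note lin = less.prems(1) and deg = less.prems(2)
  show ?case
  proof
    assume "1 \<in> left_ideal (\<Union>j<n. \<phi> j ` I)"
    then obtain A U where U: "finite U" and A: "\<And>j u. A j u \<in> I"
      and supp: "\<And>j u. A j u \<noteq> 0 \<Longrightarrow> u \<in> U \<and> \<not> ends_with j u"
      and one: "1 = (\<Sum>j<n. \<Sum>u\<in>U. single u 1 * \<phi> j (A j u))"
      using left_ideal_normal_form[OF I, where n = n and \<phi> = \<phi> and x = 1] lin by blast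
    define S where "S = {(j, u). j < n \<and> u \<in> U \<and> A j u \<noteq> 0 \<and> D j \<noteq> 0}"
    have "finite S"
      using U by (intro finite_subset[of S "{..<n} \<times> U"]) (auto simp: S_def)
    have z: "\<phi> j (A j u) = 0" if "j < n" "A j u = 0 \<or> D j = 0" for j u
      using that(2)
    proof
      assume "A j u = 0"
      then show ?thesis
        using factor_linear_zero[OF I lin[OF that(1)]] by simp
    next
      assume "D j = 0"
      then show ?thesis
        using deg[OF that(1) A] by (metis keys_eq_empty not_less_zero ex_in_conv)
    qed
    then have one_S: "1 = (\<Sum>(j, u)\<in>S. single u 1 * \<phi> j (A j u))"
      unfolding one sum.cartesian_product
    proof (intro sum.mono_neutral_right ballI)
      fix x
      assume x: "x \<in> {..<n} \<times> U - S"
      obtain j u where ju: "x = (j, u)"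
        by (cases x)
      then have "\<phi> j (A j u) = 0"
        using x by (intro z) (auto simp: S_def)
      then show "(case x of (j, u) \<Rightarrow> single u 1 * \<phi> j (A j u)) = 0"
        by (simp add: ju)
    qed (use U in \<open>auto simp: S_def\<close>)
    then have "S \<noteq> {}"
      by auto
    \<comment> \<open>This bounds the length of all words in the summand at \<open>(j, u)\<close>.
      Among the pairs that attain the maximal bound, one with the largest \<open>D\<close>, that is
      with the shortest \<open>u\<close>, is taken.\<close>
    let ?m = "\<lambda>(j, u). fp_length u + D j"
    obtain x0 where x0: "x0 \<in> S" "\<And>x. x \<in> S \<Longrightarrow> ?m x \<le> ?m x0"
      using ex_maximal[OF \<open>finite S\<close> \<open>S \<noteq> {}\<close>, where f = ?m] by blast
    define M where "M = ?m x0"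
    have "finite {x \<in> S. ?m x = M}" "x0 \<in> {x \<in> S. ?m x = M}"
      using x0(1) \<open>finite S\<close> by (simp_all add: M_def)
    then have "finite {x \<in> S. ?m x = M}" "{x \<in> S. ?m x = M} \<noteq> {}"
      by blast+
    then obtain iv where "iv \<in> {x \<in> S. ?m x = M}" "\<And>x. x \<in> {x \<in> S. ?m x = M} \<Longrightarrow> (D \<circ> fst) x \<le> (D \<circ> fst) iv"
      by (rule ex_maximal[where f = "D \<circ> fst"]) blast
    moreover obtain i v where "iv = (i, v)"
      by (cases iv)
    ultimately have iv: "(i, v) \<in> S" "fp_length v + D i = M"
      and i_max: "\<And>j u. (j, u) \<in> S \<Longrightarrow> fp_length u + D j = M \<Longrightarrow> D j \<le> D i"
      by auto
    have M_max: "fp_length u + D j \<le> M" if "(j, u) \<in> S" for j u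
      using x0(2)[OF that] by (simp add: M_def)
    have i: "i < n" and Av: "A i v \<noteq> 0" "\<not> ends_with i v" and "D i \<noteq> 0"
      using iv supp by (auto simp: S_def)
    \<comment> \<open>As \<open>D i\<close> is a strict bound, \<open>d\<close> is the highest
      degree that \<open>\<phi> i\<close> can have.\<close>
    define d where "d = D i - 1"
    have Di: "D i = Suc d"
      using \<open>D i \<noteq> 0\<close> by (simp add: d_def)
    \<comment> \<open>Elements of \<open>V\<close> can be subtracted from values of
      \<open>\<phi> i\<close>: they come from the other images and do not exceed degree
      \<open>d\<close>.\<close>
    define L where "L = left_ideal (\<Union>j\<in>{..<n} - {i}. \<phi> j ` I)"
    define V where "V = {y \<in> L. \<forall>k\<in>keys y. fp_length k \<le> d}"
    have "0 \<in> V"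
      by (simp add: V_def L_def left_ideal.zero)
    moreover have "x + y \<in> V" if "x \<in> V" "y \<in> V" for x y
      using that Poly_Mapping.keys_add[of x y] by (auto simp: V_def L_def intro: left_ideal_add)
    moreover have "single 0 c * x \<in> V" if "x \<in> V" for c x
      using that by (auto simp: V_def L_def in_keys_iff lookup_single_mult intro: left_ideal_mult)
    moreover have "fp_length k \<le> d" if "x \<in> V" "k \<in> keys x" for x k
      using that by (auto simp: V_def)
    ultimately have "\<exists>T. (\<forall>s s'. T (s + s') = T s + T s') \<and>
      (\<forall>h c s. T (single (factor i h) c * s) = single (factor i h) c * T s) \<and>
      (\<forall>s. T s \<in> left_ideal V) \<and> (\<forall>s. coset_degree_le i d (T s)) \<and>
      (\<forall>s h. (\<exists>y\<in>V. \<forall>w. fp_length w = d \<longrightarrow> \<not> starts_with i w \<longrightarrow> lookup s (factor i h + w) = lookup y w) \<longrightarrow>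
         (\<forall>w. fp_length w = d \<longrightarrow> \<not> starts_with i w \<longrightarrow>
            lookup (T s) (factor i h + w) = lookup s (factor i h + w)))"
      by (rule top_reduction)
    then obtain T where T_add: "\<forall>s s'. T (s + s') = T s + T s'"
      and T_mult: "\<forall>h c s. T (single (factor i h) c * s) = single (factor i h) c * T s"
      and T_V: "\<forall>s. T s \<in> left_ideal V"
      and T_deg: "\<forall>s. coset_degree_le i d (T s)"
      and T_top: "\<forall>s h. (\<exists>y\<in>V. \<forall>w. fp_length w = d \<longrightarrow> \<not> starts_with i w \<longrightarrow> lookup s (factor i h + w) = lookup y w) \<longrightarrow>
         (\<forall>w. fp_length w = d \<longrightarrow> \<not> starts_with i w \<longrightarrow>
            lookup (T s) (factor i h + w) = lookup s (factor i h + w))"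
      by (elim exE conjE)
    \<comment> \<open>A word of coset degree below \<open>D j\<close> reaches length
      \<open>D j\<close> only through one more letter in front, from factor
      \<open>j\<close>.\<close>
    have len_key: "fp_length k \<le> D j" "fp_length k = D j \<Longrightarrow> starts_with j k"
      if "j < n" "b \<in> I" "k \<in> keys (\<phi> j b)" for j b k
      using deg[OF that] fp_length_coset_rep[of k j] by (auto split: if_splits)
    define \<phi>' where "\<phi>' b = \<phi> i b - T (\<phi> i b)" for b
    have phi_add: "\<phi> i (a + b) = \<phi> i a + \<phi> i b"
      and phi_mult: "\<phi> i (single h c * a) = single (factor i h) c * \<phi> i a" if "a \<in> I" "b \<in> I" for a b h c
      using lin[OF i] that by (auto simp: factor_linear_def)
    have phi'_add: "\<phi>' (a + b) = \<phi>' a + \<phi>' b" if "a \<in> I" "b \<in> I" for a b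
      using that by (simp add: \<phi>'_def phi_add T_add)
    have phi'_mult: "\<phi>' (single h c * a) = single (factor i h) c * \<phi>' a" if "a \<in> I" for a h c
      using that by (simp add: \<phi>'_def phi_mult T_mult right_diff_distrib)
    have lin': "factor_linear i I \<phi>'"
      using phi'_add phi'_mult by (auto simp: factor_linear_def)

    \<comment> \<open>The relation for \<open>1\<close> is compared at the word \<open>v\<close>,
      \<open>h\<close>, \<open>w\<close> of maximal length. Besides \<open>(i, v)\<close>, only
      summands whose \<open>u\<close> extends \<open>v\<close> by the letter \<open>h\<close> reach
      it. Hence the coefficient of \<open>\<phi> i (A i v)\<close> is that of an element of
      \<open>V\<close>, and \<open>T\<close> removes it.\<close>
    have vanish: "lookup (\<phi>' (A i v)) (factor i h + w) = 0"
      if "h \<noteq> 0" "fp_length w = d" "\<not> starts_with i w" for h w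
    proof -
      define B where "B = {(j, u)\<in>S. j \<noteq> i \<and> fp_length u + D j = M \<and> (\<exists>u'. word u = word v @ (i, h) # u')}"
      have "finite B"
        using \<open>finite S\<close> by (rule finite_subset[rotated]) (auto simp: B_def)
      \<comment> \<open>These are the competing summands with the common prefix \<open>v\<close>,
        \<open>h\<close> stripped off; the sign comes from moving them to the other side of the
        relation.\<close>
      define y where "y = - 1 * (\<Sum>(j, u)\<in>B. single (- factor i h + (- v + u)) 1 * \<phi> j (A j u))"
      have "y \<in> L"
        unfolding y_def L_def
        by (intro left_ideal_mult left_ideal_sum) (use A in \<open>auto simp: B_def S_def intro!: left_ideal_gen\<close>)
      moreover have "fp_length k \<le> d" if "k \<in> keys y" for k
      proof -
        have "(\<Sum>(j, u)\<in>B. lookup (single (- factor i h + (- v + u)) 1 * \<phi> j (A j u)) k) \<noteq> 0"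
          using that by (simp add: y_def in_keys_iff lookup_sum case_prod_unfold)
        then obtain j u where B: "(j, u) \<in> B"
          and k': "lookup (single (- factor i h + (- v + u)) 1 * \<phi> j (A j u)) k \<noteq> 0"
          by (auto elim!: sum.not_neutral_contains_not_neutral)
        from B obtain u' where j: "j < n" and uM: "fp_length u + D j = M" and u': "word u = word v @ (i, h) # u'"
          by (auto simp: B_def S_def)
        have red: "reduced u'" "u' = [] \<or> fst (hd u') \<noteq> i"
          using reduced_word[of u] by (auto simp: u' successively_append_iff successively_Cons)
        define q where "q = Word u'"
        have q: "word q = u'"
          using red by (simp add: q_def Word_inverse)
        have "word (factor i h + q) = (i, h) # u'"
          using red(2) \<open>h \<noteq> 0\<close> by (subst word_factor_plus') (auto simp: starts_with_def q)
        then have "word (v + (factor i h + q)) = word u"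
          by (subst word_plus_append[OF Av(2)]) (auto simp: starts_with_def u')
        then have u: "u = v + (factor i h + q)"
          by (simp add: word_inject)
        have "- q + k \<in> keys (\<phi> j (A j u))"
          using k' by (simp add: u lookup_single_mult in_keys_iff)
        then have "fp_length (- q + k) \<le> D j"
          using len_key(1)[OF j A] by blast
        moreover have "fp_length k \<le> fp_length q + fp_length (- q + k)"
          using fp_length_plus_le[of q "- q + k"] by simp
        \<comment> \<open>The letter \<open>h\<close> accounts for the \<open>1\<close>, which turns
          the bound \<open>D i\<close> into \<open>d\<close>.\<close>
        moreover have "fp_length u = fp_length v + 1 + fp_length q"
          by (simp add: fp_length_def u' q)
        ultimately show ?thesis
          using uM iv(2) Di by simp
      qed
      ultimately have "y \<in> V"
        by (auto simp: V_def)
      moreover have "lookup (\<phi> i (A i v)) (factor i h + w) = lookup y w"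
        if w: "fp_length w = d" "\<not> starts_with i w" for w
      proof -
        define t where "t = v + (factor i h + w)"
        have word_hw: "word (factor i h + w) = (i, h) # word w"
          using w \<open>h \<noteq> 0\<close> by (intro word_factor_plus')
        have word_t: "word t = word v @ (i, h) # word w"
          unfolding t_def by (subst word_plus_append[OF Av(2)]) (auto simp: starts_with_def word_hw)
        have len_t: "fp_length t = M"
          using word_t w iv(2) Di by (simp add: fp_length_def)
        have "lookup 1 t = (0 :: 'a)"
          using word_t by (auto simp: lookup_one when_def)
        then have "(\<Sum>(j, u)\<in>S. lookup (\<phi> j (A j u)) (- u + t)) = 0"
          by (subst (asm) one_S) (simp add: lookup_sum case_prod_unfold lookup_single_mult)
        also have "(\<Sum>(j, u)\<in>S. lookup (\<phi> j (A j u)) (- u + t)) =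
            (\<Sum>(j, u)\<in>insert (i, v) B. lookup (\<phi> j (A j u)) (- u + t))"
        proof (rule sum.mono_neutral_right)
          show "\<forall>x\<in>S - insert (i, v) B. (case x of (j, u) \<Rightarrow> lookup (\<phi> j (A j u)) (- u + t)) = 0"
          proof (rule ballI, rule ccontr)
            fix x
            assume x: "x \<in> S - insert (i, v) B" "\<not> (case x of (j, u) \<Rightarrow> lookup (\<phi> j (A j u)) (- u + t)) = 0"
            obtain j u where "x = (j, u)"
              by (cases x)
            with x have ju: "(j, u) \<in> S" "(j, u) \<notin> B" "lookup (\<phi> j (A j u)) (- u + t) \<noteq> 0"
              and ne: "(j, u) \<noteq> (i, v)"
              by simp_all
            define k where "k = - u + t"
            have t: "t = u + k"
              by (simp add: k_def)
            have j: "j < n" and u_end: "\<not> ends_with j u"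
              using ju(1) supp by (auto simp: S_def)
            have k: "k \<in> keys (\<phi> j (A j u))"
              using ju(3) by (simp add: in_keys_iff k_def)
            \<comment> \<open>Since \<open>t\<close> has maximal length, all estimates are
              equalities. So \<open>k\<close> starts in factor \<open>j\<close> and is appended to
              \<open>u\<close> without cancellation.\<close>
            have "fp_length u + D j = M" "fp_length k = D j"
              using fp_length_plus_le[of u k] len_key(1)[OF j A k] M_max[OF ju(1)] len_t t by auto
            then have uM: "fp_length u + D j = M" and k_start: "starts_with j k" and "D j \<le> D i"
              using len_key(2)[OF j A k] i_max[OF ju(1)] by auto
            have wt: "word v @ (i, h) # word w = word u @ word k"
              using word_plus_append[OF u_end k_start] word_t t by simp
            \<comment> \<open>Here the choice of the largest \<open>D i\<close> enters: it makes
              \<open>v\<close> a prefix of \<open>u\<close>.\<close>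
            have "length (word v) \<le> length (word u)"
              using \<open>D j \<le> D i\<close> uM iv(2) by (simp add: fp_length_def)
            with wt obtain u' where u: "word u = word v @ u'"
              by (auto simp: append_eq_append_conv2) metis
            with wt have u': "word u = word v @ u'" "(i, h) # word w = u' @ word k"
              by auto
            show False
            proof (cases u')
              case Nil
              then have "word k = (i, h) # word w" and "u = v"
                using u' by (simp_all add: word_inject)
              then have "j = i"
                using k_start by (simp add: starts_with_def)
              with ne \<open>u = v\<close> show False
                by simp
            next
              case (Cons p u'')
              then have "word u = word v @ (i, h) # u''"
                using u' by simp
              \<comment> \<open>\<open>u\<close> is longer than \<open>v\<close>, so
                \<open>D j\<close> is smaller than \<open>D i\<close>.\<close>
              moreover from this have "j \<noteq> i"
                using uM iv(2) by (auto simp: fp_length_def)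
              ultimately show False
                using ju uM by (auto simp: B_def)
            qed
          qed
        qed (use iv \<open>finite S\<close> in \<open>auto simp: B_def\<close>)
        also have "\<dots> = lookup (\<phi> i (A i v)) (factor i h + w) + (\<Sum>(j, u)\<in>B. lookup (\<phi> j (A j u)) (- u + t))"
          using \<open>finite B\<close> by (subst sum.insert) (auto simp: B_def t_def)
        also have "(\<Sum>(j, u)\<in>B. lookup (\<phi> j (A j u)) (- u + t)) = - lookup y w"
          unfolding y_def lookup_sum
          by (simp add: lookup_sum case_prod_unfold lookup_single_mult minus_add t_def add.assoc)
        finally show ?thesis
          by simp
      qed
      ultimately have "lookup (T (\<phi> i (A i v))) (factor i h + w) = lookup (\<phi> i (A i v)) (factor i h + w)"
        using T_top that by blast
      then show ?thesis
        by (simp add: \<phi>'_def lookup_minus)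
    qed

    have "fp_length (coset_rep i k) < d" if b: "b \<in> I" and k: "k \<in> keys (\<phi>' b)" for b k
    proof (rule ccontr)
      assume "\<not> ?thesis"
      moreover have "coset_degree_le i d (\<phi>' b)"
        unfolding \<phi>'_def using deg[OF i b] Di by (intro coset_degree_le_diff T_deg[rule_format]) (force simp: coset_degree_le_def)
      ultimately have len: "fp_length (coset_rep i k) = d"
        using k by (force simp: coset_degree_le_def)
      define w where "w = coset_rep i k"
      have w: "\<not> starts_with i w" "fp_length w = d"
        using len by (simp_all add: w_def not_starts_with_coset_rep)
      \<comment> \<open>The coordinate of \<open>\<phi>'\<close> at a representative of top degree
        is a linear form on \<open>I\<close>. By \<open>vanish\<close> its value at the nonzero
        element \<open>A i v\<close> is a scalar, so rigidity makes the whole form zero: a removal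
        at one argument spreads to all of \<open>I\<close>.\<close>
      define \<psi> where "\<psi> b = coset_component i w (\<phi>' b)" for b
      have lookup_psi: "lookup (\<psi> b) h = lookup (\<phi>' b) (factor i h + w)" for b h
        by (simp add: \<psi>_def lookup_coset_component[OF w(1)])
      have "\<psi> b = 0"
      proof (rule rigid_scalar_value[OF I, where \<psi> = \<psi> and p = "A i v"])
        show "\<psi> (a + b) = \<psi> a + \<psi> b" if "a \<in> I" "b \<in> I" for a b
          using that by (intro poly_mapping_eqI) (simp add: lookup_psi phi'_add lookup_add)
        show "\<psi> (single h c * a) = single h c * \<psi> a" if "a \<in> I" for h c a
          using that by (intro poly_mapping_eqI)
            (simp add: lookup_psi phi'_mult lookup_single_mult factor_add factor_uminus add.assoc)
        show "keys (\<psi> (A i v)) \<subseteq> {0}"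
          using vanish[OF _ w(2,1)] unfolding subset_iff in_keys_iff lookup_psi singleton_iff by blast
      qed (use A Av b in auto)
      then have "lookup (\<psi> b) (coset_head i k) = 0"
        by simp
      then show False
        using k by (simp add: lookup_psi w_def coset_decomp in_keys_iff)
    qed
    then have deg': "fp_length (coset_rep j k) < (D(i := d)) j"
      if "j < n" "b \<in> I" "k \<in> keys ((\<phi>(i := \<phi>')) j b)" for j b k
      using that deg by (auto split: if_splits)
    have "(\<Sum>j<n. (D(i := d)) j) < (\<Sum>j<n. D j)"
      using i Di by (intro sum_strict_mono_ex1) (auto intro!: bexI[of _ i])
    then have "1 \<notin> left_ideal (\<Union>j<n. (\<phi>(i := \<phi>')) j ` I)"
    proof (rule less.hyps)
      show "factor_linear j I ((\<phi>(i := \<phi>')) j)" if "j < n" for j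
        using lin lin' that by (cases "j = i") auto
    qed (rule deg')
    \<comment> \<open>The left ideal does not shrink: \<open>T\<close> takes values in the left
      ideal of the unchanged images, so \<open>\<phi> i\<close> is recovered from
      \<open>\<phi>'\<close>.\<close>
    moreover have "\<phi> j b \<in> left_ideal (\<Union>j<n. (\<phi>(i := \<phi>')) j ` I)" (is "_ \<in> ?L'") if "j < n" "b \<in> I" for j b
    proof (cases "j = i")
      case True
      have "L \<subseteq> ?L'"
        unfolding L_def by (rule left_ideal_mono) force
      then have "T (\<phi> i b) \<in> ?L'"
        using T_V left_ideal_subset[of V "\<Union>j<n. (\<phi>(i := \<phi>')) j ` I"] by (auto simp: V_def)
      moreover have "\<phi>' b \<in> ?L'"
        using that i by (intro left_ideal_incl) force
      ultimately have "\<phi>' b + T (\<phi> i b) \<in> ?L'"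
        by (intro left_ideal_add)
      then show ?thesis
        by (simp add: \<phi>'_def True)
    next
      case False
      then show ?thesis
        using that by (intro left_ideal_incl) force
    qed
    ultimately show False
      using \<open>1 \<in> left_ideal (\<Union>j<n. \<phi> j ` I)\<close> left_ideal_subset[of "\<Union>j<n. \<phi> j ` I"] by blast
  qed
qed

section \<open>Group rings of right-ordered groups\<close>

lemma lookup_mult_keys:
  fixes f g :: "'g::group_add \<Rightarrow>\<^sub>0 'a::semiring_0"
  assumes "finite A" "keys f \<subseteq> A"
  shows "lookup (f * g) t = (\<Sum>k\<in>A. lookup f k * lookup g (- k + t))"
proof -
  have "f * g = (\<Sum>k\<in>keys f. single k (lookup f k) * g)"
    by (subst poly_mapping_sum_single[of f]) (simp add: sum_distrib_right)
  then have "lookup (f * g) t = (\<Sum>k\<in>keys f. lookup f k * lookup g (- k + t))"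
    by (simp add: lookup_sum lookup_single_mult)
  also have "\<dots> = (\<Sum>k\<in>A. lookup f k * lookup g (- k + t))"
    by (rule sum.mono_neutral_left) (use assms in \<open>auto simp: in_keys_iff\<close>)
  finally show ?thesis .
qed

text \<open>In a right-ordered group left translation by the maximum of the left support is not monotone,
  so the extreme element of the product is found by maximizing over the right support.\<close>

lemma extreme_key_mult:
  fixes f g :: "'g::group_add \<Rightarrow>\<^sub>0 'a::semiring_no_zero_divisors" and le lt :: "'g \<Rightarrow> 'g \<Rightarrow> bool"
  assumes g: "g \<noteq> 0" and a: "a \<in> keys f"
    and mono: "\<And>b c. b \<in> keys f \<Longrightarrow> b \<noteq> a \<Longrightarrow> lt (b + c) (a + c)"
    and order: "class.linorder le lt"
  shows "\<exists>b\<in>keys g. a + b \<in> keys (f * g) \<and> (\<forall>c\<in>keys g. le (a + c) (a + b))"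
proof -
  interpret ord: linorder le lt
    by (rule order)
  have "finite ((+) a ` keys g)" "(+) a ` keys g \<noteq> {}"
    using g by auto
  then obtain m where "m \<in> (+) a ` keys g" and max: "\<And>x. x \<in> (+) a ` keys g \<Longrightarrow> le x m"
    using ord.Max_in ord.Max_ge by metis
  then obtain b where b: "b \<in> keys g" "m = a + b"
    by blast
  have "lookup f k * lookup g (- k + m) = 0" if k: "k \<in> keys f" "k \<noteq> a" for k
  proof (rule ccontr)
    assume "\<not> ?thesis"
    then have "- k + m \<in> keys g"
      by (auto simp: in_keys_iff)
    then have "le (a + (- k + m)) m"
      using max by blast
    moreover have "lt (k + (- k + m)) (a + (- k + m))"
      by (rule mono[OF k])
    ultimately show False
      by simp
  qed
  then have "(\<Sum>k\<in>keys f - {a}. lookup f k * lookup g (- k + m)) = 0"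
    by (intro sum.neutral) blast
  then have "lookup (f * g) m = lookup f a * lookup g (- a + m)"
    using a by (subst lookup_mult_keys[of "keys f"]) (simp_all add: sum.remove)
  also have "\<dots> \<noteq> 0"
    using a b by (simp add: in_keys_iff)
  finally show ?thesis
    using b max by (intro bexI[of _ b]) (auto simp: in_keys_iff)
qed

context
  assumes right_mono: "\<And>a b c :: 'g::{group_add,linorder}. a < b \<Longrightarrow> a + c < b + c"
begin

lemma max_key_mult:
  fixes f g :: "'g \<Rightarrow>\<^sub>0 'a::semiring_no_zero_divisors"
  assumes "f \<noteq> 0" "g \<noteq> 0"
  shows "\<exists>b\<in>keys g. Max (keys f) + b \<in> keys (f * g) \<and> (\<forall>c\<in>keys g. Max (keys f) + c \<le> Max (keys f) + b)"
proof (rule extreme_key_mult[OF assms(2)])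
  show "Max (keys f) \<in> keys f"
    using assms by simp
  show "b + c < Max (keys f) + c" if "b \<in> keys f" "b \<noteq> Max (keys f)" for b c
    using that Max_ge[of "keys f" b] by (intro right_mono) (simp add: order.not_eq_order_implies_strict)
qed (rule linorder_class.linorder_axioms)

lemma min_key_mult:
  fixes f g :: "'g \<Rightarrow>\<^sub>0 'a::semiring_no_zero_divisors"
  assumes "f \<noteq> 0" "g \<noteq> 0"
  shows "\<exists>b\<in>keys g. Min (keys f) + b \<in> keys (f * g) \<and> (\<forall>c\<in>keys g. Min (keys f) + b \<le> Min (keys f) + c)"
proof (rule extreme_key_mult[OF assms(2)])
  show "Min (keys f) \<in> keys f"
    using assms by simp
  show "Min (keys f) + c < b + c" if "b \<in> keys f" "b \<noteq> Min (keys f)" for b c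
    using that Min_le[of "keys f" b] by (intro right_mono) (simp add: order.not_eq_order_implies_strict)
qed (rule linorder_class.dual_linorder)

lemma right_ordered_no_zero_divisors:
  fixes f g :: "'g \<Rightarrow>\<^sub>0 'a::semiring_no_zero_divisors"
  assumes "f * g = 0"
  shows "f = 0 \<or> g = 0"
  using max_key_mult[of f g] assms by auto

text \<open>The product has \<open>0\<close> as its only key, so keys \<open>c\<close> and
  \<open>d\<close> of \<open>g\<close> carry the greatest and the least key of \<open>f\<close> to
  \<open>0\<close>. Minimality at \<open>d\<close> gives
  \<open>Min (keys f) + c \<ge> 0 = Max (keys f) + c\<close>, and right monotonicity then makes the
  two extreme keys equal.\<close>

lemma right_ordered_unit:
  fixes f g :: "'g \<Rightarrow>\<^sub>0 'a::semiring_1_no_zero_divisors"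
  assumes "f * g = 1" "a \<in> keys f" "b \<in> keys f"
  shows "a = b"
proof -
  have nz: "f \<noteq> 0" "g \<noteq> 0"
    using assms(1) by auto
  obtain c d where c: "c \<in> keys g" "Max (keys f) + c = 0"
    and d: "d \<in> keys g" "Min (keys f) + d = 0" "\<forall>e\<in>keys g. Min (keys f) + d \<le> Min (keys f) + e"
    using max_key_mult[OF nz] min_key_mult[OF nz] by (auto simp: assms(1))
  have "Min (keys f) + c \<ge> Max (keys f) + c"
    using c d by simp
  then have "Min (keys f) = Max (keys f)"
    using right_mono[of "Min (keys f)" "Max (keys f)" c] Min_le[of "keys f" a] Max_ge[of "keys f" a] assms(2)
    by (metis finite_keys order.trans order.order_iff_strict not_le)
  then show ?thesis
    using assms(2,3) by (metis Max_ge Min_le finite_keys order_antisym order.trans)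
qed

end

section \<open>The Klein bottle group\<close>

text \<open>\<open>Klein m e\<close> stands for \<open>y\<^sup>m x\<^sup>e\<close> in the group generated by \<open>x\<close> and \<open>y\<close> subject to
  \<open>x y = y\<^sup>-\<^sup>1 x\<close>.\<close>

datatype klein = Klein (ypow: int) (xpow: int)

instance klein :: countable
  by countable_datatype

instantiation klein :: "{group_add, linorder}"
begin

definition "0 = Klein 0 0"

definition "a + b = Klein (ypow a + (if even (xpow a) then ypow b else - ypow b)) (xpow a + xpow b)"

definition "- a = Klein (if even (xpow a) then - ypow a else ypow a) (- xpow a)"

definition minus_klein :: "klein \<Rightarrow> klein \<Rightarrow> klein" where
  "minus_klein a b = a + - b"

definition "a \<le> b \<longleftrightarrow> xpow a < xpow b \<or> xpow a = xpow b \<and> ypow a \<le> ypow b"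

definition "a < b \<longleftrightarrow> xpow a < xpow b \<or> xpow a = xpow b \<and> ypow a < ypow b"

instance
  by standard
    (auto simp: zero_klein_def plus_klein_def uminus_klein_def minus_klein_def less_eq_klein_def
      less_klein_def klein.expand)

end

lemma klein_simps [simp]:
  "Klein m e + Klein m' e' = Klein (m + (if even e then m' else - m')) (e + e')"
  "- Klein m e = Klein (if even e then - m else m) (- e)"
  by (simp_all add: plus_klein_def uminus_klein_def)

lemma xpow_simps [simp]:
  "xpow 0 = 0" "xpow (a + b) = xpow a + xpow b" "xpow (- a) = - xpow a"
  by (simp_all add: zero_klein_def plus_klein_def uminus_klein_def)

text \<open>Elements with the same exponent of \<open>x\<close> have their exponents of
  \<open>y\<close> shifted by the same amount. Left translation by \<open>x\<close> reverses the
  order of the powers of \<open>y\<close>, so the order is invariant on one side only.\<close>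

lemma klein_right_mono: "a < b \<Longrightarrow> a + c < b + c" for a b c :: klein
  by (auto simp: less_klein_def plus_klein_def)

lemmas klein_no_zero_divisors = right_ordered_no_zero_divisors[OF klein_right_mono]
lemmas klein_unit = right_ordered_unit[OF klein_right_mono]

section \<open>Components of fixed degree in \<open>x\<close>\<close>

definition xpart :: "int \<Rightarrow> (klein \<Rightarrow>\<^sub>0 'a::comm_monoid_add) \<Rightarrow> (klein \<Rightarrow>\<^sub>0 'a)" where
  "xpart e f = (\<Sum>k\<in>{k\<in>keys f. xpow k = e}. single k (lookup f k))"

lemma lookup_xpart: "lookup (xpart e f) k = (if xpow k = e then lookup f k else 0)"
  by (auto simp: xpart_def lookup_sum lookup_single when_def in_keys_iff)

text \<open>The hypothesis says that degree \<open>m + n\<close> arises from a single pair of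
  degrees. This is so for the extreme degrees, and also when one factor is homogeneous.\<close>

lemma xpart_mult:
  fixes f g :: "klein \<Rightarrow>\<^sub>0 'a::semiring_0"
  assumes "\<And>a b. a \<in> keys f \<Longrightarrow> b \<in> keys g \<Longrightarrow> xpow a + xpow b = m + n \<Longrightarrow> xpow a = m"
  shows "xpart (m + n) (f * g) = xpart m f * xpart n g"
proof (rule poly_mapping_eqI)
  fix t
  have "keys (xpart m f) \<subseteq> keys f"
    by (auto simp: in_keys_iff lookup_xpart split: if_splits)
  then have "lookup (xpart m f * xpart n g) t =
      (\<Sum>k\<in>keys f. lookup (xpart m f) k * lookup (xpart n g) (- k + t))"
    by (intro lookup_mult_keys) auto
  also have "\<dots> = (\<Sum>k\<in>keys f. if xpow t = m + n then lookup f k * lookup g (- k + t) else 0)"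
  proof (rule sum.cong)
    fix k
    assume k: "k \<in> keys f"
    have "xpow k = m" if "xpow t = m + n" "lookup g (- k + t) \<noteq> 0"
      using assms[OF k, of "- k + t"] that by (simp add: in_keys_iff)
    then show "lookup (xpart m f) k * lookup (xpart n g) (- k + t) =
        (if xpow t = m + n then lookup f k * lookup g (- k + t) else 0)"
      by (cases "lookup g (- k + t) = 0") (auto simp: lookup_xpart)
  qed simp
  also have "\<dots> = lookup (xpart (m + n) (f * g)) t"
    by (simp add: lookup_xpart lookup_mult_keys[of "keys f"])
  finally show "lookup (xpart (m + n) (f * g)) t = lookup (xpart m f * xpart n g) t" ..
qed

lemma xpart_homogeneous: "(\<And>k. k \<in> keys f \<Longrightarrow> xpow k = e) \<Longrightarrow> xpart e f = f"
  by (rule poly_mapping_eqI) (auto simp: lookup_xpart in_keys_iff)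

lemma xpart_bounds:
  assumes "f \<noteq> 0"
  obtains l h where "l \<le> h" "xpart l f \<noteq> 0" "xpart h f \<noteq> 0"
    "\<forall>k\<in>keys f. l \<le> xpow k \<and> xpow k \<le> h"
proof -
  let ?X = "xpow ` keys f"
  have fin: "finite ?X" "?X \<noteq> {}"
    using assms by auto
  have nz: "xpart e f \<noteq> 0" if "e \<in> ?X" for e
  proof -
    obtain k where "k \<in> keys f" "xpow k = e"
      using \<open>e \<in> ?X\<close> by blast
    then have "lookup (xpart e f) k \<noteq> 0"
      by (simp add: lookup_xpart in_keys_iff)
    then show ?thesis
      by auto
  qed
  show thesis
    by (rule that[of "Min ?X" "Max ?X"]) (use fin Min_in[OF fin] Max_in[OF fin] in \<open>auto intro!: nz Min_le Max_ge\<close>)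
qed

lemma xpart_nonzeroD: "xpart e f \<noteq> 0 \<Longrightarrow> \<exists>k\<in>keys f. xpow k = e"
  by (force simp: in_keys_iff lookup_xpart poly_mapping_eq_iff fun_eq_iff split: if_splits)

lemma xpart_top_mult_nonzero:
  fixes f g :: "klein \<Rightarrow>\<^sub>0 'a::semiring_no_zero_divisors"
  assumes "xpart m f \<noteq> 0" "xpart n g \<noteq> 0"
    and "(\<forall>k\<in>keys f. xpow k \<le> m) \<and> (\<forall>k\<in>keys g. xpow k \<le> n) \<or>
      (\<forall>k\<in>keys f. m \<le> xpow k) \<and> (\<forall>k\<in>keys g. n \<le> xpow k)"
  shows "\<exists>k\<in>keys (f * g). xpow k = m + n"
proof -
  have "xpart (m + n) (f * g) = xpart m f * xpart n g"
    using assms(3) by (intro xpart_mult) fastforce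
  also have "\<dots> \<noteq> 0"
    using klein_no_zero_divisors assms(1,2) by blast
  finally show ?thesis
    by (rule xpart_nonzeroD)
qed

section \<open>The unimodular pair and its ideal\<close>

abbreviation kmon :: "int \<Rightarrow> int \<Rightarrow> (klein \<Rightarrow>\<^sub>0 'a::ring_1)" where
  "kmon m e \<equiv> single (Klein m e) 1"

text \<open>The element \<open>r\<close>; conjugation by \<open>x\<close> turns it into
  \<open>kr'\<close>, that is, \<open>x * r = r' * x\<close>.\<close>

definition kr :: "klein \<Rightarrow>\<^sub>0 'a::ring_1" where
  "kr = kmon 0 0 + kmon 1 0 - kmon 3 0"

definition kr' :: "klein \<Rightarrow>\<^sub>0 'a::ring_1" where
  "kr' = kmon 0 0 + kmon (- 1) 0 - kmon (- 3) 0"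

definition ks :: "klein \<Rightarrow>\<^sub>0 'a::ring_1" where
  "ks = kmon 0 1 + kmon 0 0"

text \<open>Bezout coefficient in \<open>y r + (y\<^sup>4 - y\<^sup>3) r' = 1\<close>.\<close>

definition kb :: "klein \<Rightarrow>\<^sub>0 'a::ring_1" where
  "kb = kmon 4 0 - kmon 3 0"

lemma kmon_one: "kmon 0 0 = 1"
  by (simp flip: zero_klein_def)

lemmas kdefs = kr_def kr'_def ks_def kb_def

text \<open>Because \<open>x * r = r' * x\<close>, the terms that contain \<open>x\<close> cancel
  and the Bezout identity remains.\<close>

lemma klein_unimodular:
  "(kmon 1 0 - kb * kmon 0 1) * kr + kb * kr' * ks = (1 :: klein \<Rightarrow>\<^sub>0 'a::ring_1)"
  by (simp add: kdefs distrib_left distrib_right left_diff_distrib right_diff_distrib mult_single kmon_one)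

text \<open>First coordinates of the elements in the kernel of the column \<open>(kr, ks)\<close>,
  up to the sign of \<open>b\<close>. Over a field the second coordinate is determined by the
  first.\<close>

definition klein_ideal :: "(klein \<Rightarrow>\<^sub>0 'a::ring_1) set" where
  "klein_ideal = {a. \<exists>b. a * kr = b * ks}"

text \<open>Conjugation by \<open>x\<close> inverts \<open>y\<close>, so its square is
  trivial.\<close>

lemma klein_central: "kmon 0 2 * f = f * kmon 0 2" for f :: "klein \<Rightarrow>\<^sub>0 'a::ring_1"
proof (induction f rule: poly_mapping_additive_induct)
  case (single k c)
  then show ?case
    by (cases k) (simp add: mult_single add.commute)
qed (simp add: distrib_left distrib_right)

text \<open>A generator \<open>p\<close> of the ideal would satisfy these hypotheses for some
  \<open>q\<close> and \<open>t\<close>: both \<open>x^2 - 1\<close> and \<open>ks * kr'\<close> lie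
  in the ideal, and in a domain a left cofactor of the central element \<open>x^2 - 1\<close> is
  also a right one.\<close>

lemma klein_ideal_not_principal:
  fixes p q t :: "klein \<Rightarrow>\<^sub>0 'a::field"
  assumes p: "p \<in> klein_ideal" and pt: "p * t = kmon 0 2 - 1" and qp: "q * p = ks * kr'"
  shows False
proof -
  have g_eq: "ks * kr' = kr * kmon 0 1 + (kr' :: klein \<Rightarrow>\<^sub>0 'a)"
    by (simp add: kdefs distrib_left distrib_right left_diff_distrib right_diff_distrib mult_single)
  have g_lookup: "lookup (ks * kr' :: klein \<Rightarrow>\<^sub>0 'a) (Klein 0 0) = 1"
    unfolding g_eq by (simp add: kdefs left_diff_distrib distrib_right mult_single lookup_add lookup_minus lookup_single when_def)
  have g_keys: "xpow k \<in> {0, 1}" if "k \<in> keys (ks * kr' :: klein \<Rightarrow>\<^sub>0 'a)" for k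
    using that unfolding g_eq by (auto simp: kdefs left_diff_distrib distrib_right mult_single lookup_add lookup_minus
        lookup_single when_def in_keys_iff split: if_splits)
  have nz: "p \<noteq> 0" "q \<noteq> 0"
    using qp g_lookup by auto
  obtain lp hp where bp: "lp \<le> hp" "xpart lp p \<noteq> 0" "xpart hp p \<noteq> 0"
      "\<forall>k\<in>keys p. lp \<le> xpow k \<and> xpow k \<le> hp"
    using xpart_bounds[OF nz(1)] .
  obtain lq hq where bq: "lq \<le> hq" "xpart lq q \<noteq> 0" "xpart hq q \<noteq> 0"
      "\<forall>k\<in>keys q. lq \<le> xpow k \<and> xpow k \<le> hq"
    using xpart_bounds[OF nz(2)] .
  \<comment> \<open>The product occupies only the degrees \<open>0\<close> and \<open>1\<close> in
    \<open>x\<close>, so at least one of \<open>p\<close> and \<open>q\<close> is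
    homogeneous.\<close>
  have "\<exists>k\<in>keys (q * p). xpow k = hq + hp" "\<exists>k\<in>keys (q * p). xpow k = lq + lp"
    using bp bq by (auto intro!: xpart_top_mult_nonzero)
  then have "hq + hp \<le> 1" "lq + lp \<ge> 0"
    using g_keys unfolding qp by fastforce+
  then consider "lp = hp" | "lq = hq"
    using bp(1) bq(1) by linarith
  then show False
  proof cases
    \<comment> \<open>With \<open>p\<close> also \<open>p * kr\<close> is homogeneous. The equal
      product \<open>b * ks\<close> is not, because \<open>ks\<close> contributes two different
      degrees.\<close>
    case 1
    obtain b where b: "p * kr = b * ks"
      using p by (auto simp: klein_ideal_def)
    have "xpow k = hp" if "k \<in> keys (p * kr)" for k
    proof -
      have "xpow k = 0" if "k \<in> keys (kr :: klein \<Rightarrow>\<^sub>0 'a)" for k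
        using that by (auto simp: kdefs in_keys_iff lookup_add lookup_minus lookup_single when_def split: if_splits)
      then show ?thesis
        using keys_mult[of p kr] that bp(4) 1 by fastforce
    qed
    note homog = this[unfolded b]
    have "lookup (kr :: klein \<Rightarrow>\<^sub>0 'a) (Klein 0 0) \<noteq> 0"
      by (simp add: kdefs lookup_add lookup_minus lookup_single when_def)
    then have "b \<noteq> 0"
      using klein_no_zero_divisors[of p kr] nz(1) b by auto
    then obtain l h where bb: "l \<le> h" "xpart l b \<noteq> 0" "xpart h b \<noteq> 0"
      "\<forall>k\<in>keys b. l \<le> xpow k \<and> xpow k \<le> h"
      using xpart_bounds by metis
    have ks: "xpart 0 (ks :: klein \<Rightarrow>\<^sub>0 'a) \<noteq> 0" "xpart 1 (ks :: klein \<Rightarrow>\<^sub>0 'a) \<noteq> 0"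
      "\<And>k. k \<in> keys (ks :: klein \<Rightarrow>\<^sub>0 'a) \<Longrightarrow> 0 \<le> xpow k \<and> xpow k \<le> 1"
    proof -
      have "lookup (xpart 0 (ks :: klein \<Rightarrow>\<^sub>0 'a)) (Klein 0 0) \<noteq> 0" "lookup (xpart 1 (ks :: klein \<Rightarrow>\<^sub>0 'a)) (Klein 0 1) \<noteq> 0"
        by (simp_all add: lookup_xpart kdefs lookup_add lookup_single when_def)
      then show "xpart 0 (ks :: klein \<Rightarrow>\<^sub>0 'a) \<noteq> 0" "xpart 1 (ks :: klein \<Rightarrow>\<^sub>0 'a) \<noteq> 0"
        by auto
    qed (auto simp: kdefs in_keys_iff lookup_add lookup_single when_def split: if_splits)
    have "\<exists>k\<in>keys (b * ks). xpow k = h + 1" "\<exists>k\<in>keys (b * ks). xpow k = l + 0"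
      using xpart_top_mult_nonzero[of h b 1 ks] xpart_top_mult_nonzero[of l b 0 ks] bb ks by auto
    then show False
      using homog bb(1) by fastforce
  next
    case 2
    have xpart_q: "xpart e (q * f) = q * xpart (e - hq) f" for e f
      using xpart_mult[of q f hq "e - hq"] bq(4) 2 xpart_homogeneous[of q hq] by force
    \<comment> \<open>For homogeneous \<open>q\<close> the identity splits by degree into
      \<open>q * p1 = r * x\<close> and \<open>q * p0 = r'\<close>. Coprimality of \<open>r\<close>
      and \<open>r'\<close> then makes \<open>q\<close> right invertible.\<close>
    define p0 p1 where "p0 = xpart (0 - hq) p" and "p1 = xpart (1 - hq) p"
    have "q * p1 = kr * kmon 0 1"
      unfolding p1_def xpart_q[symmetric] qp g_eq
      by (rule poly_mapping_eqI) (auto simp: lookup_xpart kdefs left_diff_distrib distrib_right mult_single lookup_add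
          lookup_minus lookup_single when_def)
    moreover have "q * p0 = kr'"
      unfolding p0_def xpart_q[symmetric] qp g_eq
      by (rule poly_mapping_eqI) (auto simp: lookup_xpart kdefs left_diff_distrib distrib_right mult_single lookup_add
          lookup_minus lookup_single when_def)
    moreover have "kr * kmon 0 1 * (kmon 0 (- 1) * kmon 1 0) + kr' * kb = (1 :: klein \<Rightarrow>\<^sub>0 'a)"
      by (simp add: kdefs distrib_left distrib_right left_diff_distrib right_diff_distrib mult_single kmon_one)
    ultimately have "q * (p1 * (kmon 0 (- 1) * kmon 1 0) + p0 * kb) = 1"
      by (simp add: distrib_left mult.assoc[symmetric])
    then obtain w where qw: "q * w = 1"
      by blast
    \<comment> \<open>Factoring the central element \<open>x^2 - 1\<close> as \<open>ks\<close>
      times \<open>x - 1\<close> and cancelling \<open>ks\<close> leaves \<open>(x - 1) * q\<close>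
      as a right multiple of \<open>r'\<close>; the right inverse of \<open>q\<close> then does the
      same for \<open>x - 1\<close>.\<close>
    have "ks * (kmon 0 1 - 1) * q = (kmon 0 2 - 1) * q"
      by (simp add: kdefs distrib_right right_diff_distrib mult_single kmon_one)
    also have "\<dots> = q * (p * t)"
      by (simp add: pt left_diff_distrib right_diff_distrib klein_central)
    also have "\<dots> = ks * kr' * t"
      by (simp add: mult.assoc[symmetric] qp)
    finally have "ks * ((kmon 0 1 - 1) * q - kr' * t) = 0"
      by (subst right_diff_distrib) (simp add: mult.assoc)
    moreover have "ks \<noteq> (0 :: klein \<Rightarrow>\<^sub>0 'a)"
      using qp nz g_lookup by auto
    ultimately have t: "(kmon 0 1 - 1) * q = kr' * t"
      using klein_no_zero_divisors by fastforce
    have "kr' * (t * w) = (kmon 0 1 - 1) * q * w"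
      by (simp only: t mult.assoc)
    also have "\<dots> = kmon 0 1 - 1"
      by (simp only: mult.assoc qw mult_1_right)
    finally have eq: "kr' * (t * w) = kmon 0 1 - 1" .
    \<comment> \<open>In degree \<open>0\<close> this makes \<open>r'\<close> a divisor of
      \<open>1\<close>, although such a divisor has only one key.\<close>
    have "xpart (0 + 0) (kr' * (t * w)) = xpart 0 kr' * xpart 0 (t * w)"
      by (rule xpart_mult) (auto simp: kdefs in_keys_iff lookup_add lookup_minus lookup_single when_def split: if_splits)
    moreover have "xpart 0 kr' = (kr' :: klein \<Rightarrow>\<^sub>0 'a)"
      by (rule xpart_homogeneous) (auto simp: kdefs in_keys_iff lookup_add lookup_minus lookup_single when_def split: if_splits)
    moreover have "xpart 0 (kmon 0 1 - 1) = (- 1 :: klein \<Rightarrow>\<^sub>0 'a)"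
      by (rule poly_mapping_eqI) (auto simp: lookup_xpart lookup_minus lookup_single lookup_one when_def zero_klein_def)
    ultimately have "kr' * xpart 0 (t * w) = - 1"
      by (simp add: eq)
    then have "kr' * (- xpart 0 (t * w)) = 1"
      by (metis minus_mult_right add.inverse_inverse)
    moreover have "Klein 0 0 \<in> keys (kr' :: klein \<Rightarrow>\<^sub>0 'a)" "Klein (- 1) 0 \<in> keys (kr' :: klein \<Rightarrow>\<^sub>0 'a)"
      by (simp_all add: kdefs in_keys_iff lookup_add lookup_minus lookup_single when_def)
    ultimately show False
      using klein_unit by (metis klein.inject neg_equal_0_iff_equal zero_neq_one)
  qed
qed

text \<open>A linear form is determined by its value at the central element \<open>z\<close> of the
  ideal. If it took a nonzero scalar value at \<open>p\<close>, then \<open>p\<close> would satisfy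
  the hypotheses of \<open>klein_ideal_not_principal\<close>.\<close>

lemma rigid_klein_ideal: "rigid (klein_ideal :: (klein \<Rightarrow>\<^sub>0 'a::field) set)"
proof -
  let ?I = "klein_ideal :: (klein \<Rightarrow>\<^sub>0 'a) set"
  have add: "a + b \<in> ?I" if "a \<in> ?I" "b \<in> ?I" for a b
    using that unfolding klein_ideal_def mem_Collect_eq by (metis distrib_right)
  have mult: "c * a \<in> ?I" if "a \<in> ?I" for a c
    using that unfolding klein_ideal_def mem_Collect_eq by (metis mult.assoc)
  define z :: "klein \<Rightarrow>\<^sub>0 'a" where "z = kmon 0 2 - 1"
  have "z * kr = kr * (kmon 0 1 - 1) * ks"
    by (simp add: z_def kdefs distrib_left distrib_right left_diff_distrib right_diff_distrib mult_single kmon_one)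
  then have zI: "z \<in> ?I"
    by (auto simp: klein_ideal_def)
  have "ks * kr' * kr = kr * kr' * (ks :: klein \<Rightarrow>\<^sub>0 'a)"
    by (simp add: kdefs distrib_left distrib_right left_diff_distrib right_diff_distrib mult_single kmon_one)
  then have gI: "ks * kr' \<in> ?I"
    by (auto simp: klein_ideal_def)
  have "lookup z (Klein 0 0) \<noteq> 0"
    by (simp add: z_def lookup_minus lookup_single lookup_one when_def zero_klein_def)
  then have "z \<noteq> 0"
    by auto
  have z_central: "z * f = f * z" for f
    by (simp add: z_def left_diff_distrib right_diff_distrib klein_central)
  have "\<psi> a = 0"
    if \<psi>_mult: "\<And>c a. a \<in> ?I \<Longrightarrow> \<psi> (c * a) = c * \<psi> a" and p: "p \<in> ?I" "p \<noteq> 0" "keys (\<psi> p) \<subseteq> {0}" and a: "a \<in> ?I"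
    for \<psi> p a
  proof -
    \<comment> \<open>Up to the central denominator \<open>z\<close>, the form \<open>\<psi>\<close>
      is right multiplication by \<open>\<psi> z\<close>.\<close>
    have swap: "z * \<psi> b = b * \<psi> z" if "b \<in> ?I" for b
      using \<psi>_mult[OF that, of z] \<psi>_mult[OF zI, of b] by (simp add: z_central)
    obtain c where c: "\<psi> p = single 0 c"
    proof
      show "\<psi> p = single 0 (lookup (\<psi> p) 0)"
        by (rule poly_mapping_eqI) (use p(3) in \<open>auto simp: lookup_single when_def in_keys_iff\<close>)
    qed
    show ?thesis
    proof (cases "c = 0")
      case True
      then have "p * \<psi> z = 0"
        using swap[OF p(1)] c by simp
      then have "\<psi> z = 0"
        using klein_no_zero_divisors p(2) by blast
      then show ?thesis
        using swap[OF a] klein_no_zero_divisors \<open>z \<noteq> 0\<close> by fastforce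
    next
      case False
      define t where "t = \<psi> z * single 0 (inverse c)"
      define q where "q = \<psi> (ks * kr') * single 0 (inverse c)"
      have pt: "p * t = z"
        using False by (simp add: t_def mult.assoc[symmetric] swap[OF p(1), symmetric] c) (simp add: mult.assoc mult_single)
      have "q * z = ks * kr' * t"
        by (simp add: t_def q_def mult.assoc[symmetric] swap[OF gI, symmetric] flip: z_central)
      then have "(q * p - ks * kr') * t = 0"
        by (simp add: left_diff_distrib mult.assoc pt)
      moreover have "t \<noteq> 0"
        using pt \<open>z \<noteq> 0\<close> by auto
      ultimately have "q * p = ks * kr'"
        using klein_no_zero_divisors by fastforce
      then show ?thesis
        using klein_ideal_not_principal p(1) pt unfolding z_def by blast
    qed
  qed
  moreover have "0 \<in> ?I"
    by (auto simp: klein_ideal_def intro: exI[of _ 0])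
  ultimately show ?thesis
    unfolding rigid_def using add mult by blast
qed

section \<open>Kernels of unimodular columns\<close>

lemma (in left_module) left_module_submodule:
  assumes "N \<subseteq> carrier M" "\<zero>\<^bsub>M\<^esub> \<in> N" "\<And>x y. x \<in> N \<Longrightarrow> y \<in> N \<Longrightarrow> x \<oplus>\<^bsub>M\<^esub> y \<in> N"
    "\<And>r x. r \<in> carrier R \<Longrightarrow> x \<in> N \<Longrightarrow> r \<odot>\<^bsub>M\<^esub> x \<in> N"
  shows "left_module R (M\<lparr>carrier := N\<rparr>)"
proof (intro left_module.intro left_module_axioms.intro)
  have N: "x \<in> carrier M" if "x \<in> N" for x
    using that assms(1) by blast
  show "abelian_group (M\<lparr>carrier := N\<rparr>)"
  proof (rule abelian_groupI)
    fix x
    assume "x \<in> carrier (M\<lparr>carrier := N\<rparr>)"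
    then have x: "x \<in> N"
      by simp
    have "(\<ominus> \<one>) \<odot>\<^bsub>M\<^esub> x \<oplus>\<^bsub>M\<^esub> x = ((\<ominus> \<one>) \<oplus> \<one>) \<odot>\<^bsub>M\<^esub> x"
      using x N by (subst smult_l_distr) auto
    also have "\<dots> = \<zero>\<^bsub>M\<^esub>"
      using x N by (simp add: R.l_neg)
    finally show "\<exists>y\<in>carrier (M\<lparr>carrier := N\<rparr>). y \<oplus>\<^bsub>M\<lparr>carrier := N\<rparr>\<^esub> x = \<zero>\<^bsub>M\<lparr>carrier := N\<rparr>\<^esub>"
      using assms(4)[OF _ x, of "\<ominus> \<one>"] by auto
  qed (use assms N in \<open>auto simp: M.a_ac\<close>)
qed (use assms in \<open>auto simp: smult_l_distr smult_r_distr smult_assoc1 subset_iff intro: R.ring_axioms\<close>)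

text \<open>The definition of finite generation sums over a set, whereas a family may repeat
  elements. Closure of the span \<open>N\<close> under sums avoids collecting equal
  generators.\<close>

lemma (in left_module) finitely_generatedI:
  assumes I: "finite I" and b: "b \<in> I \<rightarrow> carrier M"
    and gen: "\<And>x. x \<in> carrier M \<Longrightarrow> \<exists>a\<in>I \<rightarrow> carrier R. x = (\<Oplus>\<^bsub>M\<^esub>i\<in>I. a i \<odot>\<^bsub>M\<^esub> b i)"
  shows "finitely_generated_module R M"
proof -
  define S where "S = b ` I"
  have S: "finite S" "S \<subseteq> carrier M" and sM: "\<And>s. s \<in> S \<Longrightarrow> s \<in> carrier M"
    using I b by (auto simp: S_def)
  define N where "N = {x. \<exists>c\<in>S \<rightarrow> carrier R. x = (\<Oplus>\<^bsub>M\<^esub>s\<in>S. c s \<odot>\<^bsub>M\<^esub> s)}"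
  have N_zero: "\<zero>\<^bsub>M\<^esub> \<in> N"
  proof -
    have "(\<Oplus>\<^bsub>M\<^esub>s\<in>S. \<zero> \<odot>\<^bsub>M\<^esub> s) = \<zero>\<^bsub>M\<^esub>"
      using sM by (intro M.add.finprod_one_eqI) auto
    then show ?thesis
      unfolding N_def by (intro CollectI bexI[of _ "\<lambda>_. \<zero>"]) auto
  qed
  have N_add: "x \<oplus>\<^bsub>M\<^esub> y \<in> N" if xy: "x \<in> N" "y \<in> N" for x y
  proof -
    obtain c d where c: "c \<in> S \<rightarrow> carrier R" "x = (\<Oplus>\<^bsub>M\<^esub>s\<in>S. c s \<odot>\<^bsub>M\<^esub> s)"
      and d: "d \<in> S \<rightarrow> carrier R" "y = (\<Oplus>\<^bsub>M\<^esub>s\<in>S. d s \<odot>\<^bsub>M\<^esub> s)"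
      using xy by (auto simp: N_def)
    have c': "c s \<in> carrier R" "d s \<in> carrier R" if "s \<in> S" for s
      using c d that by auto
    have "x \<oplus>\<^bsub>M\<^esub> y = (\<Oplus>\<^bsub>M\<^esub>s\<in>S. c s \<odot>\<^bsub>M\<^esub> s \<oplus>\<^bsub>M\<^esub> d s \<odot>\<^bsub>M\<^esub> s)"
      unfolding c(2) d(2) using c' sM by (intro M.finsum_addf[symmetric]) auto
    also have "\<dots> = (\<Oplus>\<^bsub>M\<^esub>s\<in>S. (c s \<oplus> d s) \<odot>\<^bsub>M\<^esub> s)"
      using c' sM by (intro M.finsum_cong') (auto simp: smult_l_distr)
    finally show ?thesis
      unfolding N_def using c' by (intro CollectI bexI[of _ "\<lambda>s. c s \<oplus> d s"]) auto
  qed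
  have N_gen: "r \<odot>\<^bsub>M\<^esub> s \<in> N" if r: "r \<in> carrier R" and s: "s \<in> S" for r s
  proof -
    have "(\<Oplus>\<^bsub>M\<^esub>t\<in>S. (if s = t then r \<odot>\<^bsub>M\<^esub> t else \<zero>\<^bsub>M\<^esub>)) = r \<odot>\<^bsub>M\<^esub> s"
      using r s S sM by (intro M.add.finprod_singleton) auto
    also have "(\<Oplus>\<^bsub>M\<^esub>t\<in>S. (if s = t then r \<odot>\<^bsub>M\<^esub> t else \<zero>\<^bsub>M\<^esub>)) =
        (\<Oplus>\<^bsub>M\<^esub>t\<in>S. (if s = t then r else \<zero>) \<odot>\<^bsub>M\<^esub> t)"
      using r sM by (intro M.finsum_cong') auto
    finally show ?thesis
      unfolding N_def using r by (intro CollectI bexI[of _ "\<lambda>t. if s = t then r else \<zero>"]) auto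
  qed
  have "\<exists>c\<in>S \<rightarrow> carrier R. x = (\<Oplus>\<^bsub>M\<^esub>s\<in>S. c s \<odot>\<^bsub>M\<^esub> s)" if x: "x \<in> carrier M" for x
  proof -
    obtain a where a: "a \<in> I \<rightarrow> carrier R" "x = (\<Oplus>\<^bsub>M\<^esub>i\<in>I. a i \<odot>\<^bsub>M\<^esub> b i)"
      using gen[OF x] by blast
    have "(\<Oplus>\<^bsub>M\<^esub>i\<in>J. a i \<odot>\<^bsub>M\<^esub> b i) \<in> N" if "finite J" "J \<subseteq> I" for J
      using that
    proof (induction J rule: finite_induct)
      case (insert i J)
      then have "(\<Oplus>\<^bsub>M\<^esub>i\<in>insert i J. a i \<odot>\<^bsub>M\<^esub> b i) = a i \<odot>\<^bsub>M\<^esub> b i \<oplus>\<^bsub>M\<^esub> (\<Oplus>\<^bsub>M\<^esub>i\<in>J. a i \<odot>\<^bsub>M\<^esub> b i)"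
        using a(1) b by (intro M.finsum_insert) (auto simp: Pi_iff subset_iff)
      with insert show ?case
        using a(1) by (auto intro!: N_add N_gen simp: S_def)
    qed (simp add: N_zero)
    from this[OF I] show ?thesis
      unfolding a(2)[symmetric] by (simp add: N_def)
  qed
  then show ?thesis
    unfolding finitely_generated_module_def using S by blast
qed

context ring
begin

section \<open>Free modules of finite rank\<close>

definition basis_vector :: "nat \<Rightarrow> nat \<Rightarrow> nat \<Rightarrow> 'a" where
  "basis_vector m i = (\<lambda>j\<in>{..<m}. if i = j then \<one> else \<zero>)"

abbreviation "free_rank \<equiv> free_module_of_rank R"

lemma free_rank_simps [simp]:
  "x \<in> carrier (free_rank m) \<longleftrightarrow> x \<in> (\<Pi>\<^sub>E i\<in>{..<m}. carrier R)"
  "\<zero>\<^bsub>free_rank m\<^esub> = (\<lambda>i\<in>{..<m}. \<zero>)"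
  "x \<oplus>\<^bsub>free_rank m\<^esub> y = (\<lambda>i\<in>{..<m}. x i \<oplus> y i)"
  "r \<odot>\<^bsub>free_rank m\<^esub> x = (\<lambda>i\<in>{..<m}. r \<otimes> x i)"
  by (simp_all add: free_module_of_rank_def)

lemma basis_vector_closed: "basis_vector m i \<in> carrier (free_rank m)"
  by (auto simp: basis_vector_def)

lemma free_rank_finsum:
  assumes "finite J" "\<And>i. i \<in> J \<Longrightarrow> y i \<in> carrier (free_rank m)" "j < m"
  shows "(\<Oplus>\<^bsub>free_rank m\<^esub>i\<in>J. y i) j = (\<Oplus>i\<in>J. y i j)"
proof -
  interpret F: left_module R "free_rank m"
    by (rule left_module_free_module_of_rank) (rule ring_axioms)
  show ?thesis
    using assms(1,2)
  proof (induction J rule: finite_induct)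
    case (insert i J)
    have y: "y \<in> J \<rightarrow> carrier (free_rank m)" "y i \<in> carrier (free_rank m)"
      using insert by blast+
    have yj: "(\<lambda>i. y i j) \<in> J \<rightarrow> carrier R" "y i j \<in> carrier R"
      using insert.prems assms(3) by (auto simp: PiE_iff)
    have "(\<Oplus>\<^bsub>free_rank m\<^esub>i\<in>insert i J. y i) = y i \<oplus>\<^bsub>free_rank m\<^esub> (\<Oplus>\<^bsub>free_rank m\<^esub>i\<in>J. y i)"
      using insert.hyps y by (rule F.M.finsum_insert)
    then show ?case
      using insert yj assms(3) by simp
  qed (use assms(3) in simp)
qed

lemma free_rank_expand:
  assumes "x \<in> carrier (free_rank m)"
  shows "x = (\<Oplus>\<^bsub>free_rank m\<^esub>i\<in>{..<m}. x i \<odot>\<^bsub>free_rank m\<^esub> basis_vector m i)"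
proof -
  interpret F: left_module R "free_rank m"
    by (rule left_module_free_module_of_rank) (rule ring_axioms)
  have x: "x i \<in> carrier R" if "i < m" for i
    using assms that by (auto simp: PiE_iff)
  have trm: "x i \<odot>\<^bsub>free_rank m\<^esub> basis_vector m i \<in> carrier (free_rank m)" if "i \<in> {..<m}" for i
    using x that basis_vector_closed by (intro F.smult_closed) auto
  have sum: "(\<Oplus>\<^bsub>free_rank m\<^esub>i\<in>{..<m}. x i \<odot>\<^bsub>free_rank m\<^esub> basis_vector m i) \<in> carrier (free_rank m)"
    using trm by (intro F.M.finsum_closed) blast
  show ?thesis
  proof (rule PiE_ext)
    show "x \<in> (\<Pi>\<^sub>E i\<in>{..<m}. carrier R)"
      using assms by simp
    show "(\<Oplus>\<^bsub>free_rank m\<^esub>i\<in>{..<m}. x i \<odot>\<^bsub>free_rank m\<^esub> basis_vector m i) \<in> (\<Pi>\<^sub>E i\<in>{..<m}. carrier R)"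
      using sum by simp
    fix j
    assume j: "j \<in> {..<m}"
    have "(\<Oplus>\<^bsub>free_rank m\<^esub>i\<in>{..<m}. x i \<odot>\<^bsub>free_rank m\<^esub> basis_vector m i) j =
        (\<Oplus>i\<in>{..<m}. (x i \<odot>\<^bsub>free_rank m\<^esub> basis_vector m i) j)"
      using trm j by (intro free_rank_finsum) auto
    also have "\<dots> = (\<Oplus>i\<in>{..<m}. if j = i then x i else \<zero>)"
      using j x by (intro finsum_cong') (auto simp: basis_vector_def)
    also have "\<dots> = x j"
      using j x by (intro add.finprod_singleton) auto
    finally show "x j = (\<Oplus>\<^bsub>free_rank m\<^esub>i\<in>{..<m}. x i \<odot>\<^bsub>free_rank m\<^esub> basis_vector m i) j" ..
  qed
qed

lemma finitely_generated_free_rank: "finitely_generated_module R (free_rank m)"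
proof -
  interpret F: left_module R "free_rank m"
    by (rule left_module_free_module_of_rank) (rule ring_axioms)
  show ?thesis
  proof (rule F.finitely_generatedI[of "{..<m}" "basis_vector m"])
    fix x
    assume x: "x \<in> carrier (free_rank m)"
    then have "x \<in> {..<m} \<rightarrow> carrier R"
      by auto
    with free_rank_expand[OF x]
    show "\<exists>a\<in>{..<m} \<rightarrow> carrier R. x = (\<Oplus>\<^bsub>free_rank m\<^esub>i\<in>{..<m}. a i \<odot>\<^bsub>free_rank m\<^esub> basis_vector m i)"
      by blast
  qed (use basis_vector_closed in blast)+
qed

lemma projective_free_rank: "projective_module R (free_rank m)"
  unfolding projective_module_def
proof (intro allI impI ballI)
  interpret F: left_module R "free_rank m"
    by (rule left_module_free_module_of_rank) (rule ring_axioms)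
  fix A :: "('a, (nat \<Rightarrow> 'a) \<Rightarrow> 'a) module" and B :: "('a, nat \<Rightarrow> 'a) module" and f g
  assume A: "left_module R A" and B: "left_module R B"
    and f: "f \<in> left_module_hom R A B" and g: "g \<in> left_module_hom R (free_rank m) B"
    and surj: "f ` carrier A = carrier B"
  interpret A: left_module R A by fact
  interpret B: left_module R B by fact
  have "\<exists>a\<in>carrier A. f a = g (basis_vector m i)" for i
  proof -
    have "g (basis_vector m i) \<in> f ` carrier A"
      using g basis_vector_closed unfolding surj left_module_hom_def by blast
    then show ?thesis
      by auto
  qed
  then obtain a where a: "\<And>i. a i \<in> carrier A" "\<And>i. f (a i) = g (basis_vector m i)"
    by metis
  define h where "h x = (\<Oplus>\<^bsub>A\<^esub>i\<in>{..<m}. x i \<odot>\<^bsub>A\<^esub> a i)" for x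
  have coeff: "x i \<in> carrier R" if "x \<in> carrier (free_rank m)" "i < m" for x i
    using that by (auto simp: PiE_iff)
  have "h \<in> left_module_hom R (free_rank m) A"
    unfolding left_module_hom_def
  proof (intro CollectI conjI ballI)
    show "h \<in> carrier (free_rank m) \<rightarrow> carrier A"
      using coeff a by (auto simp: h_def simp del: free_rank_simps(1) intro!: A.M.finsum_closed)
    fix x
    assume x: "x \<in> carrier (free_rank m)"
    show "h (x \<oplus>\<^bsub>free_rank m\<^esub> y) = h x \<oplus>\<^bsub>A\<^esub> h y" if y: "y \<in> carrier (free_rank m)" for y
    proof -
      have "h (x \<oplus>\<^bsub>free_rank m\<^esub> y) = (\<Oplus>\<^bsub>A\<^esub>i\<in>{..<m}. x i \<odot>\<^bsub>A\<^esub> a i \<oplus>\<^bsub>A\<^esub> y i \<odot>\<^bsub>A\<^esub> a i)"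
        unfolding h_def using coeff[OF x] coeff[OF y] a
        by (intro A.M.finsum_cong') (auto simp: A.smult_l_distr)
      also have "\<dots> = h x \<oplus>\<^bsub>A\<^esub> h y"
        unfolding h_def using coeff[OF x] coeff[OF y] a by (intro A.M.finsum_addf) auto
      finally show ?thesis .
    qed
    show "h (r \<odot>\<^bsub>free_rank m\<^esub> x) = r \<odot>\<^bsub>A\<^esub> h x" if r: "r \<in> carrier R" for r
    proof -
      have "h (r \<odot>\<^bsub>free_rank m\<^esub> x) = (\<Oplus>\<^bsub>A\<^esub>i\<in>{..<m}. r \<odot>\<^bsub>A\<^esub> (x i \<odot>\<^bsub>A\<^esub> a i))"
        unfolding h_def using coeff[OF x] r a
        by (intro A.M.finsum_cong') (auto simp: A.smult_assoc1)
      also have "\<dots> = r \<odot>\<^bsub>A\<^esub> h x"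
        unfolding h_def using coeff[OF x] r a by (intro A.finsum_smult_ldistr[symmetric]) auto
      finally show ?thesis .
    qed
  qed
  moreover have "f (h x) = g x" if x: "x \<in> carrier (free_rank m)" for x
  proof -
    have trm: "x i \<odot>\<^bsub>free_rank m\<^esub> basis_vector m i \<in> carrier (free_rank m)" if "i \<in> {..<m}" for i
      using coeff[OF x] that basis_vector_closed by (intro F.smult_closed) auto
    have gB: "g y \<in> carrier B" if "y \<in> carrier (free_rank m)" for y
      using g that unfolding left_module_hom_def by blast
    have g_smult: "g (r \<odot>\<^bsub>free_rank m\<^esub> y) = r \<odot>\<^bsub>B\<^esub> g y" if "r \<in> carrier R" "y \<in> carrier (free_rank m)" for r y
      using g that unfolding left_module_hom_def by blast
    have f_smult: "f (r \<odot>\<^bsub>A\<^esub> y) = r \<odot>\<^bsub>B\<^esub> f y" if "r \<in> carrier R" "y \<in> carrier A" for r y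
      using f that unfolding left_module_hom_def by blast
    have "f (h x) = (\<Oplus>\<^bsub>B\<^esub>i\<in>{..<m}. f (x i \<odot>\<^bsub>A\<^esub> a i))"
      unfolding h_def using coeff[OF x] a by (intro A.hom_finsum B f) auto
    also have "\<dots> = (\<Oplus>\<^bsub>B\<^esub>i\<in>{..<m}. g (x i \<odot>\<^bsub>free_rank m\<^esub> basis_vector m i))"
    proof (rule B.M.finsum_cong')
      show "(\<lambda>i. g (x i \<odot>\<^bsub>free_rank m\<^esub> basis_vector m i)) \<in> {..<m} \<rightarrow> carrier B"
        using gB trm by blast
      show "f (x i \<odot>\<^bsub>A\<^esub> a i) = g (x i \<odot>\<^bsub>free_rank m\<^esub> basis_vector m i)" if "i \<in> {..<m}" for i
        using that coeff[OF x] a basis_vector_closed by (simp only: f_smult g_smult lessThan_iff)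
    qed simp
    also have "\<dots> = g (\<Oplus>\<^bsub>free_rank m\<^esub>i\<in>{..<m}. x i \<odot>\<^bsub>free_rank m\<^esub> basis_vector m i)"
      using trm by (intro F.hom_finsum[symmetric] B g) blast+
    also have "\<dots> = g x"
      by (subst free_rank_expand[OF x]) simp
    finally show ?thesis .
  qed
  ultimately show "\<exists>h\<in>left_module_hom R (free_rank m) A. \<forall>x\<in>carrier (free_rank m). f (h x) = g x"
    by blast
qed

text \<open>Both modules share a type because the test modules in \<open>projective_module\<close>
  live on types built from that of the module.\<close>

lemma projective_retract:
  fixes M N :: "('a, 'm) module"
  assumes "projective_module R M" "p \<in> left_module_hom R M N" "s \<in> left_module_hom R N M"
    "\<And>x. x \<in> carrier N \<Longrightarrow> p (s x) = x"
  shows "projective_module R N"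
  unfolding projective_module_def
proof (intro allI impI ballI)
  fix A :: "('a, 'm \<Rightarrow> 'a) module" and B :: "('a, 'm) module" and f g
  assume *: "left_module R A" "left_module R B" "f \<in> left_module_hom R A B"
    "g \<in> left_module_hom R N B" "f ` carrier A = carrier B"
  have "\<exists>h\<in>left_module_hom R M A. \<forall>x\<in>carrier M. f (h x) = g (p x)"
    using assms(1)[unfolded projective_module_def, rule_format,
        OF *(1,2,3) left_module_hom_comp[OF assms(2) *(4)] *(5)] .
  then obtain h where h: "h \<in> left_module_hom R M A" "\<And>x. x \<in> carrier M \<Longrightarrow> f (h x) = g (p x)"
    by blast
  have "f (h (s x)) = g x" if "x \<in> carrier N" for x
  proof -
    have "s x \<in> carrier M"
      using assms(3) that unfolding left_module_hom_def by blast
    then show ?thesis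
      using h(2) assms(4)[OF that] by simp
  qed
  then show "\<exists>h\<in>left_module_hom R N A. \<forall>x\<in>carrier N. f (h x) = g x"
    by (intro bexI[OF _ left_module_hom_comp[OF assms(3) h(1)]] ballI)
qed

section \<open>The kernel of a unimodular column\<close>

definition dot :: "nat \<Rightarrow> (nat \<Rightarrow> 'a) \<Rightarrow> (nat \<Rightarrow> 'a) \<Rightarrow> 'a" where
  "dot m x u = (\<Oplus>i\<in>{..<m}. x i \<otimes> u i)"

definition column_kernel :: "nat \<Rightarrow> (nat \<Rightarrow> 'a) \<Rightarrow> ('a, nat \<Rightarrow> 'a) module" where
  "column_kernel m u = (free_rank m)\<lparr>carrier := {x \<in> carrier (free_rank m). dot m x u = \<zero>}\<rparr>"

lemma dot_closed:
  "x \<in> {..<m} \<rightarrow> carrier R \<Longrightarrow> u \<in> {..<m} \<rightarrow> carrier R \<Longrightarrow> dot m x u \<in> carrier R"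
  unfolding dot_def by (intro finsum_closed) auto

lemma dot_add:
  assumes "x \<in> {..<m} \<rightarrow> carrier R" "y \<in> {..<m} \<rightarrow> carrier R" "u \<in> {..<m} \<rightarrow> carrier R"
  shows "dot m (\<lambda>i\<in>{..<m}. x i \<oplus> y i) u = dot m x u \<oplus> dot m y u"
proof -
  have "dot m (\<lambda>i\<in>{..<m}. x i \<oplus> y i) u = (\<Oplus>i\<in>{..<m}. x i \<otimes> u i \<oplus> y i \<otimes> u i)"
    unfolding dot_def using assms by (intro finsum_cong') (auto simp: l_distr Pi_iff)
  also have "\<dots> = dot m x u \<oplus> dot m y u"
    unfolding dot_def using assms by (intro finsum_addf) (auto simp: Pi_iff)
  finally show ?thesis .
qed

lemma dot_smult:
  assumes "r \<in> carrier R" "x \<in> {..<m} \<rightarrow> carrier R" "u \<in> {..<m} \<rightarrow> carrier R"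
  shows "dot m (\<lambda>i\<in>{..<m}. r \<otimes> x i) u = r \<otimes> dot m x u"
proof -
  have "dot m (\<lambda>i\<in>{..<m}. r \<otimes> x i) u = (\<Oplus>i\<in>{..<m}. r \<otimes> (x i \<otimes> u i))"
    unfolding dot_def using assms by (intro finsum_cong') (auto simp: m_assoc Pi_iff)
  also have "\<dots> = r \<otimes> dot m x u"
    unfolding dot_def using assms by (intro finsum_rdistr[symmetric]) (auto simp: Pi_iff)
  finally show ?thesis .
qed

context
  fixes m and u v :: "nat \<Rightarrow> 'a"
  assumes u: "u \<in> {..<m} \<rightarrow> carrier R" and v: "v \<in> {..<m} \<rightarrow> carrier R" and uv: "dot m v u = \<one>"
begin

abbreviation "Ker \<equiv> column_kernel m u"

text \<open>Since \<open>v\<close> pairs with \<open>u\<close> to \<open>\<one>\<close>, the free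
  module is the direct sum of the kernel and the multiples of \<open>v\<close>; this is the
  projection to the kernel.\<close>

definition kernel_proj :: "(nat \<Rightarrow> 'a) \<Rightarrow> nat \<Rightarrow> 'a" where
  "kernel_proj x = (\<lambda>i\<in>{..<m}. x i \<oplus> (\<ominus> dot m x u) \<otimes> v i)"

lemma kernel_simps [simp]:
  "x \<in> carrier Ker \<longleftrightarrow> x \<in> carrier (free_rank m) \<and> dot m x u = \<zero>"
  "\<zero>\<^bsub>Ker\<^esub> = \<zero>\<^bsub>free_rank m\<^esub>"
  "x \<oplus>\<^bsub>Ker\<^esub> y = x \<oplus>\<^bsub>free_rank m\<^esub> y"
  "r \<odot>\<^bsub>Ker\<^esub> x = r \<odot>\<^bsub>free_rank m\<^esub> x"
  by (simp_all add: column_kernel_def)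

lemma coeff: "x \<in> carrier (free_rank m) \<Longrightarrow> i < m \<Longrightarrow> x i \<in> carrier R"
  by (auto simp: PiE_iff)

lemma coeffs: "x \<in> carrier (free_rank m) \<Longrightarrow> x \<in> {..<m} \<rightarrow> carrier R"
  by (auto simp: PiE_iff)

lemma dot_u_closed: "x \<in> carrier (free_rank m) \<Longrightarrow> dot m x u \<in> carrier R"
  by (rule dot_closed[OF coeffs u])

lemma v_closed: "i < m \<Longrightarrow> v i \<in> carrier R"
  using v by auto

lemma u_closed: "i < m \<Longrightarrow> u i \<in> carrier R"
  using u by auto

lemma left_module_kernel: "left_module R Ker"
proof -
  interpret F: left_module R "free_rank m"
    by (rule left_module_free_module_of_rank) (rule ring_axioms)
  have "dot m (\<lambda>i\<in>{..<m}. \<zero>) u = \<zero>"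
    unfolding dot_def by (intro add.finprod_one_eqI) (simp add: u_closed)
  note zero = this
  show ?thesis
    unfolding column_kernel_def
  proof (rule F.left_module_submodule)
    show "{x \<in> carrier (free_rank m). dot m x u = \<zero>} \<subseteq> carrier (free_rank m)"
      by blast
    show "\<zero>\<^bsub>free_rank m\<^esub> \<in> {x \<in> carrier (free_rank m). dot m x u = \<zero>}"
      using F.M.zero_closed zero by simp
  next
    fix x y
    assume "x \<in> {x \<in> carrier (free_rank m). dot m x u = \<zero>}" "y \<in> {x \<in> carrier (free_rank m). dot m x u = \<zero>}"
    then have xy: "x \<in> carrier (free_rank m)" "y \<in> carrier (free_rank m)" "dot m x u = \<zero>" "dot m y u = \<zero>"
      by blast+
    have "dot m (x \<oplus>\<^bsub>free_rank m\<^esub> y) u = \<zero>"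
      using dot_add[OF coeffs[OF xy(1)] coeffs[OF xy(2)] u] xy(3,4) by simp
    then show "x \<oplus>\<^bsub>free_rank m\<^esub> y \<in> {x \<in> carrier (free_rank m). dot m x u = \<zero>}"
      using F.M.a_closed[OF xy(1,2)] by blast
  next
    fix r x
    assume r: "r \<in> carrier R" and "x \<in> {x \<in> carrier (free_rank m). dot m x u = \<zero>}"
    then have x: "x \<in> carrier (free_rank m)" "dot m x u = \<zero>"
      by blast+
    have "dot m (r \<odot>\<^bsub>free_rank m\<^esub> x) u = \<zero>"
      using dot_smult[OF r coeffs[OF x(1)] u] x(2) r by simp
    then show "r \<odot>\<^bsub>free_rank m\<^esub> x \<in> {x \<in> carrier (free_rank m). dot m x u = \<zero>}"
      using F.smult_closed[OF r x(1)] by blast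
  qed
qed

lemma dot_add_smult_v:
  assumes "x \<in> carrier (free_rank m)" "s \<in> carrier R"
  shows "dot m (\<lambda>i\<in>{..<m}. x i \<oplus> s \<otimes> v i) u = dot m x u \<oplus> s"
proof -
  have "dot m (\<lambda>i\<in>{..<m}. x i \<oplus> s \<otimes> v i) u = dot m (\<lambda>i\<in>{..<m}. x i \<oplus> (\<lambda>i\<in>{..<m}. s \<otimes> v i) i) u"
    by (simp cong: restrict_cong)
  also have "\<dots> = dot m x u \<oplus> dot m (\<lambda>i\<in>{..<m}. s \<otimes> v i) u"
    using assms(2) v_closed by (intro dot_add[OF coeffs[OF assms(1)] _ u]) auto
  also have "dot m (\<lambda>i\<in>{..<m}. s \<otimes> v i) u = s"
    using assms v by (simp add: dot_smult[OF _ v u] uv)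
  finally show ?thesis .
qed

lemma kernel_proj_closed:
  assumes x: "x \<in> carrier (free_rank m)"
  shows "kernel_proj x \<in> carrier Ker"
proof -
  have s: "\<ominus> dot m x u \<in> carrier R"
    using dot_u_closed[OF x] by simp
  have "dot m (kernel_proj x) u = \<zero>"
    unfolding kernel_proj_def dot_add_smult_v[OF x s] using dot_u_closed[OF x] by (rule r_neg)
  moreover have "kernel_proj x \<in> carrier (free_rank m)"
    unfolding kernel_proj_def free_rank_simps using s coeff[OF x] v_closed by (intro restrict_PiE_iff[THEN iffD2]) simp
  ultimately show ?thesis
    by (simp only: kernel_simps)
qed

lemma kernel_proj_hom: "kernel_proj \<in> left_module_hom R (free_rank m) Ker"
  unfolding left_module_hom_def
proof (intro CollectI conjI ballI)
  fix x
  assume x: "x \<in> carrier (free_rank m)"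
  show "kernel_proj (x \<oplus>\<^bsub>free_rank m\<^esub> y) = kernel_proj x \<oplus>\<^bsub>Ker\<^esub> kernel_proj y"
    if y: "y \<in> carrier (free_rank m)" for y
    unfolding kernel_simps free_rank_simps
    using dot_u_closed[OF x] dot_u_closed[OF y] v_closed coeff[OF x] coeff[OF y]
    by (auto simp: kernel_proj_def dot_add[OF coeffs[OF x] coeffs[OF y] u] minus_add l_distr a_ac intro!: restrict_ext)
  show "kernel_proj (r \<odot>\<^bsub>free_rank m\<^esub> x) = r \<odot>\<^bsub>Ker\<^esub> kernel_proj x" if r: "r \<in> carrier R" for r
    unfolding kernel_simps free_rank_simps
    using dot_u_closed[OF x] v_closed coeff[OF x] r
    by (auto simp: kernel_proj_def dot_smult[OF r coeffs[OF x] u] r_distr r_minus m_assoc l_minus intro!: restrict_ext)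
next
  show "kernel_proj \<in> carrier (free_rank m) \<rightarrow> carrier Ker"
    using kernel_proj_closed by (rule Pi_I)
qed

lemma kernel_proj_id:
  assumes "x \<in> carrier Ker"
  shows "kernel_proj x = x"
proof -
  have x: "x \<in> carrier (free_rank m)" "dot m x u = \<zero>"
    using assms by auto
  show ?thesis
  proof
    fix i
    show "kernel_proj x i = x i"
    proof (cases "i < m")
      case True
      then show ?thesis
        using v_closed coeff[OF x(1)] by (simp add: kernel_proj_def x(2))
    next
      case False
      then show ?thesis
        using x(1) by (simp add: kernel_proj_def PiE_iff extensional_def)
    qed
  qed
qed

lemma kernel_incl_hom: "(\<lambda>x. x) \<in> left_module_hom R Ker (free_rank m)"
  unfolding left_module_hom_def by (intro CollectI conjI ballI funcsetI) (simp_all only: kernel_simps)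

lemma projective_kernel: "projective_module R Ker"
  by (rule projective_retract[OF projective_free_rank kernel_proj_hom kernel_incl_hom kernel_proj_id])

lemma kernel_expand:
  assumes "x \<in> carrier Ker"
  shows "x = (\<Oplus>\<^bsub>Ker\<^esub>i\<in>{..<m}. x i \<odot>\<^bsub>Ker\<^esub> kernel_proj (basis_vector m i))"
proof -
  interpret F: left_module R "free_rank m"
    by (rule left_module_free_module_of_rank) (rule ring_axioms)
  interpret K: left_module R Ker
    by (rule left_module_kernel)
  have x: "x \<in> carrier (free_rank m)"
    using assms by simp
  have trm: "x i \<odot>\<^bsub>free_rank m\<^esub> basis_vector m i \<in> carrier (free_rank m)" if "i \<in> {..<m}" for i
    using coeff[OF x] that basis_vector_closed by (intro F.smult_closed) auto
  have hom: "kernel_proj (r \<odot>\<^bsub>free_rank m\<^esub> y) = r \<odot>\<^bsub>Ker\<^esub> kernel_proj y"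
    if "r \<in> carrier R" "y \<in> carrier (free_rank m)" for r y
    using kernel_proj_hom that unfolding left_module_hom_def by blast
  have "x = kernel_proj (\<Oplus>\<^bsub>free_rank m\<^esub>i\<in>{..<m}. x i \<odot>\<^bsub>free_rank m\<^esub> basis_vector m i)"
    by (subst free_rank_expand[OF x, symmetric]) (rule kernel_proj_id[OF assms, symmetric])
  also have "\<dots> = (\<Oplus>\<^bsub>Ker\<^esub>i\<in>{..<m}. kernel_proj (x i \<odot>\<^bsub>free_rank m\<^esub> basis_vector m i))"
    using trm by (intro F.hom_finsum left_module_kernel kernel_proj_hom) blast+
  also have "\<dots> = (\<Oplus>\<^bsub>Ker\<^esub>i\<in>{..<m}. x i \<odot>\<^bsub>Ker\<^esub> kernel_proj (basis_vector m i))"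
  proof (rule K.M.finsum_cong')
    show "(\<lambda>i. x i \<odot>\<^bsub>Ker\<^esub> kernel_proj (basis_vector m i)) \<in> {..<m} \<rightarrow> carrier Ker"
      using coeff[OF x] kernel_proj_closed[OF basis_vector_closed] by (blast intro: K.smult_closed)
    show "kernel_proj (x i \<odot>\<^bsub>free_rank m\<^esub> basis_vector m i) = x i \<odot>\<^bsub>Ker\<^esub> kernel_proj (basis_vector m i)"
      if "i \<in> {..<m}" for i
      using that coeff[OF x] by (intro hom basis_vector_closed) auto
  qed simp
  finally show ?thesis .
qed

lemma finitely_generated_kernel: "finitely_generated_module R Ker"
proof -
  interpret K: left_module R Ker
    by (rule left_module_kernel)
  show ?thesis
  proof (rule K.finitely_generatedI[of "{..<m}" "\<lambda>i. kernel_proj (basis_vector m i)"])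
    fix x
    assume "x \<in> carrier Ker"
    then show "\<exists>a\<in>{..<m} \<rightarrow> carrier R. x = (\<Oplus>\<^bsub>Ker\<^esub>i\<in>{..<m}. a i \<odot>\<^bsub>Ker\<^esub> kernel_proj (basis_vector m i))"
      using kernel_expand[of x] coeffs[of x] by (intro bexI[of _ x]) (auto simp del: free_rank_simps)
  qed (use kernel_proj_closed[OF basis_vector_closed] in blast)+
qed

text \<open>The first coordinate of \<open>f\<close> is a linear form on the kernel that takes the
  value \<open>\<one>\<close>. Here \<open>z\<close> is a preimage of the first basis vector, and
  \<open>h\<close> lists the values of the form on the projected basis vectors.\<close>

lemma surjection_from_kernel:
  assumes f: "f \<in> left_module_hom R Ker (free_rank n)" and surj: "f ` carrier Ker = carrier (free_rank n)"
    and "n > 0"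
  shows "\<exists>z\<in>{..<m} \<rightarrow> carrier R. \<exists>h\<in>{..<m} \<rightarrow> carrier R. dot m z u = \<zero> \<and> dot m z h = \<one>"
proof -
  interpret K: left_module R Ker
    by (rule left_module_kernel)
  have N: "left_module R (free_rank n)"
    by (rule left_module_free_module_of_rank) (rule ring_axioms)
  obtain z where z: "z \<in> carrier Ker" "f z = basis_vector n 0"
    using surj basis_vector_closed[of n 0] by (metis imageE)
  have z': "z \<in> carrier (free_rank m)"
    using z(1) by simp
  define b where "b i = kernel_proj (basis_vector m i)" for i
  have b: "b i \<in> carrier Ker" for i
    unfolding b_def by (rule kernel_proj_closed[OF basis_vector_closed])
  have fb: "f (b i) \<in> carrier (free_rank n)" for i
    using f b unfolding left_module_hom_def by blast
  have fb0: "f (b i) 0 \<in> carrier R" for i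
    using fb[of i] \<open>n > 0\<close> by (auto simp: PiE_iff)
  have f_smult: "f (z i \<odot>\<^bsub>Ker\<^esub> b i) = z i \<odot>\<^bsub>free_rank n\<^esub> f (b i)" if "i < m" for i
    using f b coeff[OF z' that] unfolding left_module_hom_def by blast
  have "f z = f (\<Oplus>\<^bsub>Ker\<^esub>i\<in>{..<m}. z i \<odot>\<^bsub>Ker\<^esub> b i)"
    unfolding b_def by (subst kernel_expand[OF z(1)]) simp
  also have "\<dots> = (\<Oplus>\<^bsub>free_rank n\<^esub>i\<in>{..<m}. f (z i \<odot>\<^bsub>Ker\<^esub> b i))"
    using coeff[OF z'] b by (intro K.hom_finsum N f) (auto simp del: kernel_simps free_rank_simps intro!: K.smult_closed)
  finally have "f z 0 = (\<Oplus>\<^bsub>free_rank n\<^esub>i\<in>{..<m}. f (z i \<odot>\<^bsub>Ker\<^esub> b i)) 0"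
    by (rule fun_cong)
  also have "\<dots> = (\<Oplus>i\<in>{..<m}. f (z i \<odot>\<^bsub>Ker\<^esub> b i) 0)"
  proof (rule free_rank_finsum)
    fix i
    assume "i \<in> {..<m}"
    then have "z i \<odot>\<^bsub>Ker\<^esub> b i \<in> carrier Ker"
      using coeff[OF z'] b by (intro K.smult_closed) auto
    then show "f (z i \<odot>\<^bsub>Ker\<^esub> b i) \<in> carrier (free_rank n)"
      using f unfolding left_module_hom_def by blast
  qed (use \<open>n > 0\<close> in auto)
  also have "\<dots> = dot m z (\<lambda>i. f (b i) 0)"
    unfolding dot_def
  proof (rule finsum_cong')
    show "f (z i \<odot>\<^bsub>Ker\<^esub> b i) 0 = z i \<otimes> f (b i) 0" if "i \<in> {..<m}" for i
      unfolding f_smult[OF that[unfolded lessThan_iff]] using \<open>n > 0\<close> by simp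
  qed (use coeff[OF z'] fb0 in auto)
  finally have "dot m z (\<lambda>i. f (b i) 0) = \<one>"
    using z(2) \<open>n > 0\<close> by (simp add: basis_vector_def)
  then show ?thesis
    using z fb0 coeffs[OF z'] by (intro bexI[of _ z] bexI[of _ "\<lambda>i. f (b i) 0"]) auto
qed

text \<open>Adding a multiple of \<open>v\<close> identifies the left side with the free module of
  rank \<open>m\<close>, whose last coordinate is then split off. The inverse is given by
  \<open>kernel_proj\<close> and \<open>dot\<close>.\<close>

lemma direct_sum_kernel:
  assumes "m = Suc n"
  shows "left_module_isomorphic R (direct_sum Ker (regular_module R)) (direct_sum (free_rank n) (regular_module R))"
proof -
  let ?D = "direct_sum Ker (regular_module R)" and ?E = "direct_sum (free_rank n) (regular_module R)"
  define F where "F = (\<lambda>(x, s). (\<lambda>i\<in>{..<n}. x i \<oplus> s \<otimes> v i, x n \<oplus> s \<otimes> v n))"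
  define G where "G = (\<lambda>(y, c). let w = (\<lambda>i\<in>{..<m}. if i < n then y i else c)
      in (kernel_proj w, dot m w u))"
  have n: "n < m" "\<And>i. i < n \<Longrightarrow> i < m"
    using assms by auto
  have vn: "v n \<in> carrier R" and vi: "\<And>i. i < n \<Longrightarrow> v i \<in> carrier R"
    using v_closed n by auto
  have "F \<in> left_module_hom R ?D ?E"
    unfolding left_module_hom_def
  proof (intro CollectI conjI ballI)
    show "F \<in> carrier ?D \<rightarrow> carrier ?E"
      using vn vi n by (auto simp: F_def direct_sum_def regular_module_def PiE_iff)
    fix p
    assume p: "p \<in> carrier ?D"
    obtain x s where p_eq: "p = (x, s)"
      by (cases p)
    have xs: "\<And>i. i < n \<Longrightarrow> x i \<in> carrier R" "x n \<in> carrier R" "s \<in> carrier R"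
      using p n by (auto simp: p_eq direct_sum_def regular_module_def PiE_iff)
    show "F (p \<oplus>\<^bsub>?D\<^esub> q) = F p \<oplus>\<^bsub>?E\<^esub> F q" if q: "q \<in> carrier ?D" for q
    proof -
      obtain y t where q_eq: "q = (y, t)"
        by (cases q)
      have yt: "\<And>i. i < n \<Longrightarrow> y i \<in> carrier R" "y n \<in> carrier R" "t \<in> carrier R"
        using q n by (auto simp: q_eq direct_sum_def regular_module_def PiE_iff)
      show ?thesis
        using xs yt vn vi n
        by (auto simp: p_eq q_eq F_def direct_sum_def regular_module_def l_distr a_ac intro!: restrict_ext)
    qed
    show "F (r \<odot>\<^bsub>?D\<^esub> p) = r \<odot>\<^bsub>?E\<^esub> F p" if "r \<in> carrier R" for r
      using xs vn vi that n
      by (auto simp: p_eq F_def direct_sum_def regular_module_def r_distr m_assoc intro!: restrict_ext)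
  qed
  moreover have "bij_betw F (carrier ?D) (carrier ?E)"
  proof (rule bij_betw_byWitness[where f' = G])
    show "F ` carrier ?D \<subseteq> carrier ?E"
      using \<open>F \<in> left_module_hom R ?D ?E\<close> by (auto simp: left_module_hom_def)
    show "G ` carrier ?E \<subseteq> carrier ?D"
    proof (rule image_subsetI)
      fix q
      assume q: "q \<in> carrier ?E"
      obtain y c where q_eq: "q = (y, c)"
        by (cases q)
      define w where "w = (\<lambda>i\<in>{..<m}. if i < n then y i else c)"
      have "w \<in> carrier (free_rank m)"
        using q by (auto simp: w_def q_eq direct_sum_def regular_module_def PiE_iff)
      then show "G q \<in> carrier ?D"
        using kernel_proj_closed[of w] dot_u_closed[of w]
        by (simp add: G_def q_eq direct_sum_def regular_module_def Let_def flip: w_def)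
    qed
    show "\<forall>p\<in>carrier ?D. G (F p) = p"
    proof
      fix p
      assume p: "p \<in> carrier ?D"
      obtain x s where p_eq: "p = (x, s)"
        by (cases p)
      have x: "x \<in> carrier (free_rank m)" "dot m x u = \<zero>" and s: "s \<in> carrier R"
        using p by (auto simp: p_eq direct_sum_def regular_module_def)
      define w where "w = (\<lambda>i\<in>{..<m}. x i \<oplus> s \<otimes> v i)"
      have w: "dot m w u = s"
        using s by (simp add: w_def dot_add_smult_v[OF x(1)] x(2))
      have "kernel_proj w = x"
      proof
        fix i
        show "kernel_proj w i = x i"
        proof (cases "i < m")
          case True
          then have "kernel_proj w i = x i \<oplus> s \<otimes> v i \<oplus> (\<ominus> s) \<otimes> v i"
            unfolding kernel_proj_def w by (simp add: w_def)
          then show ?thesis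
            using True s coeff[OF x(1), of i] v_closed[of i] by (simp add: a_assoc l_minus r_neg)
        next
          case False
          then show ?thesis
            using x(1) by (simp add: kernel_proj_def PiE_iff extensional_def)
        qed
      qed
      moreover have "(\<lambda>i\<in>{..<m}. if i < n then (\<lambda>i\<in>{..<n}. x i \<oplus> s \<otimes> v i) i else x n \<oplus> s \<otimes> v n) = w"
        unfolding w_def by (rule restrict_ext) (auto simp: assms less_Suc_eq)
      ultimately show "G (F p) = p"
        by (simp add: F_def G_def p_eq w)
    qed
    show "\<forall>q\<in>carrier ?E. F (G q) = q"
    proof
      fix q
      assume q: "q \<in> carrier ?E"
      obtain y c where q_eq: "q = (y, c)"
        by (cases q)
      define w where "w = (\<lambda>i\<in>{..<m}. if i < n then y i else c)"
      have w: "w \<in> carrier (free_rank m)"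
        using q by (auto simp: w_def q_eq direct_sum_def regular_module_def PiE_iff)
      have eq: "kernel_proj w i \<oplus> dot m w u \<otimes> v i = w i" if "i < m" for i
        using that dot_u_closed[OF w] v_closed coeff[OF w]
        by (simp add: kernel_proj_def a_assoc l_minus l_neg)
      have y: "y \<in> extensional {..<n}"
        using q by (auto simp: q_eq direct_sum_def PiE_iff)
      have "(\<lambda>i\<in>{..<n}. kernel_proj w i \<oplus> dot m w u \<otimes> v i) = y"
      proof
        fix i
        show "(\<lambda>i\<in>{..<n}. kernel_proj w i \<oplus> dot m w u \<otimes> v i) i = y i"
        proof (cases "i < n")
          case True
          then show ?thesis
            using eq[of i] n by (simp add: w_def)
        next
          case False
          then show ?thesis
            using y by (simp add: extensional_def)
        qed
      qed
      moreover have "kernel_proj w n \<oplus> dot m w u \<otimes> v n = c"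
        using eq[of n] n by (simp add: w_def)
      moreover have "G q = (kernel_proj w, dot m w u)"
        unfolding G_def q_eq w_def Let_def by simp
      ultimately show "F (G q) = q"
        unfolding F_def q_eq by simp
    qed
  qed
  ultimately show ?thesis
    unfolding left_module_isomorphic_def by blast
qed

end

text \<open>The free module of rank \<open>0\<close> serves as the complement; its only element is
  the extensional function on the empty set, constantly \<open>undefined\<close>.\<close>

lemma free_rank_isomorphic_direct_sum_zero:
  "left_module_isomorphic R (free_rank n) (direct_sum (free_rank 0) (free_rank n))"
  unfolding left_module_isomorphic_def
proof (rule bexI)
  let ?f = "\<lambda>x. (\<lambda>i. undefined, x)"
  have zero: "carrier (free_rank 0) = {\<lambda>i. undefined}"
    "x \<oplus>\<^bsub>free_rank 0\<^esub> y = (\<lambda>i. undefined)" "r \<odot>\<^bsub>free_rank 0\<^esub> x = (\<lambda>i. undefined)" for x y r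
    by (simp_all add: free_module_of_rank_def restrict_def)
  show "bij_betw ?f (carrier (free_rank n)) (carrier (direct_sum (free_rank 0) (free_rank n)))"
    unfolding direct_sum_def by (rule bij_betw_byWitness[where f' = snd]) (auto simp only: zero partial_object.simps snd_conv)
  show "?f \<in> left_module_hom R (free_rank n) (direct_sum (free_rank 0) (free_rank n))"
    unfolding left_module_hom_def direct_sum_def
    by (auto simp only: zero partial_object.simps ring.simps module.simps prod.case mem_Times_iff fst_conv snd_conv singleton_iff)
qed

text \<open>Non-isomorphism comes from a stronger property: no linear form takes the value
  \<open>\<one>\<close> on the kernel.\<close>

theorem nonfree_column_kernel:
  assumes "u \<in> {..<Suc n} \<rightarrow> carrier R" "v \<in> {..<Suc n} \<rightarrow> carrier R" "dot (Suc n) v u = \<one>" "n > 0"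
    and "\<And>z h. z \<in> {..<Suc n} \<rightarrow> carrier R \<Longrightarrow> h \<in> {..<Suc n} \<rightarrow> carrier R \<Longrightarrow>
      dot (Suc n) z u = \<zero> \<Longrightarrow> dot (Suc n) z h \<noteq> \<one>"
  shows "\<exists>(P :: ('a, nat \<Rightarrow> 'a) module) (Q :: ('a, nat \<Rightarrow> 'a) module).
      left_module R P \<and> finitely_generated_module R P \<and> projective_module R P \<and>
      left_module R Q \<and> finitely_generated_module R Q \<and> projective_module R Q \<and>
      left_module_isomorphic R (direct_sum P (regular_module R)) (direct_sum Q (regular_module R)) \<and>
      (\<exists>Q0 :: ('a, nat \<Rightarrow> 'a) module. left_module R Q0 \<and>
        left_module_isomorphic R Q (direct_sum Q0 (free_module_of_rank R n))) \<and>
      \<not> left_module_isomorphic R P Q"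
proof -
  note uv = assms(1-3)
  have "\<not> left_module_isomorphic R (column_kernel (Suc n) u) (free_rank n)"
  proof
    assume "left_module_isomorphic R (column_kernel (Suc n) u) (free_rank n)"
    then obtain f where "f \<in> left_module_hom R (column_kernel (Suc n) u) (free_rank n)"
      "f ` carrier (column_kernel (Suc n) u) = carrier (free_rank n)"
      by (auto simp: left_module_isomorphic_def bij_betw_def simp del: free_rank_simps)
    from surjection_from_kernel[OF uv this assms(4)] show False
      using assms(5) by blast
  qed
  moreover have "\<exists>Q0 :: ('a, nat \<Rightarrow> 'a) module. left_module R Q0 \<and>
      left_module_isomorphic R (free_rank n) (direct_sum Q0 (free_rank n))"
    using left_module_free_module_of_rank[OF ring_axioms, of 0] free_rank_isomorphic_direct_sum_zero
    by (intro exI[of _ "free_rank 0"] conjI)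
  ultimately show ?thesis
    by - (rule exI[of _ "column_kernel (Suc n) u"], rule exI[of _ "free_rank n"], intro conjI
        left_module_kernel[OF uv] finitely_generated_kernel[OF uv] projective_kernel[OF uv]
        left_module_free_module_of_rank[OF ring_axioms] finitely_generated_free_rank projective_free_rank
        direct_sum_kernel[OF uv refl])
qed

end

section \<open>Unimodular columns from a sequence of unimodular pairs\<close>

primrec rprod :: "(nat \<Rightarrow> 'r::monoid_mult) \<Rightarrow> nat \<Rightarrow> 'r" where
  "rprod a 0 = 1"
| "rprod a (Suc i) = a i * rprod a i"

primrec lprod :: "(nat \<Rightarrow> 'r::monoid_mult) \<Rightarrow> nat \<Rightarrow> 'r" where
  "lprod a 0 = 1"
| "lprod a (Suc i) = lprod a i * a i"

text \<open>The column grows by replacing its last entry \<open>e\<close> by \<open>u1 n * e\<close>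
  and \<open>u2 n * e\<close>, so \<open>n\<close> pairs give one column of length
  \<open>n + 1\<close>. The row grows on the other side, whence the two orders of multiplication in
  \<open>rprod\<close> and \<open>lprod\<close>.\<close>

definition chain_column :: "(nat \<Rightarrow> 'r::monoid_mult) \<Rightarrow> (nat \<Rightarrow> 'r) \<Rightarrow> nat \<Rightarrow> nat \<Rightarrow> 'r" where
  "chain_column u1 u2 n i = (if i < n then u1 i * rprod u2 i else rprod u2 i)"

definition chain_row :: "(nat \<Rightarrow> 'r::monoid_mult) \<Rightarrow> (nat \<Rightarrow> 'r) \<Rightarrow> nat \<Rightarrow> nat \<Rightarrow> 'r" where
  "chain_row v1 v2 n i = (if i < n then lprod v2 i * v1 i else lprod v2 i)"

lemma chain_sum:
  "(\<Sum>i<Suc n. f i * chain_column u1 u2 n i) = (\<Sum>i<n. f i * (u1 i * rprod u2 i)) + f n * rprod u2 n"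
  for f :: "nat \<Rightarrow> 'r::ring_1"
  by (simp add: chain_column_def)

lemma chain_unimodular:
  fixes u1 u2 v1 v2 :: "nat \<Rightarrow> 'r::ring_1"
  assumes "\<And>i. v1 i * u1 i + v2 i * u2 i = 1"
  shows "(\<Sum>i<Suc n. chain_row v1 v2 n i * chain_column u1 u2 n i) = 1"
proof -
  have "(\<Sum>i<n. lprod v2 i * v1 i * (u1 i * rprod u2 i)) + lprod v2 n * rprod u2 n = 1"
  proof (induction n)
    case (Suc n)
    have "lprod v2 n * v1 n * (u1 n * rprod u2 n) + lprod v2 (Suc n) * rprod u2 (Suc n) =
        lprod v2 n * (v1 n * u1 n + v2 n * u2 n) * rprod u2 n"
      by (simp add: distrib_left distrib_right mult.assoc)
    then show ?case
      using Suc by (simp add: assms add.assoc)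
  qed simp
  then show ?thesis
    unfolding chain_sum by (simp add: chain_row_def)
qed

text \<open>The kernel of the long column decomposes into the kernels of the pairs. This is
  expressed through values of linear forms, which is how it is applied.\<close>

lemma chain_column_kernel:
  fixes u1 u2 v1 v2 z h :: "nat \<Rightarrow> 'r::ring_1"
  assumes uv: "\<And>i. v1 i * u1 i + v2 i * u2 i = 1"
  shows "(\<Sum>i<n. z i * (u1 i * rprod u2 i)) + c * rprod u2 n = 0 \<Longrightarrow>
    \<exists>\<alpha> \<beta> X Y. (\<Sum>i<n. z i * h i) + c * d = (\<Sum>j<n. \<alpha> j * X j + \<beta> j * Y j) \<and>
      (\<forall>j<n. \<alpha> j * u1 j + \<beta> j * u2 j = 0)"
proof (induction n arbitrary: c d)
  case (Suc n)
  \<comment> \<open>Merging the last two entries of the row through the last pair gives an element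
    of the kernel of the shorter column.\<close>
  define s where "s = z n * u1 n + c * u2 n"
  have "(\<Sum>i<n. z i * (u1 i * rprod u2 i)) + s * rprod u2 n = 0"
    using Suc.prems by (simp add: s_def distrib_right mult.assoc add.assoc)
  from Suc.IH[OF this, of "v1 n * h n + v2 n * d"] obtain \<alpha> \<beta> X Y where
    eq: "(\<Sum>i<n. z i * h i) + s * (v1 n * h n + v2 n * d) = (\<Sum>j<n. \<alpha> j * X j + \<beta> j * Y j)"
    and ker: "\<And>j. j < n \<Longrightarrow> \<alpha> j * u1 j + \<beta> j * u2 j = 0"
    by blast
  \<comment> \<open>What remains of these two entries after subtracting \<open>s\<close> times the
    row \<open>(v1 n, v2 n)\<close> lies in the kernel of the last pair.\<close>
  define a b where "a = z n - s * v1 n" and "b = c - s * v2 n"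
  have "a * u1 n + b * u2 n = s - s * (v1 n * u1 n + v2 n * u2 n)"
    by (simp add: a_def b_def left_diff_distrib distrib_left mult.assoc s_def)
  then have ab: "a * u1 n + b * u2 n = 0"
    by (simp add: uv)
  have "(\<Sum>i<Suc n. z i * h i) + c * d = ((\<Sum>i<n. z i * h i) + s * (v1 n * h n + v2 n * d)) + (a * h n + b * d)"
    by (simp add: a_def b_def left_diff_distrib distrib_left mult.assoc)
  also have "\<dots> = (\<Sum>j<Suc n. (\<alpha>(n := a)) j * (X(n := h n)) j + (\<beta>(n := b)) j * (Y(n := d)) j)"
    by (simp add: eq)
  finally show ?case
    using ker ab
    by (intro exI[of _ "\<alpha>(n := a)"] exI[of _ "\<beta>(n := b)"] exI[of _ "X(n := h n)"] exI[of _ "Y(n := d)"])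
      (auto simp: less_Suc_eq)
qed simp

section \<open>The non-free module\<close>

lemma ring_hom_id: "ring_hom_1 (\<lambda>x. x)"
  by standard auto

lemma ring_hom_of_int: "ring_hom_1 of_int"
  by standard auto

lemma (in ring_hom_1) minus: "c (- x) = - c x" and diff: "c (x - y) = c x - c y"
proof -
  show "c (- x) = - c x" for x
    using add[of "- x" x] by (simp add: zero eq_neg_iff_add_eq_0)
  then show "c (x - y) = c x - c y"
    using add[of x "- y"] by simp
qed

lemma (in ring_hom_1) rprod: "c (rprod a i) = rprod (\<lambda>i. c (a i)) i"
  by (induction i) (simp_all add: mult one)

lemma (in ring_hom_1) chain_column:
  "c (chain_column u1 u2 n i) = chain_column (\<lambda>i. c (u1 i)) (\<lambda>i. c (u2 i)) n i"
  by (simp add: chain_column_def mult rprod)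

definition factor_ring :: "nat \<Rightarrow> ('h::group_add \<Rightarrow>\<^sub>0 'a::ring_1) \<Rightarrow> ('h free_power \<Rightarrow>\<^sub>0 'a)" where
  "factor_ring j = pm_map (factor j) (\<lambda>x. x)"

lemma ring_hom_factor_ring: "ring_hom_1 (factor_ring j)"
  unfolding factor_ring_def by (rule ring_hom_1.pm_map_hom[OF ring_hom_id factor_add])

lemma factor_ring_single: "factor_ring j (single h c) = single (factor j h) c"
  unfolding factor_ring_def by (rule ring_hom_1.pm_map_single[OF ring_hom_id])

lemma keys_factor_ring: "keys (factor_ring j a) \<subseteq> range (factor j)"
proof
  fix k
  assume "k \<in> keys (factor_ring j a)"
  then have "lookup (factor_ring j a) k \<noteq> 0"
    by (simp add: in_keys_iff)
  then show "k \<in> range (factor j)"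
    unfolding factor_ring_def pm_map_def lookup_sum
    by (auto simp: lookup_single when_def elim!: sum.not_neutral_contains_not_neutral split: if_splits)
qed

lemma keys_factor_ring_mult:
  fixes X :: "'h::group_add free_power \<Rightarrow>\<^sub>0 'a::ring_1"
  assumes "k \<in> keys (factor_ring j a * X)"
  shows "\<exists>l. \<exists>m\<in>keys X. k = factor j l + m"
proof -
  obtain p m where "k = p + m" "p \<in> keys (factor_ring j a)" "m \<in> keys X"
    using assms keys_mult[of "factor_ring j a" X] by auto
  moreover from this obtain l where "p = factor j l"
    using keys_factor_ring[of j a] by blast
  ultimately show ?thesis
    by auto
qed

definition kv :: "klein \<Rightarrow>\<^sub>0 'a::ring_1" where
  "kv = kmon 1 0 - kb * kmon 0 1"

lemma klein_unimodular': "kv * kr + (kb * kr') * ks = (1 :: klein \<Rightarrow>\<^sub>0 'a::ring_1)"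
  unfolding kv_def by (rule klein_unimodular)

lemma factor_ring_unimodular:
  "factor_ring j kv * factor_ring j kr + factor_ring j (kb * kr') * factor_ring j ks = 1"
proof -
  interpret ring_hom_1 "factor_ring j"
    by (rule ring_hom_factor_ring)
  show ?thesis
    unfolding mult[symmetric] add[symmetric] klein_unimodular' by (rule one)
qed

text \<open>By \<open>chain_column_kernel\<close> the value \<open>1\<close> would be a sum of terms
  coming from the kernels of single pairs. Each such kernel is induced from
  \<open>klein_ideal\<close>, so the terms lie in the left ideal generated by linear images of that
  ideal, which does not contain \<open>1\<close>.\<close>

lemma no_unimodular_element:
  fixes z h :: "nat \<Rightarrow> (klein free_power \<Rightarrow>\<^sub>0 'a::field)"
  assumes "(\<Sum>i<Suc n. z i * chain_column (\<lambda>j. factor_ring j kr) (\<lambda>j. factor_ring j ks) n i) = 0"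
  shows "(\<Sum>i<Suc n. z i * h i) \<noteq> 1"
proof
  assume one: "(\<Sum>i<Suc n. z i * h i) = 1"
  let ?I = "klein_ideal :: (klein \<Rightarrow>\<^sub>0 'a) set"
  obtain \<alpha> \<beta> X Y where sum: "(\<Sum>i<n. z i * h i) + z n * h n = (\<Sum>j<n. \<alpha> j * X j + \<beta> j * Y j)"
    and ker: "\<And>j. j < n \<Longrightarrow> \<alpha> j * factor_ring j kr + \<beta> j * factor_ring j ks = 0"
    using chain_column_kernel[where ?u1.0 = "\<lambda>j. factor_ring j kr" and ?u2.0 = "\<lambda>j. factor_ring j ks",
        OF factor_ring_unimodular assms[unfolded chain_sum], of h "h n"] by blast
  \<comment> \<open>The second coordinate of the kernel element with first coordinate
    \<open>a\<close>. Its uniqueness makes it linear in \<open>a\<close> on the ideal.\<close>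
  define b :: "(klein \<Rightarrow>\<^sub>0 'a) \<Rightarrow> (klein \<Rightarrow>\<^sub>0 'a)" where "b a = (THE b. a * kr + b * ks = 0)" for a
  have "lookup (ks :: klein \<Rightarrow>\<^sub>0 'a) (Klein 0 0) \<noteq> 0"
    by (simp add: ks_def lookup_add lookup_single when_def)
  then have ks: "(ks :: klein \<Rightarrow>\<^sub>0 'a) \<noteq> 0"
    by auto
  have b_unique: "b a = c" if "a * kr + c * ks = 0" for a c
    unfolding b_def
  proof (rule the_equality)
    show "a * kr + c * ks = 0"
      by (rule that)
    fix c'
    assume "a * kr + c' * ks = 0"
    with that have "(c' - c) * ks = 0"
      by (metis add_left_imp_eq left_diff_distrib right_minus_eq)
    then show "c' = c"
      using klein_no_zero_divisors[of "c' - c" ks] ks by simp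
  qed
  have b: "a * kr + b a * ks = 0" if a: "a \<in> ?I" for a
  proof -
    obtain c where "a * kr = c * ks"
      using a by (auto simp: klein_ideal_def)
    then have "a * kr + (- c) * ks = 0"
      by simp
    with b_unique[OF this] show ?thesis
      by simp
  qed
  have b_add: "b (a + a') = b a + b a'" if a: "a \<in> ?I" "a' \<in> ?I" for a a'
  proof (rule b_unique)
    have "(a + a') * kr + (b a + b a') * ks = (a * kr + b a * ks) + (a' * kr + b a' * ks)"
      by (simp only: distrib_right add_ac)
    then show "(a + a') * kr + (b a + b a') * ks = 0"
      by (simp only: b a add_0)
  qed
  have b_mult: "b (c * a) = c * b a" if "a \<in> ?I" for a c
  proof (rule b_unique)
    have "c * a * kr + c * b a * ks = c * (a * kr + b a * ks)"
      by (simp add: distrib_left mult.assoc)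
    then show "c * a * kr + c * b a * ks = 0"
      by (simp add: b[OF that])
  qed
  define \<phi> where "\<phi> j a = factor_ring j a * X j + factor_ring j (b a) * Y j" for j a
  \<comment> \<open>Left multiplication by factor \<open>j\<close> preserves coset representatives,
    so \<open>X j\<close> and \<open>Y j\<close> bound the degrees of all values of
    \<open>\<phi> j\<close>. The inserted \<open>0\<close> covers the case of no keys, and
    \<open>Suc\<close> makes the bound strict.\<close>
  define D where "D j = Suc (Max (insert 0 ((\<lambda>k. fp_length (coset_rep j k)) ` (keys (X j) \<union> keys (Y j)))))" for j
  have "1 \<notin> left_ideal (\<Union>j<n. \<phi> j ` ?I)"
  proof (rule one_notin_left_ideal[OF rigid_klein_ideal])
    fix j
    interpret hom: ring_hom_1 "factor_ring j :: (klein \<Rightarrow>\<^sub>0 'a) \<Rightarrow> _"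
      by (rule ring_hom_factor_ring)
    show "factor_linear j ?I (\<phi> j)"
      by (simp add: factor_linear_def \<phi>_def b_add b_mult hom.add hom.mult factor_ring_single
          distrib_left distrib_right mult.assoc add_ac)
    fix a k
    assume k: "k \<in> keys (\<phi> j a)"
    have "k \<in> keys (factor_ring j a * X j) \<union> keys (factor_ring j (b a) * Y j)"
      using k Poly_Mapping.keys_add[of "factor_ring j a * X j" "factor_ring j (b a) * Y j"] by (auto simp: \<phi>_def)
    then obtain l m where "k = factor j l + m" "m \<in> keys (X j) \<union> keys (Y j)"
      using keys_factor_ring_mult[of k j a "X j"] keys_factor_ring_mult[of k j "b a" "Y j"] by auto
    then show "fp_length (coset_rep j k) < D j"
      by (auto simp: D_def coset_factor_plus less_Suc_eq_le intro!: Max_ge)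
  qed
  moreover have "\<alpha> j * X j + \<beta> j * Y j \<in> left_ideal (\<Union>j<n. \<phi> j ` ?I)" if j: "j < n" for j
  proof -
    interpret hom: ring_hom_1 "factor_ring j :: (klein \<Rightarrow>\<^sub>0 'a) \<Rightarrow> _"
      by (rule ring_hom_factor_ring)
    let ?v = "kb * kr' :: klein \<Rightarrow>\<^sub>0 'a"
    \<comment> \<open>The two rows of the matrix \<open>1 - u v\<close>, where \<open>u\<close> is
      the column \<open>(kr, ks)\<close> and \<open>v\<close> the row with \<open>v u = 1\<close>.
      They generate the kernel of \<open>u\<close>.\<close>
    have "(1 - kr * kv) * kr + (- (kr * ?v)) * ks = kr - kr * (kv * kr + ?v * ks)"
      "(- (ks * kv)) * kr + (1 - ks * ?v) * ks = ks - ks * (kv * kr + ?v * ks)"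
      by (simp_all add: left_diff_distrib distrib_left mult.assoc)
    then have *: "(1 - kr * kv) * kr + (- (kr * ?v)) * ks = 0" "(- (ks * kv)) * kr + (1 - ks * ?v) * ks = 0"
      by (simp_all only: klein_unimodular' mult_1_right diff_self)
    have "x \<in> ?I" if "x * kr + y * ks = 0" for x y
      unfolding klein_ideal_def using that by (intro CollectI exI[of _ "- y"]) (simp add: eq_neg_iff_add_eq_0)
    from this[OF *(1)] this[OF *(2)]
    have gen: "\<alpha> j * \<phi> j (1 - kr * kv) \<in> left_ideal (\<Union>j<n. \<phi> j ` ?I)"
      "\<beta> j * \<phi> j (- (ks * kv)) \<in> left_ideal (\<Union>j<n. \<phi> j ` ?I)"
      using j by (auto intro!: left_ideal_gen)
    let ?u = "factor_ring j kr :: klein free_power \<Rightarrow>\<^sub>0 'a" and ?u' = "factor_ring j ks :: klein free_power \<Rightarrow>\<^sub>0 'a"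
    \<comment> \<open>Combining the rows with coefficients \<open>\<alpha> j\<close> and
      \<open>\<beta> j\<close> gives the desired term up to a multiple of \<open>?w\<close>, which
      vanishes by \<open>ker\<close>.\<close>
    let ?w = "factor_ring j kv * X j + factor_ring j ?v * Y j"
    have "\<alpha> j * \<phi> j (1 - kr * kv) = \<alpha> j * X j - \<alpha> j * ?u * ?w"
      "\<beta> j * \<phi> j (- (ks * kv)) = \<beta> j * Y j - \<beta> j * ?u' * ?w"
      unfolding \<phi>_def *[THEN b_unique]
      by (simp_all only: hom.mult[of kr] hom.mult[of ks] hom.minus hom.diff hom.one)
        (simp_all add: algebra_simps)
    then have "\<alpha> j * \<phi> j (1 - kr * kv) + \<beta> j * \<phi> j (- (ks * kv)) =
        \<alpha> j * X j + \<beta> j * Y j - (\<alpha> j * ?u + \<beta> j * ?u') * ?w"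
      by (simp add: distrib_right)
    then show ?thesis
      using left_ideal_add[OF gen(2,1)] by (simp add: ker[OF j])
  qed
  then have "(\<Sum>j<n. \<alpha> j * X j + \<beta> j * Y j) \<in> left_ideal (\<Union>j<n. \<phi> j ` ?I)"
    by (intro left_ideal_sum) auto
  ultimately show False
    using one sum by simp
qed

section \<open>Change of coefficients and transport to the natural numbers\<close>

lemma (in ring_hom_1) pm_map_compose:
  assumes "ring_hom_1 c'"
  shows "pm_map g' c' (pm_map g c f) = pm_map (\<lambda>x. g' (g x)) (\<lambda>x. c' (c x)) f"
proof -
  interpret c': ring_hom_1 c' by fact
  interpret cc: ring_hom_1 "\<lambda>x. c' (c x)"
    by standard (simp_all add: add mult one c'.add c'.mult c'.one)
  show ?thesis
    by (induction f rule: poly_mapping_additive_induct)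
      (simp_all add: pm_map_single c'.pm_map_single cc.pm_map_single pm_map_add c'.pm_map_add cc.pm_map_add)
qed

lemma coefficient_map_factor_ring:
  "pm_map (\<lambda>x. x) of_int (factor_ring j f) = factor_ring j (pm_map (\<lambda>x. x) of_int f :: _ \<Rightarrow>\<^sub>0 'a::ring_1)"
  unfolding factor_ring_def
  by (simp add: ring_hom_1.pm_map_compose[OF ring_hom_id ring_hom_of_int]
      ring_hom_1.pm_map_compose[OF ring_hom_of_int ring_hom_id])

lemma coefficient_map_klein:
  "pm_map (\<lambda>x. x) of_int kr = (kr :: klein \<Rightarrow>\<^sub>0 'a::ring_1)"
  "pm_map (\<lambda>x. x) of_int ks = (ks :: klein \<Rightarrow>\<^sub>0 'a::ring_1)"
proof -
  interpret hom: ring_hom_1 "pm_map (\<lambda>x. x) of_int :: (klein \<Rightarrow>\<^sub>0 int) \<Rightarrow> (klein \<Rightarrow>\<^sub>0 'a)"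
    by (rule ring_hom_1.pm_map_hom[OF ring_hom_of_int]) simp
  show "pm_map (\<lambda>x. x) of_int kr = (kr :: klein \<Rightarrow>\<^sub>0 'a::ring_1)"
    "pm_map (\<lambda>x. x) of_int ks = (ks :: klein \<Rightarrow>\<^sub>0 'a::ring_1)"
    by (simp_all add: kr_def ks_def hom.add hom.diff ring_hom_1.pm_map_single[OF ring_hom_of_int])
qed

text \<open>Being countable and infinite, the group is in bijection with the natural numbers, so its
  structure can be carried over to all of \<open>nat\<close>.\<close>

lemma infinite_klein_free_power: "infinite (UNIV :: klein free_power set)"
proof -
  have "inj (\<lambda>m. factor 0 (Klein (int m) 0))"
  proof (rule injI)
    fix m n
    assume "factor 0 (Klein (int m) 0) = factor 0 (Klein (int n) 0)"
    then show "m = n"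
      unfolding word_inject[symmetric] word_factor by (auto simp: zero_klein_def split: if_splits)
  qed
  then show ?thesis
    by (meson finite_imageD finite_subset infinite_UNIV_nat top_greatest)
qed

theorem theoremA:
  fixes k :: nat
  assumes "k \<ge> 2"
  shows "\<exists>(G :: nat monoid)
            (P :: (nat \<Rightarrow>\<^sub>0 int, nat \<Rightarrow> nat \<Rightarrow>\<^sub>0 int) module)
            (Q :: (nat \<Rightarrow>\<^sub>0 int, nat \<Rightarrow> nat \<Rightarrow>\<^sub>0 int) module).
      group G \<and>
      left_module (integral_group_ring G) P \<and>
      finitely_generated_module (integral_group_ring G) P \<and>
      projective_module (integral_group_ring G) P \<and>
      left_module (integral_group_ring G) Q \<and>
      finitely_generated_module (integral_group_ring G) Q \<and>
      projective_module (integral_group_ring G) Q \<and>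
      left_module_isomorphic (integral_group_ring G)
        (direct_sum P (regular_module (integral_group_ring G)))
        (direct_sum Q (regular_module (integral_group_ring G))) \<and>
      (\<exists>Q0 :: (nat \<Rightarrow>\<^sub>0 int, nat \<Rightarrow> nat \<Rightarrow>\<^sub>0 int) module.
        left_module (integral_group_ring G) Q0 \<and>
        left_module_isomorphic (integral_group_ring G)
          Q (direct_sum Q0 (free_module_of_rank (integral_group_ring G) k))) \<and>
      \<not> left_module_isomorphic (integral_group_ring G) P Q"
proof -
  obtain e :: "klein free_power \<Rightarrow> nat" where e: "bij e"
    using to_nat_on_infinite[OF countableI_type infinite_klein_free_power] by blast
  define d where "d = inv_into UNIV e"
  have e_inv [simp]: "d (e g) = g" "e (d m) = m" for g m
    using e by (simp_all add: d_def bij_is_inj bij_is_surj surj_f_inv_f)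
  define G :: "nat monoid" where
    "G = \<lparr>carrier = UNIV, monoid.mult = (\<lambda>a b. e (d a + d b)), one = e 0\<rparr>"
  have G_simps: "carrier G = UNIV" "a \<otimes>\<^bsub>G\<^esub> b = e (d a + d b)" "\<one>\<^bsub>G\<^esub> = e 0" for a b
    by (simp_all add: G_def)
  have "group G"
  proof (rule groupI)
    fix x
    show "\<exists>y\<in>carrier G. y \<otimes>\<^bsub>G\<^esub> x = \<one>\<^bsub>G\<^esub>"
      by (intro bexI[of _ "e (- d x)"]) (simp_all add: G_simps)
  qed (simp_all add: G_simps add.assoc)
  let ?R = "integral_group_ring G"
  interpret R: ring ?R
    using \<open>group G\<close> by (rule ring_integral_group_ring)
  have R_simps: "carrier ?R = UNIV" "x \<otimes>\<^bsub>?R\<^esub> y = group_ring_mult G x y" "x \<oplus>\<^bsub>?R\<^esub> y = x + y"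
    "\<one>\<^bsub>?R\<^esub> = single (e 0) 1" "\<zero>\<^bsub>?R\<^esub> = 0" for x y
    by (simp_all add: integral_group_ring_def G_simps)
  have finsum: "finsum ?R f A = sum f A" if "finite A" for f and A :: "nat set"
    using that by (induction A rule: finite_induct) (simp_all add: R_simps)
  \<comment> \<open>\<open>\<Psi>\<close> carries elements built over the free power into the group
    ring of \<open>G\<close>. \<open>\<Phi>\<close> goes back and enlarges the coefficients to the
    rationals, because \<open>no_unimodular_element\<close> needs a field.\<close>
  define \<Psi> :: "(klein free_power \<Rightarrow>\<^sub>0 int) \<Rightarrow> (nat \<Rightarrow>\<^sub>0 int)" where "\<Psi> = pm_map e (\<lambda>x. x)"
  define \<Phi> :: "(nat \<Rightarrow>\<^sub>0 int) \<Rightarrow> (klein free_power \<Rightarrow>\<^sub>0 rat)" where "\<Phi> = pm_map d of_int"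
  have \<Psi>_add: "\<Psi> (f + g) = \<Psi> f + \<Psi> g" and \<Psi>_single: "\<Psi> (single h c) = single (e h) c" for f g h c
    by (simp_all add: \<Psi>_def ring_hom_1.pm_map_add[OF ring_hom_id] ring_hom_1.pm_map_single[OF ring_hom_id])
  have \<Phi>_add: "\<Phi> (f + g) = \<Phi> f + \<Phi> g" and \<Phi>_single: "\<Phi> (single m c) = single (d m) (of_int c)" for f g m c
    by (simp_all add: \<Phi>_def ring_hom_1.pm_map_add[OF ring_hom_of_int] ring_hom_1.pm_map_single[OF ring_hom_of_int])
  have \<Psi>_mult: "\<Psi> (f * g) = group_ring_mult G (\<Psi> f) (\<Psi> g)" for f g
  proof (induction f rule: poly_mapping_additive_induct)
    case (single h c)
    show ?case
      by (induction g rule: poly_mapping_additive_induct)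
        (simp_all add: mult_single \<Psi>_single \<Psi>_add group_ring_mult_single group_ring_mult_add_right
          distrib_left G_simps)
  qed (simp add: distrib_right \<Psi>_add group_ring_mult_add_left)
  have \<Phi>_mult: "\<Phi> (group_ring_mult G f g) = \<Phi> f * \<Phi> g" for f g
  proof (induction f rule: poly_mapping_additive_induct)
    case (single h c)
    show ?case
      by (induction g rule: poly_mapping_additive_induct)
        (simp_all add: mult_single \<Phi>_single \<Phi>_add group_ring_mult_single group_ring_mult_add_right
          distrib_left G_simps)
  qed (simp add: distrib_right \<Phi>_add group_ring_mult_add_left)
  have \<Psi>_zero: "\<Psi> 0 = 0" and \<Phi>_zero: "\<Phi> 0 = 0"
    by (simp_all add: \<Psi>_def \<Phi>_def pm_map_def)
  have \<Psi>_sum: "\<Psi> (sum f A) = (\<Sum>i\<in>A. \<Psi> (f i))" and \<Phi>_sum: "\<Phi> (sum f' A) = (\<Sum>i\<in>A. \<Phi> (f' i))"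
    for f f' and A :: "nat set"
    by (induction A rule: infinite_finite_induct) (simp_all add: \<Psi>_zero \<Psi>_add \<Phi>_zero \<Phi>_add)
  have \<Phi>\<Psi>: "\<Phi> (\<Psi> f) = pm_map (\<lambda>x. x) of_int f" for f
    by (simp add: \<Phi>_def \<Psi>_def ring_hom_1.pm_map_compose[OF ring_hom_id ring_hom_of_int])
  define u where "u i = \<Psi> (chain_column (\<lambda>j. factor_ring j kr) (\<lambda>j. factor_ring j ks) k i)" for i
  define v where "v i = \<Psi> (chain_row (\<lambda>j. factor_ring j kv) (\<lambda>j. factor_ring j (kb * kr')) k i)" for i
  have \<Phi>u: "\<Phi> (u i) = chain_column (\<lambda>j. factor_ring j kr) (\<lambda>j. factor_ring j ks) k i" for i
  proof -
    interpret hom: ring_hom_1 "pm_map (\<lambda>x. x) of_int :: (klein free_power \<Rightarrow>\<^sub>0 int) \<Rightarrow> (klein free_power \<Rightarrow>\<^sub>0 rat)"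
      by (rule ring_hom_1.pm_map_hom[OF ring_hom_of_int]) simp
    show ?thesis
      by (simp add: u_def \<Phi>\<Psi> hom.chain_column coefficient_map_factor_ring coefficient_map_klein)
  qed
  have dot: "R.dot m x y = (\<Sum>i<m. group_ring_mult G (x i) (y i))" for m x y
    by (simp add: R.dot_def finsum R_simps)
  have "R.dot (Suc k) v u = \<Psi> 1"
    unfolding dot u_def v_def \<Psi>_mult[symmetric] \<Psi>_sum[symmetric]
    by (simp only: chain_unimodular[OF factor_ring_unimodular])
  also have "\<dots> = \<one>\<^bsub>?R\<^esub>"
    using \<Psi>_single[of 0 1] by (simp add: R_simps)
  finally have "R.dot (Suc k) v u = \<one>\<^bsub>?R\<^esub>" .
  \<comment> \<open>A linear form with value \<open>1\<close> on the integral kernel would give one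
    over the rationals.\<close>
  moreover have "R.dot (Suc k) z h \<noteq> \<one>\<^bsub>?R\<^esub>" if "R.dot (Suc k) z u = \<zero>\<^bsub>?R\<^esub>" for z h
  proof
    assume "R.dot (Suc k) z h = \<one>\<^bsub>?R\<^esub>"
    then have "\<Phi> (\<Sum>i<Suc k. group_ring_mult G (z i) (h i)) = \<Phi> (single (e 0) 1)"
      by (simp only: dot R_simps)
    then have "(\<Sum>i<Suc k. \<Phi> (z i) * \<Phi> (h i)) = 1"
      by (simp only: \<Phi>_sum \<Phi>_mult \<Phi>_single e_inv of_int_1 single_one)
    moreover have "\<Phi> (\<Sum>i<Suc k. group_ring_mult G (z i) (u i)) = \<Phi> 0"
      using that by (simp only: dot R_simps)
    then have "(\<Sum>i<Suc k. \<Phi> (z i) * \<Phi> (u i)) = 0"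
      by (simp only: \<Phi>_sum \<Phi>_mult \<Phi>_zero)
    ultimately show False
      using no_unimodular_element[of "\<lambda>i. \<Phi> (z i)" k "\<lambda>i. \<Phi> (h i)"] unfolding \<Phi>u by blast
  qed
  ultimately have "\<exists>(P :: (nat \<Rightarrow>\<^sub>0 int, nat \<Rightarrow> nat \<Rightarrow>\<^sub>0 int) module)
      (Q :: (nat \<Rightarrow>\<^sub>0 int, nat \<Rightarrow> nat \<Rightarrow>\<^sub>0 int) module). left_module ?R P \<and> finitely_generated_module ?R P \<and> projective_module ?R P \<and>
      left_module ?R Q \<and> finitely_generated_module ?R Q \<and> projective_module ?R Q \<and>
      left_module_isomorphic ?R (direct_sum P (regular_module ?R)) (direct_sum Q (regular_module ?R)) \<and>
      (\<exists>Q0 :: (nat \<Rightarrow>\<^sub>0 int, nat \<Rightarrow> nat \<Rightarrow>\<^sub>0 int) module. left_module ?R Q0 \<and>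
        left_module_isomorphic ?R Q (direct_sum Q0 (free_module_of_rank ?R k))) \<and>
      \<not> left_module_isomorphic ?R P Q"
    using assms by (intro R.nonfree_column_kernel[of u k v]) (auto simp: R_simps)
  with \<open>group G\<close> show ?thesis
    by blast
qed

end
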